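(* Any formal deformation of the $\mathfrak{vect}(1)$-module $\mathcal{S}^4_5=\mathcal{F}_5\oplus\mathcal{F}_4\oplus\mathcal{F}_3\oplus\mathcal{F}_2\oplus\mathcal{F}_1$ is equivalent to a polynomial one (in the deformation parameters) of degree $\le3$.
   Context: $\mathfrak{vect}(1)$ is the Lie algebra of polynomial vector fields $X\frac{d}{dx}$, $X\in\mathbb{R}[x]$. $\mathcal{F}_\lambda=\{f\,dx^\lambda: f\in\mathbb{R}[x]\}$ with action $L^\lambda_X(f)=Xf'+\lambda X'f$; $L_X$ is the resulting action on $\mathcal{S}^4_5$. Define (extended by $0$ to $\mathcal{S}^4_5$), as maps $\mathcal{F}_\lambda\to\mathcal{F}_{\lambda+k}$ for $k=0,2,3,4$: $C_{\lambda,\lambda}(X)(f)=X'f$, $C_{\lambda,\lambda+2}(X)(f)=X^{(3)}f+2X''f'$, $C_{\lambda,\lambda+3}(X)(f)=X^{(3)}f'+X''f''$, $C_{\lambda,\lambda+4}(X)(f)=-\lambda X^{(5)}f+X^{(4)}f'-6X^{(3)}f''-4X''f^{(3)}$. Infinitesimal deformations of $\mathcal{S}^4_5$ are $L_X+\mathcal{L}^{(1)}_X$ with $$\mathcal{L}_X^{(1)}=\big(t_{1,1}C_{1,1}+t_{1,3}C_{1,3}+t_{1,4}C_{1,4}+t_{1,5}C_{1,5}+t_{2,2}C_{2,2}+t_{2,4}C_{2,4}+t_{2,5}C_{2,5}+t_{3,3}C_{3,3}+t_{3,5}C_{3,5}+t_{4,4}C_{4,4}+t_{5,5}C_{5,5}\big)(X).$$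 A formal deformation is a formal series $\mathcal{L}_X=L_X+\mathcal{L}_X^{(1)}+\mathcal{L}_X^{(2)}+\cdots$ with this first-order term and $\mathcal{L}^{(m)}$ homogeneous of degree $m$ in the parameters with values in differential operators on $\mathcal{S}^4_5$, where the parameters are subject to an ideal $\mathcal{R}$ of relations, such that $[\mathcal{L}_X,\mathcal{L}_Y]=\mathcal{L}_{[X,Y]}$ holds over the base $\mathcal{A}=\mathbb{C}[[t]]/\mathcal{R}$. It is polynomial of degree $\le3$ if $\mathcal{L}^{(m)}=0$ for $m\ge4$. Two deformations $\rho,\rho'$ with the same base $\mathcal{A}$ are equivalent if there is an inner automorphism $\Psi$ of the associative algebra $\mathrm{End}(\mathcal{S}^4_5)\otimes\mathcal{A}$ with $\Psi\circ\rho=\rho'$ and $\Psi(\mathbb{I})=\mathbb{I}$.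
   Formalization: With the parameters kept fixed the claim fails (replace F_1 by F_{1+t+t^5}, all parameters but t=t_{1,1} zero); here the equivalent deformation over the same base is polynomial of degree ≤3 in new deformation parameters t_p + (terms of degree ≥2). *)

theory Defs
  imports "HOL-Analysis.Finite_Cartesian_Product" "HOL-Computational_Algebra.Polynomial"
begin

section \<open>Formal power series in finitely many variables\<close>

text \<open>
  The type \<open>('v, 'a) mfps\<close> is the ring of formal power series with coefficients in \<open>'a\<close> in commuting
  variables \<open>t\<^sub>v\<close>, one for each \<open>v\<close> of the finite type \<open>'v\<close>; the variables commute with the
  coefficients. A monomial is given by its exponents \<open>a :: 'v \<Rightarrow> nat\<close>.
\<close>

typedef ('v, 'a) mfps = "UNIV :: (('v \<Rightarrow> nat) \<Rightarrow> 'a) set"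
  morphisms mcoeff MFPS by simp

lemmas mcoeff_MFPS [simp] = MFPS_inverse [OF UNIV_I]

lemma mfps_eqI: "(\<And>a. mcoeff f a = mcoeff g a) \<Longrightarrow> f = g"
  by (metis ext mcoeff_inject)

definition mdeg :: "('v::finite \<Rightarrow> nat) \<Rightarrow> nat" where
  "mdeg a = (\<Sum>v\<in>UNIV. a v)"

definition mconst :: "'a::zero \<Rightarrow> ('v, 'a) mfps" where
  "mconst c = MFPS (\<lambda>a. if a = (\<lambda>_. 0) then c else 0)"

definition mvar :: "'v \<Rightarrow> ('v, 'a::zero_neq_one) mfps" where
  "mvar v = MFPS (\<lambda>a. if a = (\<lambda>w. if w = v then 1 else 0) then 1 else 0)"

lemma finite_exponents_le: "finite {b :: 'v::finite \<Rightarrow> nat. b \<le> a}"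
proof (rule finite_subset)
  show "{b. b \<le> a} \<subseteq> (\<Pi>\<^sub>E v\<in>UNIV. {..a v})"
    by (auto simp: le_fun_def PiE_def)
  show "finite (\<Pi>\<^sub>E v\<in>UNIV. {..a v})"
    by (rule finite_PiE) auto
qed

lemma exponents_diff_cancel: "b \<le> a \<Longrightarrow> a - (a - b) = (b :: 'v \<Rightarrow> nat)"
  by (auto simp: le_fun_def fun_eq_iff)

instantiation mfps :: (finite, ring_1) ring_1
begin

definition "0 = MFPS (\<lambda>_. 0)"
definition "1 = mconst 1"
definition "f + g = MFPS (\<lambda>a. mcoeff f a + mcoeff g a)"
definition "f - g = MFPS (\<lambda>a. mcoeff f a - mcoeff g a)"
definition "- f = MFPS (\<lambda>a. - mcoeff f a)"
definition "f * g = MFPS (\<lambda>a. \<Sum>b | b \<le> a. mcoeff f b * mcoeff g (a - b))"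

instance
proof
  fix f g h :: "('a, 'b) mfps"
  show "f * g * h = f * (g * h)"
  proof (rule mfps_eqI)
    fix a
    have "mcoeff (f * g * h) a =
        (\<Sum>b | b \<le> a. \<Sum>c | c \<le> b. mcoeff f c * mcoeff g (b - c) * mcoeff h (a - b))"
      by (simp add: times_mfps_def sum_distrib_right)
    also have "\<dots> = (\<Sum>(b, c) \<in> (SIGMA b:{b. b \<le> a}. {c. c \<le> b}).
        mcoeff f c * mcoeff g (b - c) * mcoeff h (a - b))"
      by (rule sum.Sigma) (auto simp: finite_exponents_le)
    also have "\<dots> = (\<Sum>(c, d) \<in> (SIGMA c:{c. c \<le> a}. {d. d \<le> a - c}).
        mcoeff f c * (mcoeff g d * mcoeff h (a - c - d)))"
    proof (rule sum.reindex_bij_witness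
        [where j = "\<lambda>(b, c). (c, b - c)" and i = "\<lambda>(c, d). (\<lambda>v. c v + d v, c)"], goal_cases)
      case (5 x)
      obtain b c where x: "x = (b, c)" by force
      with 5 have "c \<le> b" by auto
      then have "a - c - (b - c) = a - b"
        by (auto simp: fun_eq_iff le_fun_def)
      then show ?case by (simp add: x mult.assoc)
    next
      case (4 x)
      then obtain c d where "x = (c, d)" "c \<le> a" "d \<le> a - c" by auto
      then show ?case
        by (auto simp: le_fun_def) (metis add.commute le_diff_conv2)
    qed (auto simp: le_fun_def fun_eq_iff intro!: diff_le_mono intro: order_trans)
    also have "\<dots> = (\<Sum>c | c \<le> a. \<Sum>d | d \<le> a - c.
        mcoeff f c * (mcoeff g d * mcoeff h (a - c - d)))"
      by (rule sum.Sigma [symmetric]) (auto simp: finite_exponents_le)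
    also have "\<dots> = mcoeff (f * (g * h)) a"
      by (simp add: times_mfps_def sum_distrib_left)
    finally show "mcoeff (f * g * h) a = mcoeff (f * (g * h)) a" .
  qed
  show "1 * f = f"
  proof (rule mfps_eqI)
    fix a
    have "mcoeff (1 * f) a = (\<Sum>b | b \<le> a. if b = (\<lambda>_. 0) then mcoeff f (a - b) else 0)"
      by (simp add: times_mfps_def one_mfps_def mconst_def if_distrib [of "\<lambda>c. c * _"] cong: if_cong)
    also have "\<dots> = mcoeff f (a - (\<lambda>_. 0))"
      using finite_exponents_le [of a] by (subst sum.delta) (simp_all add: le_fun_def)
    also have "a - (\<lambda>_. 0) = a" by auto
    finally show "mcoeff (1 * f) a = mcoeff f a" .
  qed
  show "f * 1 = f"
  proof (rule mfps_eqI)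
    fix a
    have "mcoeff (f * 1) a = (\<Sum>b | b \<le> a. if b = a then mcoeff f b else 0)"
      unfolding times_mfps_def one_mfps_def mconst_def
      by (auto intro!: sum.cong simp: fun_eq_iff le_fun_def) (metis le_antisym)+
    also have "\<dots> = mcoeff f a"
      by (subst sum.delta) (auto simp: finite_exponents_le)
    finally show "mcoeff (f * 1) a = mcoeff f a" .
  qed
  show "(f + g) * h = f * h + g * h"
    by (rule mfps_eqI) (simp add: times_mfps_def plus_mfps_def distrib_right sum.distrib)
  show "f * (g + h) = f * g + f * h"
    by (rule mfps_eqI) (simp add: times_mfps_def plus_mfps_def distrib_left sum.distrib)
  show "(0 :: ('a, 'b) mfps) \<noteq> 1"
  proof
    assume "(0 :: ('a, 'b) mfps) = 1"
    then have "mcoeff (0 :: ('a, 'b) mfps) (\<lambda>_. 0) = mcoeff 1 (\<lambda>_. 0)" by simp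
    then show False by (simp add: zero_mfps_def one_mfps_def mconst_def)
  qed
qed (auto intro!: mfps_eqI simp: plus_mfps_def zero_mfps_def minus_mfps_def uminus_mfps_def
     algebra_simps)

end

instance mfps :: (finite, comm_ring_1) comm_ring_1
proof
  fix f g :: "('a, 'b) mfps"
  show "f * g = g * f"
  proof (rule mfps_eqI)
    fix a
    have "(\<Sum>b | b \<le> a. mcoeff f b * mcoeff g (a - b)) =
        (\<Sum>b | b \<le> a. mcoeff g b * mcoeff f (a - b))"
      by (rule sum.reindex_bij_witness [where i = "\<lambda>b. a - b" and j = "\<lambda>b. a - b"])
        (auto simp: exponents_diff_cancel mult.commute le_fun_def)
    then show "mcoeff (f * g) a = mcoeff (g * f) a"
      by (simp add: times_mfps_def)
  qed
qed (simp_all add: distrib_right)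

definition hom_part :: "nat \<Rightarrow> ('v::finite, 'a::zero) mfps \<Rightarrow> ('v, 'a) mfps" where
  "hom_part m f = MFPS (\<lambda>a. if mdeg a = m then mcoeff f a else 0)"

definition is_ideal :: "'a::comm_ring_1 set \<Rightarrow> bool" where
  "is_ideal R \<longleftrightarrow> 0 \<in> R \<and> (\<forall>f\<in>R. \<forall>g\<in>R. f + g \<in> R) \<and> (\<forall>f. \<forall>g\<in>R. f * g \<in> R)"


section \<open>Tensor densities and the module of symbols\<close>

text \<open>The polynomial \<open>X\<close> stands for the vector field \<open>X d/dx\<close>.\<close>

definition vect_bracket :: "real poly \<Rightarrow> real poly \<Rightarrow> real poly" where
  "vect_bracket X Y = X * pderiv Y - pderiv X * Y"

text \<open>
  The base of a deformation is a complex algebra, so operators on the real module \<open>\<S>\<close> occur only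
  tensored with the complex numbers, and the tensor product of \<open>End(\<S>)\<close> with the complex numbers is
  the algebra of complex linear endomorphisms of the complexification of \<open>\<S>\<close>. Hence densities have
  complex coefficients here, while vector fields remain real.
\<close>

definition Dx :: "nat \<Rightarrow> real poly \<Rightarrow> complex poly" where
  "Dx n X = map_poly of_real ((pderiv ^^ n) X)"

definition lie_density :: "nat \<Rightarrow> real poly \<Rightarrow> complex poly \<Rightarrow> complex poly" where
  "lie_density l X f = Dx 0 X * pderiv f + of_nat l * Dx 1 X * f"

text \<open>\<open>cocycle l m\<close> is \<open>C\<^bsub>l,m\<^esub>\<close>; only the differences \<open>m - l \<in> {0, 2, 3, 4}\<close> are meaningful.\<close>

definition cocycle :: "nat \<Rightarrow> nat \<Rightarrow> real poly \<Rightarrow> complex poly \<Rightarrow> complex poly" where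
  "cocycle l m X f =
    (if m = l then Dx 1 X * f
     else if m = l + 2 then Dx 3 X * f + 2 * Dx 2 X * pderiv f
     else if m = l + 3 then Dx 3 X * pderiv f + Dx 2 X * (pderiv ^^ 2) f
     else if m = l + 4 then
       - of_nat l * Dx 5 X * f + Dx 4 X * pderiv f
       - 6 * Dx 3 X * (pderiv ^^ 2) f - 4 * Dx 2 X * (pderiv ^^ 3) f
     else 0)"

datatype weight = W1 | W2 | W3 | W4 | W5

lemma UNIV_weight: "UNIV = {W1, W2, W3, W4, W5}"
  using weight.exhaust by auto

instance weight :: finite
  by standard (simp add: UNIV_weight)

fun wt :: "weight \<Rightarrow> nat" where
  "wt W1 = 1" | "wt W2 = 2" | "wt W3 = 3" | "wt W4 = 4" | "wt W5 = 5"

text \<open>The component \<open>u $ i\<close> of a symbol \<open>u\<close> lies in the density module of weight \<open>wt i\<close>.\<close>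

type_synonym symbols = "complex poly ^ weight"

definition scale_symbols :: "complex \<Rightarrow> symbols \<Rightarrow> symbols" where
  "scale_symbols c u = (\<chi> i. smult c (u $ i))"

definition clinear_symbols :: "(symbols \<Rightarrow> symbols) \<Rightarrow> bool" where
  "clinear_symbols A \<longleftrightarrow>
    (\<forall>u v. A (u + v) = A u + A v) \<and> (\<forall>c u. A (scale_symbols c u) = scale_symbols c (A u))"

typedef endo = "{A. clinear_symbols A}"
  morphisms app Endo
  by (rule exI [of _ id]) (simp add: clinear_symbols_def)

lemma app_linear: "clinear_symbols (app A)"
  using app by simp

lemma app_add: "app A (u + v) = app A u + app A v"
  and app_scale: "app A (scale_symbols c u) = scale_symbols c (app A u)"
  using app_linear by (auto simp: clinear_symbols_def)

lemma app_Endo: "clinear_symbols A \<Longrightarrow> app (Endo A) = A"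
  by (simp add: Endo_inverse)

lemma endo_eqI: "(\<And>u. app A u = app B u) \<Longrightarrow> A = B"
  by (metis ext app_inject)

instantiation endo :: ring_1
begin

definition "0 = Endo (\<lambda>_. 0)"
definition "1 = Endo (\<lambda>u. u)"
definition "A + B = Endo (\<lambda>u. app A u + app B u)"
definition "A - B = Endo (\<lambda>u. app A u - app B u)"
definition "- A = Endo (\<lambda>u. - app A u)"
definition "A * B = Endo (\<lambda>u. app A (app B u))"

lemma app_simps [simp]:
  "app 0 u = 0" "app 1 u = u" "app (A + B) u = app A u + app B u"
  "app (A - B) u = app A u - app B u" "app (- A) u = - app A u"
  "app (A * B) u = app A (app B u)"
  unfolding zero_endo_def one_endo_def plus_endo_def minus_endo_def uminus_endo_def times_endo_def
  by (subst app_Endo; simp add: clinear_symbols_def app_add app_scale;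
      simp add: scale_symbols_def vec_eq_iff smult_add_right smult_diff_right)+

instance
proof
  show "(0 :: endo) \<noteq> 1"
  proof
    assume "(0 :: endo) = 1"
    then have "app 0 (\<chi> i. 1) = app 1 (\<chi> i. 1)" by simp
    then show False by (simp add: vec_eq_iff)
  qed
qed (auto intro!: endo_eqI simp: app_add)

end

definition scalar_endo :: "complex \<Rightarrow> endo" where
  "scalar_endo c = Endo (scale_symbols c)"

definition is_diff_op :: "endo \<Rightarrow> bool" where
  "is_diff_op A \<longleftrightarrow>
    (\<exists>N (p :: weight \<Rightarrow> weight \<Rightarrow> nat \<Rightarrow> complex poly).
       \<forall>u j. app A u $ j = (\<Sum>i\<in>UNIV. \<Sum>k\<le>N. p i j k * (pderiv ^^ k) (u $ i)))"

definition lie_symbols :: "real poly \<Rightarrow> endo" where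
  "lie_symbols X = Endo (\<lambda>u. \<chi> i. lie_density (wt i) X (u $ i))"

definition cocycle_symbols :: "weight \<Rightarrow> weight \<Rightarrow> real poly \<Rightarrow> endo" where
  "cocycle_symbols i j X = Endo (\<lambda>u. \<chi> k. if k = j then cocycle (wt i) (wt j) X (u $ i) else 0)"


section \<open>Formal deformations\<close>

datatype param = T11 | T13 | T14 | T15 | T22 | T24 | T25 | T33 | T35 | T44 | T55

lemma UNIV_param: "UNIV = {T11, T13, T14, T15, T22, T24, T25, T33, T35, T44, T55}"
  using param.exhaust by auto

instance param :: finite
  by standard (simp add: UNIV_param)

fun src :: "param \<Rightarrow> weight" where
  "src T11 = W1" | "src T13 = W1" | "src T14 = W1" | "src T15 = W1"
| "src T22 = W2" | "src T24 = W2" | "src T25 = W2"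
| "src T33 = W3" | "src T35 = W3" | "src T44 = W4" | "src T55 = W5"

fun tgt :: "param \<Rightarrow> weight" where
  "tgt T11 = W1" | "tgt T13 = W3" | "tgt T14 = W4" | "tgt T15 = W5"
| "tgt T22 = W2" | "tgt T24 = W4" | "tgt T25 = W5"
| "tgt T33 = W3" | "tgt T35 = W5" | "tgt T44 = W4" | "tgt T55 = W5"

type_synonym scalar_series = "(param, complex) mfps"
type_synonym endo_series = "(param, endo) mfps"

definition infinitesimal :: "real poly \<Rightarrow> endo_series" where
  "infinitesimal X = (\<Sum>p\<in>UNIV. mvar p * mconst (cocycle_symbols (src p) (tgt p) X))"

definition embed :: "scalar_series \<Rightarrow> endo_series" where
  "embed f = MFPS (\<lambda>a. scalar_endo (mcoeff f a))"

text \<open>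
  For an ideal \<open>R\<close> of \<open>\<complex>[[t]]\<close> with quotient \<open>A\<close>, the (completed) tensor product of \<open>End(\<S>)\<close> and \<open>A\<close>
  is \<open>End(\<S>)[[t]]\<close> modulo the two-sided ideal generated by \<open>R\<close>; the completion is needed for
  infinite series with values in \<open>End(\<S>)\<close> to make sense. Its elements are represented by series, and
  equality in the quotient is \<open>cong_base R\<close>.
\<close>

definition generated_by :: "scalar_series set \<Rightarrow> endo_series set" where
  "generated_by R =
    {T. \<exists>(n::nat) r Q. (\<forall>k<n. r k \<in> R) \<and> T = (\<Sum>k<n. embed (r k) * Q k)}"

definition cong_base :: "scalar_series set \<Rightarrow> endo_series \<Rightarrow> endo_series \<Rightarrow> bool" where
  "cong_base R S T \<longleftrightarrow> S - T \<in> generated_by R"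

definition formal_deformation ::
    "scalar_series set \<Rightarrow> (real poly \<Rightarrow> endo_series) \<Rightarrow> bool" where
  "formal_deformation R \<rho> \<longleftrightarrow>
     is_ideal R \<and>
     (\<forall>X Y. \<rho> (X + Y) = \<rho> X + \<rho> Y) \<and>
     (\<forall>c X. \<rho> (smult c X) = mconst (scalar_endo (of_real c)) * \<rho> X) \<and>
     (\<forall>X a. is_diff_op (mcoeff (\<rho> X) a)) \<and>
     (\<forall>X. hom_part 0 (\<rho> X) = mconst (lie_symbols X)) \<and>
     (\<forall>X. hom_part 1 (\<rho> X) = infinitesimal X) \<and>
     (\<forall>X Y. cong_base R (\<rho> X * \<rho> Y - \<rho> Y * \<rho> X) (\<rho> (vect_bracket X Y)))"

definition polynomial_of_degree_le :: "nat \<Rightarrow> (real poly \<Rightarrow> endo_series) \<Rightarrow> bool" where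
  "polynomial_of_degree_le d \<rho> \<longleftrightarrow> (\<forall>X. \<forall>m>d. hom_part m (\<rho> X) = 0)"

text \<open>
  Equivalence over the base \<open>\<complex>[[t]]/R\<close>: the inner automorphism is \<open>T \<mapsto> P T Q\<close>, where \<open>Q\<close> is the inverse
  of \<open>P\<close> modulo \<open>R\<close>; it maps the identity to \<open>P Q\<close>, that is, to the identity.
\<close>

definition equivalent_deformations ::
    "scalar_series set \<Rightarrow> (real poly \<Rightarrow> endo_series) \<Rightarrow> (real poly \<Rightarrow> endo_series) \<Rightarrow> bool" where
  "equivalent_deformations R \<rho> \<rho>' \<longleftrightarrow>
     (\<exists>P Q. cong_base R (P * Q) 1 \<and> cong_base R (Q * P) 1 \<and>
            (\<forall>X. cong_base R (P * \<rho> X * Q) (\<rho>' X)))"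


section \<open>Choice of the deformation parameters\<close>

text \<open>
  Any family \<open>\<phi> p = t\<^sub>p + (terms of degree at least 2)\<close> is again a system of deformation parameters of
  the base, inducing the same infinitesimal deformation. Substituting \<open>\<phi> p\<close> for \<open>t\<^sub>p\<close> is an automorphism
  of \<open>\<complex>[[t]]\<close> and identifies \<open>\<complex>[[t]]/R'\<close> with \<open>\<complex>[[t]]/R\<close>, where \<open>R'\<close>, the ideal of relations between
  the new parameters, is the preimage of \<open>R\<close>. This freedom cannot be dispensed with: when all
  parameters but \<open>t = t\<^bsub>1,1\<^esub>\<close> vanish in the base, the deformation \<open>L\<^sub>X + (t + t\<^sup>5) C\<^bsub>1,1\<^esub>(X)\<close> is not
  conjugate to one of degree at most 3 in \<open>t\<close>, since its Casimir operator for \<open>sl(2)\<close> has an eigenvalue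
  of degree 10 in \<open>t\<close>; but it has degree 1 in the parameter \<open>t + t\<^sup>5\<close>.
\<close>

definition parameter_system :: "(param \<Rightarrow> scalar_series) \<Rightarrow> bool" where
  "parameter_system \<phi> \<longleftrightarrow>
     (\<forall>p. hom_part 0 (\<phi> p) = 0 \<and> hom_part 1 (\<phi> p) = mvar p)"

text \<open>
  A product of \<open>mdeg b\<close> series without constant term has no terms of degree less than \<open>mdeg b\<close>,
  so the restriction to \<open>mdeg b \<le> mdeg a\<close> below omits only zero terms.
\<close>

definition subst_scalar :: "(param \<Rightarrow> scalar_series) \<Rightarrow> scalar_series \<Rightarrow> scalar_series" where
  "subst_scalar \<phi> f = MFPS (\<lambda>a. \<Sum>b | mdeg b \<le> mdeg a.
     mcoeff (\<Prod>p\<in>UNIV. \<phi> p ^ b p) a * mcoeff f b)"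

definition subst_endo :: "(param \<Rightarrow> scalar_series) \<Rightarrow> endo_series \<Rightarrow> endo_series" where
  "subst_endo \<phi> T = MFPS (\<lambda>a. \<Sum>b | mdeg b \<le> mdeg a.
     scalar_endo (mcoeff (\<Prod>p\<in>UNIV. \<phi> p ^ b p) a) * mcoeff T b)"

definition relations_between :: "(param \<Rightarrow> scalar_series) \<Rightarrow> scalar_series set \<Rightarrow> scalar_series set" where
  "relations_between \<phi> R = {f. subst_scalar \<phi> f \<in> R}"

end

theory Submission
  imports Defs
begin

text \<open>
  Everything takes place in the algebra of series in the parameters with coefficients in the full
  endomorphism algebra of the module, modulo the relations. Formal gauge transformations, found as fixed
  points of contractions, make the field \<open>1\<close> act as \<open>\<partial>\<close>, then \<open>x\<^sup>2\<close> as \<open>x\<^sup>2 \<partial> + 2 x A\<close>, where \<open>x\<close> acts as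
  \<open>x \<partial> + A\<close> and \<open>A\<close> has constant coefficients. The relation between the actions of \<open>x\<close> and \<open>x\<^sup>2\<close> forces
  \<open>A\<close> to be a matrix, which can be diagonalised: on \<open>sl(2)\<close> the deformation only shifts the five weights.
  The action of \<open>x\<^sup>3\<close> then adds an operator \<open>y\<close> with constant coefficients, homogeneous of degree \<open>2\<close>. The
  fields \<open>x\<^sup>4\<close> and \<open>x\<^sup>5\<close> are obtained as brackets, and for \<open>x\<^sup>n\<close> with \<open>n \<ge> 6\<close> there is no room for a constant term, since
  weights differ by at most \<open>4\<close>. The five shifts and the six entries of \<open>y\<close> are the eleven parameters; the
  operators are transvectants with the third derivative of \<open>X\<close>, whose coefficients are polynomials of degree at most \<open>2\<close> in the
  shifted weight, so the total degree is at most \<open>3\<close>. A last unipotent gauge transformation, linear in the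
  parameters, restores the prescribed infinitesimal part; by nilpotency it does not raise the degree above \<open>3\<close>.
\<close>

section \<open>Homogeneous parts and contractions\<close>

text \<open>The ideal of relations is arbitrary: it may contain series with a nonzero linear part,
  and \<open>generated_by R\<close> admits only finite sums, so an infinite chain of corrections
  need not stay inside it. Two decisions follow. Gauge transformations are exact, with
  \<open>P * Q = 1\<close> as series before any quotient is taken; only the consequences of the
  bracket relations are congruences. Such a consequence typically says that U + \<Psi> U lies in the
  ideal, where \<Psi> raises the order in the parameters; 1 + \<Psi> is then inverted on each of the
  finitely many generators separately. Congruent series may have different linear parts. Hence the
  new parameters are read off from the conjugated series itself, whose first order part is known
  exactly, and not from its normal form. Finite order of the operators is not followed through the
  gauge transformations. Symbols are treated as endomorphisms commuting with \<partial>, which makes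
  every inverse a total linear map on endomorphisms; the representative is explicit, so its
  coefficients are seen to be differential operators at the end.\<close>

lemma mcoeff_simps [simp]:
  fixes f g :: "('v::finite, 'a::ring_1) mfps"
  shows "mcoeff (0 :: ('v, 'a) mfps) a = 0" "mcoeff (f + g) a = mcoeff f a + mcoeff g a"
    "mcoeff (f - g) a = mcoeff f a - mcoeff g a" "mcoeff (- f) a = - mcoeff f a"
  by (simp_all add: zero_mfps_def plus_mfps_def minus_mfps_def uminus_mfps_def)

lemma mcoeff_mult: 
  fixes f g :: "('v::finite, 'a::ring_1) mfps"
  shows "mcoeff (f * g) a = (\<Sum>b | b \<le> a. mcoeff f b * mcoeff g (a - b))"
  by (simp add: times_mfps_def)

lemma mcoeff_sum: 
  fixes f :: "'i \<Rightarrow> ('v::finite, 'a::ring_1) mfps"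
  shows "mcoeff (\<Sum>i\<in>S. f i) a = (\<Sum>i\<in>S. mcoeff (f i) a)"
  by (induction S rule: infinite_finite_induct) simp_all

lemma mcoeff_mconst: "mcoeff (mconst c) a = (if a = (\<lambda>_. 0) then c else 0)"
  by (simp add: mconst_def)

lemma mcoeff_one: "mcoeff (1 :: ('v::finite, 'a::ring_1) mfps) a = (if a = (\<lambda>_. 0) then 1 else 0)"
  by (simp add: one_mfps_def mcoeff_mconst)

lemma mcoeff_mconst_mult [simp]:
  fixes f :: "('v::finite, 'a::ring_1) mfps"
  shows "mcoeff (mconst c * f) a = c * mcoeff f a"
proof -
  have "mcoeff (mconst c * f) a = (\<Sum>b | b \<le> a. if b = (\<lambda>_. 0) then c * mcoeff f (a - b) else 0)"
    by (simp add: mcoeff_mult mcoeff_mconst if_distrib [of "\<lambda>c. c * _"] cong: if_cong)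
  also have "\<dots> = c * mcoeff f (a - (\<lambda>_. 0))"
    using finite_exponents_le [of a] by (subst sum.delta) (simp_all add: le_fun_def)
  also have "a - (\<lambda>_. 0) = a" by auto
  finally show ?thesis .
qed

lemma mcoeff_mult_mconst [simp]:
  fixes f :: "('v::finite, 'a::ring_1) mfps"
  shows "mcoeff (f * mconst c) a = mcoeff f a * c"
proof -
  have "mcoeff (f * mconst c) a = (\<Sum>b | b \<le> a. if b = a then mcoeff f b * c else 0)"
    unfolding mcoeff_mult mcoeff_mconst
    by (auto intro!: sum.cong simp: fun_eq_iff le_fun_def) (metis le_antisym)+
  also have "\<dots> = mcoeff f a * c"
    by (subst sum.delta) (auto simp: finite_exponents_le)
  finally show ?thesis .
qed

lemma mconst_hom [simp]:
  fixes c e :: "'a::ring_1"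
  shows "mconst 0 = (0 :: ('v::finite, 'a) mfps)" "mconst 1 = (1 :: ('v, 'a) mfps)"
  by (auto intro!: mfps_eqI simp: mcoeff_mconst mcoeff_one)

lemma mconst_arith:
  fixes c e :: "'a::ring_1"
  shows "(mconst (c + e) :: ('v::finite, 'a) mfps) = mconst c + mconst e"
    "(mconst (c - e) :: ('v, 'a) mfps) = mconst c - mconst e"
    "(mconst (- c) :: ('v, 'a) mfps) = - mconst c"
    "(mconst (c * e) :: ('v, 'a) mfps) = mconst c * mconst e"
  by (auto intro!: mfps_eqI simp: mcoeff_mconst)

lemma mdeg_add: "mdeg (\<lambda>v. a v + b v) = mdeg a + mdeg b"
  by (simp add: mdeg_def sum.distrib)

lemma mdeg_diff: "b \<le> a \<Longrightarrow> mdeg a = mdeg b + mdeg (a - b)"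
  unfolding mdeg_def sum.distrib [symmetric]
  by (rule sum.cong) (auto simp: le_fun_def)

lemma mdeg_eq_0: "mdeg a = 0 \<longleftrightarrow> a = (\<lambda>_. 0)"
  by (auto simp: mdeg_def)

lemma finite_mdeg_le: "finite {a :: 'v::finite \<Rightarrow> nat. mdeg a \<le> n}"
proof (rule finite_subset)
  show "{a :: 'v \<Rightarrow> nat. mdeg a \<le> n} \<subseteq> {a. a \<le> (\<lambda>_. n)}"
  proof (clarsimp simp: le_fun_def mdeg_def)
    fix a :: "'v \<Rightarrow> nat" and v
    assume "sum a UNIV \<le> n"
    moreover have "a v \<le> sum a UNIV" by (rule member_le_sum) auto
    ultimately show "a v \<le> n" by simp
  qed
qed (rule finite_exponents_le)

lemma mcoeff_hom_part [simp]: "mcoeff (hom_part m f) a = (if mdeg a = m then mcoeff f a else 0)"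
  by (simp add: hom_part_def)

lemma hom_part_arith [simp]:
  fixes f g :: "('v::finite, 'a::ring_1) mfps"
  shows "hom_part m (0 :: ('v, 'a) mfps) = 0" "hom_part m (f + g) = hom_part m f + hom_part m g"
    "hom_part m (f - g) = hom_part m f - hom_part m g" "hom_part m (- f) = - hom_part m f"
  by (auto intro!: mfps_eqI)

lemma hom_part_mconst: 
  "hom_part m (mconst c :: ('v::finite, 'a::ring_1) mfps) = (if m = 0 then mconst c else 0)"
  by (auto intro!: mfps_eqI simp: mcoeff_mconst mdeg_eq_0)
    (auto simp: mdeg_def)

lemma hom_part_one: 
  "hom_part m (1 :: ('v::finite, 'a::ring_1) mfps) = (if m = 0 then 1 else 0)"
  using hom_part_mconst [where c = "1::'a" and 'v = 'v] by simp

lemma mfps_eqI_hom: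
  fixes f g :: "('v::finite, 'a::ring_1) mfps"
  assumes "\<And>m. hom_part m f = hom_part m g"
  shows "f = g"
proof (rule mfps_eqI)
  fix a :: "'v \<Rightarrow> nat"
  from assms [of "mdeg a"] have "mcoeff (hom_part (mdeg a) f) a = mcoeff (hom_part (mdeg a) g) a"
    by simp
  then show "mcoeff f a = mcoeff g a" by simp
qed

lemma hom_part_mult:
  fixes f g :: "('v::finite, 'a::ring_1) mfps"
  shows "hom_part m (f * g) = (\<Sum>i\<le>m. hom_part i f * hom_part (m - i) g)"
proof (rule mfps_eqI)
  fix a
  have "mcoeff (\<Sum>i\<le>m. hom_part i f * hom_part (m - i) g) a =
     (\<Sum>b | b \<le> a. \<Sum>i\<le>m. mcoeff (hom_part i f) b * mcoeff (hom_part (m - i) g) (a - b))"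
    unfolding mcoeff_sum mcoeff_mult by (rule sum.swap)
  also have "\<dots> = (\<Sum>b | b \<le> a. if mdeg a = m then mcoeff f b * mcoeff g (a - b) else 0)"
  proof (rule sum.cong [OF refl], clarify)
    fix b assume "b \<le> a"
    then have d: "mdeg a = mdeg b + mdeg (a - b)" by (rule mdeg_diff)
    have "(\<Sum>i\<le>m. mcoeff (hom_part i f) b * mcoeff (hom_part (m - i) g) (a - b)) =
       (\<Sum>i\<le>m. if mdeg b = i then mcoeff f b * mcoeff (hom_part (m - i) g) (a - b) else 0)"
      by (intro sum.cong) auto
    also have "\<dots> = (if mdeg a = m then mcoeff f b * mcoeff g (a - b) else 0)"
      using d by (subst sum.delta') auto
    finally show "(\<Sum>i\<le>m. mcoeff (hom_part i f) b * mcoeff (hom_part (m - i) g) (a - b)) =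
       (if mdeg a = m then mcoeff f b * mcoeff g (a - b) else 0)" .
  qed
  finally show "mcoeff (hom_part m (f * g)) a =
      mcoeff (\<Sum>i\<le>m. hom_part i f * hom_part (m - i) g) a"
    by (simp add: mcoeff_mult)
qed

section \<open>Order of vanishing, degree in the parameters, and formal fixed points\<close>

definition vanish :: "nat \<Rightarrow> ('v::finite, 'a::ring_1) mfps \<Rightarrow> bool" where
  "vanish n f \<longleftrightarrow> (\<forall>m<n. hom_part m f = 0)"

definition pdeg :: "nat \<Rightarrow> ('v::finite, 'a::ring_1) mfps \<Rightarrow> bool" where
  "pdeg n f \<longleftrightarrow> (\<forall>m>n. hom_part m f = 0)"

lemma vanish_mult: 
  assumes "vanish m f" "vanish n g" shows "vanish (m + n) (f * g)"
  unfolding vanish_def hom_part_mult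
proof (intro allI impI sum.neutral ballI)
  fix k i assume "k < m + n" "i \<in> {..k}"
  then have "i < m \<or> k - i < n" by auto
  then show "hom_part i f * hom_part (k - i) g = 0"
    using assms by (auto simp: vanish_def)
qed

lemma pdeg_mult: 
  assumes "pdeg m f" "pdeg n g" shows "pdeg (m + n) (f * g)"
  unfolding pdeg_def hom_part_mult
proof (intro allI impI sum.neutral ballI)
  fix k i assume "k > m + n" "i \<in> {..k}"
  then have "i > m \<or> k - i > n" by auto
  then show "hom_part i f * hom_part (k - i) g = 0"
    using assms by (auto simp: pdeg_def)
qed

lemma vanish_arith:
  "vanish n f \<Longrightarrow> vanish n g \<Longrightarrow> vanish n (f + g)"
  "vanish n f \<Longrightarrow> vanish n g \<Longrightarrow> vanish n (f - g)"
  "vanish n f \<Longrightarrow> vanish n (- f)" "vanish n 0" "vanish 0 f"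
  by (auto simp: vanish_def)

lemma pdeg_arith:
  "pdeg n f \<Longrightarrow> pdeg n g \<Longrightarrow> pdeg n (f + g)"
  "pdeg n f \<Longrightarrow> pdeg n g \<Longrightarrow> pdeg n (f - g)"
  "pdeg n f \<Longrightarrow> pdeg n (- f)" "pdeg n 0" 
  by (auto simp: pdeg_def)

lemma pdeg_mono: "pdeg m f \<Longrightarrow> m \<le> n \<Longrightarrow> pdeg n f"
  by (auto simp: pdeg_def)

lemma pdeg_mconst [simp]: "pdeg n (mconst c)"
  by (auto simp: pdeg_def hom_part_mconst)

lemma vanish_mult_left: "vanish n g \<Longrightarrow> vanish n (f * g)"
  using vanish_mult [of 0 f n g] by (simp add: vanish_arith)

lemma vanish_mult_right: "vanish n f \<Longrightarrow> vanish n (f * g)"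
  using vanish_mult [of n f 0 g] by (simp add: vanish_arith)

lemma vanish_mcoeff: "vanish n f \<longleftrightarrow> (\<forall>a. mdeg a < n \<longrightarrow> mcoeff f a = 0)"
proof
  assume "vanish n f"
  then show "\<forall>a. mdeg a < n \<longrightarrow> mcoeff f a = 0"
    unfolding vanish_def by (metis mcoeff_hom_part mcoeff_simps(1))
qed (auto simp: vanish_def intro!: mfps_eqI)

lemma vanish_all: "(\<And>n. vanish n f) \<Longrightarrow> f = 0"
  by (rule mfps_eqI_hom) (auto simp: vanish_def)

text \<open>Series are complete for the grading by degree, and the iterates starting at 0 agree to
  increasing order. \<open>\<Phi>\<close> may be nonlinear: \<open>diagonalise_constant\<close>
  applies the lemma to a quadratic equation.\<close>

lemma contraction_fixpoint:
  fixes \<Phi> :: "('v::finite, 'a::ring_1) mfps \<Rightarrow> ('v, 'a) mfps"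
  assumes contr: "\<And>m S T. vanish m (S - T) \<Longrightarrow> vanish (Suc m) (\<Phi> S - \<Phi> T)"
  obtains T where "\<Phi> T = T"
proof -
  define F where "F n = (\<Phi> ^^ n) 0" for n
  have step: "vanish n (F (Suc n) - F n)" for n
    by (induction n) (auto simp: F_def vanish_arith contr)
  have steps: "vanish n (F (n + k) - F n)" for n k
  proof (induction k)
    case (Suc k)
    have "vanish n (F (Suc (n + k)) - F (n + k))"
      using step [of "n + k"] by (auto simp: vanish_def)
    from vanish_arith(1) [OF this Suc] show ?case by simp
  qed (simp add: vanish_arith)
  \<comment> \<open>A coefficient of degree d no longer changes from the iterate d + 1 on.\<close>
  define T where "T = MFPS (\<lambda>a. mcoeff (F (Suc (mdeg a))) a)"
  have TF: "vanish n (T - F n)" for n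
    unfolding vanish_mcoeff
  proof (intro allI impI)
    fix a :: "'v \<Rightarrow> nat" assume "mdeg a < n"
    then obtain k where "n = Suc (mdeg a) + k" using less_iff_Suc_add by auto
    with steps [of "Suc (mdeg a)" k] show "mcoeff (T - F n) a = 0"
      by (simp add: T_def vanish_mcoeff)
  qed
  have "\<Phi> T - T = 0"
  proof (rule vanish_all)
    fix n
    have "vanish (Suc n) (\<Phi> T - F (Suc n))"
      using contr [OF TF [of n]] by (simp add: F_def)
    moreover have "vanish (Suc n) (T - F (Suc n))" by (rule TF)
    ultimately have "vanish (Suc n) (\<Phi> T - F (Suc n) - (T - F (Suc n)))"
      by (rule vanish_arith)
    then show "vanish n (\<Phi> T - T)" by (simp add: vanish_def)
  qed
  then show ?thesis using that by simp
qed

text \<open>Each application of \<open>\<Psi>\<close> gains one order, so a fixed point vanishes to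
  every order.\<close>

lemma contraction_zero:
  fixes u :: "('v::finite, 'a::ring_1) mfps"
  assumes "\<And>m S. vanish m S \<Longrightarrow> vanish (Suc m) (\<Psi> S)" "\<Psi> u = u"
  shows "u = 0"
proof (rule vanish_all)
  fix n show "vanish n u"
    using assms by (induction n) (auto simp: vanish_arith, metis)
qed

text \<open>The coefficients do not commute; a right and a left inverse are found as separate fixed
  points and agree by associativity.\<close>

lemma invertible_series:
  fixes P :: "('v::finite, 'a::ring_1) mfps"
  assumes "hom_part 0 P = 1"
  obtains Q where "P * Q = 1" "Q * P = 1" "hom_part 0 Q = 1"
proof -
  have v: "vanish 1 (1 - P)" using assms by (simp add: vanish_def hom_part_one)
  obtain Q where Q: "1 + (1 - P) * Q = Q"
  proof (rule contraction_fixpoint [of "\<lambda>Q. 1 + (1 - P) * Q"])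
    fix m and S T :: "('v, 'a) mfps" assume "vanish m (S - T)"
    from vanish_mult [OF v this]
    show "vanish (Suc m) (1 + (1 - P) * S - (1 + (1 - P) * T))" by (simp add: algebra_simps)
  qed
  obtain Q' where Q': "1 + Q' * (1 - P) = Q'"
  proof (rule contraction_fixpoint [of "\<lambda>Q. 1 + Q * (1 - P)"])
    fix m and S T :: "('v, 'a) mfps" assume "vanish m (S - T)"
    from vanish_mult [OF this v]
    show "vanish (Suc m) (1 + S * (1 - P) - (1 + T * (1 - P)))" by (simp add: algebra_simps)
  qed
  from Q have PQ: "P * Q = 1" by (simp add: algebra_simps)
  from Q' have QP: "Q' * P = 1" by (simp add: algebra_simps)
  have "Q' = Q' * (P * Q)" by (simp add: PQ)
  then have "Q' = Q" by (simp add: mult.assoc [symmetric] QP)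
  have "hom_part 0 (P * Q) = 1" by (simp add: PQ hom_part_one)
  then have "hom_part 0 Q = 1" by (simp add: hom_part_mult assms)
  with PQ QP \<open>Q' = Q\<close> that show ?thesis by blast
qed

section \<open>Coefficientwise maps, the ideal of relations and substitution\<close>

lemma scale_symbols_linear: "clinear_symbols (scale_symbols c)"
  by (simp add: clinear_symbols_def scale_symbols_def vec_eq_iff smult_add_right mult.commute)

lemma app_scalar_endo [simp]: "app (scalar_endo c) u = scale_symbols c u"
  by (simp add: scalar_endo_def app_Endo scale_symbols_linear)

lemma scale_symbols_simps:
  "scale_symbols 0 u = 0" "scale_symbols 1 u = u" "scale_symbols (b + c) u = scale_symbols b u + scale_symbols c u"
  "scale_symbols (b * c) u = scale_symbols b (scale_symbols c u)" "scale_symbols b 0 = 0"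
  "scale_symbols b (u + v) = scale_symbols b u + scale_symbols b v"
  by (simp_all add: scale_symbols_def vec_eq_iff smult_add_left smult_add_right)

lemma scalar_endo_hom:
  "scalar_endo 0 = 0" "scalar_endo 1 = 1" "scalar_endo (b + c) = scalar_endo b + scalar_endo c"
  "scalar_endo (b * c) = scalar_endo b * scalar_endo c"
  by (auto intro!: endo_eqI simp: scale_symbols_simps)

lemma scalar_endo_commute: "scalar_endo c * A = A * scalar_endo c"
  by (auto intro!: endo_eqI simp: app_scale)

lemma scalar_endo_left_commute: "A * (scalar_endo c * B) = scalar_endo c * (A * B)"
  by (metis mult.assoc scalar_endo_commute)

lemma scalar_endo_sum: "scalar_endo (\<Sum>i\<in>S. f i) = (\<Sum>i\<in>S. scalar_endo (f i))"
  by (induction S rule: infinite_finite_induct) (auto simp: scalar_endo_hom)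

lemma mcoeff_embed [simp]: "mcoeff (embed f) a = scalar_endo (mcoeff f a)"
  by (simp add: embed_def)

lemma embed_hom:
  "embed 0 = 0" "embed 1 = 1" "embed (f + g) = embed f + embed g" "embed (f * g) = embed f * embed g"
  "embed (mconst c) = mconst (scalar_endo c)"
  by (auto intro!: mfps_eqI simp: scalar_endo_hom mcoeff_one mcoeff_mult scalar_endo_sum mcoeff_mconst)

lemma embed_uminus: "embed (- f) = - embed f"
  using embed_hom(3) [of f "- f"] by (simp add: embed_hom(1) eq_neg_iff_add_eq_0 add.commute)

lemma embed_diff: "embed (f - g) = embed f - embed g"
  using embed_hom(3) [of f "- g"] by (simp add: embed_uminus)

lemma embed_commute: "embed f * T = T * embed f"
proof (rule mfps_eqI)
  fix a
  have "(\<Sum>b | b \<le> a. scalar_endo (mcoeff f b) * mcoeff T (a - b)) =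
      (\<Sum>b | b \<le> a. mcoeff T b * scalar_endo (mcoeff f (a - b)))"
    by (rule sum.reindex_bij_witness [where i = "\<lambda>b. a - b" and j = "\<lambda>b. a - b"])
      (auto simp: exponents_diff_cancel scalar_endo_commute le_fun_def)
  then show "mcoeff (embed f * T) a = mcoeff (T * embed f) a"
    by (simp add: mcoeff_mult)
qed

lemma embed_left_commute: "S * (embed f * T) = embed f * (S * T)"
  by (metis mult.assoc embed_commute)

section \<open>Maps applied to the coefficients of a series\<close>

definition lift :: "('a \<Rightarrow> 'b) \<Rightarrow> ('v, 'a) mfps \<Rightarrow> ('v, 'b) mfps" where
  "lift \<phi> T = MFPS (\<lambda>a. \<phi> (mcoeff T a))"

lemma mcoeff_lift [simp]: "mcoeff (lift \<phi> T) a = \<phi> (mcoeff T a)"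
  by (simp add: lift_def)

definition endo_linear :: "(endo \<Rightarrow> endo) \<Rightarrow> bool" where
  "endo_linear \<phi> \<longleftrightarrow> (\<forall>A B. \<phi> (A + B) = \<phi> A + \<phi> B) \<and>
     (\<forall>c A. \<phi> (scalar_endo c * A) = scalar_endo c * \<phi> A)"

definition endo_functional :: "(endo \<Rightarrow> complex) \<Rightarrow> bool" where
  "endo_functional \<phi> \<longleftrightarrow> (\<forall>A B. \<phi> (A + B) = \<phi> A + \<phi> B) \<and>
     (\<forall>c A. \<phi> (scalar_endo c * A) = c * \<phi> A)"

lemma endo_linearD:
  assumes "endo_linear \<phi>"
  shows "\<phi> (A + B) = \<phi> A + \<phi> B" "\<phi> (scalar_endo c * A) = scalar_endo c * \<phi> A" "\<phi> 0 = 0"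
    "\<phi> (A - B) = \<phi> A - \<phi> B" "\<phi> (- A) = - \<phi> A" "\<phi> (\<Sum>i\<in>S. f i) = (\<Sum>i\<in>S. \<phi> (f i))"
proof -
  show add: "\<phi> (A + B) = \<phi> A + \<phi> B" for A B using assms by (simp add: endo_linear_def)
  show "\<phi> (scalar_endo c * A) = scalar_endo c * \<phi> A" using assms by (simp add: endo_linear_def)
  show zero: "\<phi> 0 = 0" using add [of 0 0] by simp
  show "\<phi> (- A) = - \<phi> A" using add [of A "- A"] zero by (simp add: eq_neg_iff_add_eq_0 add.commute)
  show "\<phi> (A - B) = \<phi> A - \<phi> B" using add [of "A - B" B] by simp
  show "\<phi> (\<Sum>i\<in>S. f i) = (\<Sum>i\<in>S. \<phi> (f i))"
    by (induction S rule: infinite_finite_induct) (auto simp: add zero)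
qed

lemma endo_functionalD:
  assumes "endo_functional \<phi>"
  shows "\<phi> (A + B) = \<phi> A + \<phi> B" "\<phi> (scalar_endo c * A) = c * \<phi> A" "\<phi> 0 = 0"
    "\<phi> (A - B) = \<phi> A - \<phi> B" "\<phi> (- A) = - \<phi> A" "\<phi> (\<Sum>i\<in>S. f i) = (\<Sum>i\<in>S. \<phi> (f i))"
proof -
  show add: "\<phi> (A + B) = \<phi> A + \<phi> B" for A B using assms by (simp add: endo_functional_def)
  show "\<phi> (scalar_endo c * A) = c * \<phi> A" using assms by (simp add: endo_functional_def)
  show zero: "\<phi> 0 = 0" using add [of 0 0] by simp
  show "\<phi> (- A) = - \<phi> A" using add [of A "- A"] zero by (simp add: eq_neg_iff_add_eq_0 add.commute)
  show "\<phi> (A - B) = \<phi> A - \<phi> B" using add [of "A - B" B] by simp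
  show "\<phi> (\<Sum>i\<in>S. f i) = (\<Sum>i\<in>S. \<phi> (f i))"
    by (induction S rule: infinite_finite_induct) (auto simp: add zero)
qed

lemma lift_arith:
  assumes "endo_linear \<phi>"
  shows "lift \<phi> (S + T) = lift \<phi> S + (lift \<phi> T :: endo_series)" "lift \<phi> 0 = (0 :: endo_series)"
    "lift \<phi> (S - T) = lift \<phi> S - (lift \<phi> T :: endo_series)"
    "lift \<phi> (- S) = - (lift \<phi> S :: endo_series)"
    "lift \<phi> (embed f * T) = embed f * lift \<phi> T"
    "lift \<phi> (hom_part m T) = hom_part m (lift \<phi> T)"
    "lift \<phi> (mconst A) = (mconst (\<phi> A) :: endo_series)"
  by (auto intro!: mfps_eqI simp: endo_linearD [OF assms] mcoeff_mult mcoeff_mconst)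

lemma lift_functional_arith:
  assumes "endo_functional \<phi>"
  shows "lift \<phi> (S + T) = lift \<phi> S + (lift \<phi> T :: scalar_series)" "lift \<phi> 0 = (0 :: scalar_series)"
    "lift \<phi> (S - T) = lift \<phi> S - (lift \<phi> T :: scalar_series)"
    "lift \<phi> (embed f * T) = f * lift \<phi> T"
    "lift \<phi> (hom_part m T) = hom_part m (lift \<phi> T)"
    "lift \<phi> (mconst A) = (mconst (\<phi> A) :: scalar_series)"
  by (auto intro!: mfps_eqI simp: endo_functionalD [OF assms] mcoeff_mult mcoeff_mconst)

lemma vanish_lift: "endo_linear \<phi> \<Longrightarrow> vanish n S \<Longrightarrow> vanish n (lift \<phi> S :: endo_series)"
  by (simp add: vanish_mcoeff endo_linearD)

lemma lift_cong: "(\<And>a. \<phi> (mcoeff S a) = \<psi> (mcoeff T a)) \<Longrightarrow> lift \<phi> S = lift \<psi> T"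
  by (auto intro!: mfps_eqI)

text \<open>The ideal \<open>generated_by R\<close> is stable under coefficientwise linear maps, but it need not be
  closed under infinite sums; the lemma on contractions replaces a closure argument.\<close>

lemma generated_by_cons:
  assumes "T \<in> generated_by R" "r \<in> R"
  shows "T + embed r * Q \<in> generated_by R"
proof -
  from assms(1) obtain n :: nat and s S where
    s: "\<forall>k<n. s k \<in> R" "T = (\<Sum>k<n. embed (s k) * S k)"
    by (auto simp: generated_by_def)
  have "T + embed r * Q = (\<Sum>k<Suc n. embed ((s(n := r)) k) * (S(n := Q)) k)"
    by (simp add: s(2))
  moreover have "\<forall>k<Suc n. (s(n := r)) k \<in> R" using s(1) assms(2) by auto
  ultimately show ?thesis unfolding generated_by_def by blast
qed

lemma generated_by_zero: "0 \<in> generated_by R"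
  unfolding generated_by_def by (intro CollectI exI [of _ 0]) auto

lemma generated_by_embed: "r \<in> R \<Longrightarrow> embed r * Q \<in> generated_by R"
  using generated_by_cons [OF generated_by_zero] by fastforce

lemma generated_by_induct [consumes 1, case_names zero cons]:
  assumes "T \<in> generated_by R" "P 0"
    "\<And>T r Q. P T \<Longrightarrow> r \<in> R \<Longrightarrow> P (T + embed r * Q)"
  shows "P T"
proof -
  from assms(1) obtain n :: nat and s S where
    s: "\<forall>k<n. s k \<in> R" "T = (\<Sum>k<n. embed (s k) * S k)"
    by (auto simp: generated_by_def)
  have "P (\<Sum>k<m. embed (s k) * S k)" if "m \<le> n" for m
    using that by (induction m) (use s assms in auto)
  with s show ?thesis by simp
qed

lemma generated_by_add: 
  assumes "S \<in> generated_by R" "T \<in> generated_by R" shows "S + T \<in> generated_by R"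
  using assms(2)
proof (induction T rule: generated_by_induct)
  case (cons T r Q)
  from generated_by_cons [OF this] show ?case by (simp add: add.assoc)
qed (use assms in simp)

lemma generated_by_lift:
  assumes "endo_linear \<phi>" "T \<in> generated_by R" shows "lift \<phi> T \<in> generated_by R"
  using assms(2)
  by (induction T rule: generated_by_induct)
    (auto simp: lift_arith [OF assms(1)] intro: generated_by_zero generated_by_cons)

lemma generated_by_mult_left: 
  assumes "T \<in> generated_by R" shows "S * T \<in> generated_by R"
  using assms
  by (induction T rule: generated_by_induct)
    (auto simp: distrib_left embed_left_commute intro: generated_by_zero generated_by_cons)

lemma generated_by_mult_right: 
  assumes "T \<in> generated_by R" shows "T * S \<in> generated_by R"
  using assms
  by (induction T rule: generated_by_induct)
    (auto simp: distrib_right mult.assoc intro: generated_by_zero generated_by_cons)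

lemma generated_by_uminus: "T \<in> generated_by R \<Longrightarrow> - T \<in> generated_by R"
  using generated_by_mult_left [of T R "- 1"] by simp

lemma generated_by_diff: "S \<in> generated_by R \<Longrightarrow> T \<in> generated_by R \<Longrightarrow> S - T \<in> generated_by R"
  using generated_by_add [OF _ generated_by_uminus] by fastforce

lemma generated_by_functional:
  assumes "is_ideal R" "endo_functional \<phi>" "T \<in> generated_by R" shows "lift \<phi> T \<in> R"
  using assms(3)
proof (induction T rule: generated_by_induct)
  case (cons T r Q)
  then show ?case
    using assms(1) by (simp add: lift_functional_arith [OF assms(2)] is_ideal_def mult.commute [of r])
qed (use assms(1) in \<open>simp add: lift_functional_arith [OF assms(2)] is_ideal_def\<close>)

text \<open>The Neumann series of 1 + \<Psi> is an infinite sum and could leave the ideal. Instead,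
  if W + \<Psi> W = Q, then \<open>embed r * W\<close> is a preimage of the generator
  \<open>embed r * Q\<close>, because \<Psi> is linear over the scalar series. So every element of
  the ideal has a preimage in the ideal, and the preimage is unique by
  \<open>contraction_zero\<close>.\<close>

lemma generated_by_contraction:
  fixes \<Psi> :: "endo_series \<Rightarrow> endo_series"
  assumes add: "\<And>S T. \<Psi> (S + T) = \<Psi> S + \<Psi> T"
    and emb: "\<And>f T. \<Psi> (embed f * T) = embed f * \<Psi> T"
    and contr: "\<And>m S. vanish m S \<Longrightarrow> vanish (Suc m) (\<Psi> S)"
    and mem: "U + \<Psi> U \<in> generated_by R"
  shows "U \<in> generated_by R"
proof -
  have zero: "\<Psi> 0 = 0" using add [of 0 0] by simp
  have diff: "\<Psi> (S - T) = \<Psi> S - \<Psi> T" for S T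
    using add [of "S - T" T] by simp
  have solve: "\<exists>V. V + \<Psi> V = Q" for Q
  proof -
    obtain V where "Q - \<Psi> V = V"
    proof (rule contraction_fixpoint [of "\<lambda>V. Q - \<Psi> V"])
      fix m and S T :: endo_series assume "vanish m (S - T)"
      from vanish_arith(3) [OF contr [OF this]]
      show "vanish (Suc m) (Q - \<Psi> S - (Q - \<Psi> T))" by (simp add: diff)
    qed
    then show ?thesis by (intro exI [of _ V]) (simp add: algebra_simps)
  qed
  have ex: "\<exists>V\<in>generated_by R. V + \<Psi> V = T" if "T \<in> generated_by R" for T
    using that
  proof (induction T rule: generated_by_induct)
    case zero
    then show ?case by (intro bexI [of _ 0]) (simp_all add: generated_by_zero \<open>\<Psi> 0 = 0\<close>)
  next
    case (cons T r Q)
    from cons.IH obtain V where V: "V \<in> generated_by R" "V + \<Psi> V = T" by blast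
    obtain W where W: "W + \<Psi> W = Q" using solve by blast
    show ?case
    proof (rule bexI)
      show "V + embed r * W \<in> generated_by R" by (rule generated_by_cons) fact+
      show "V + embed r * W + \<Psi> (V + embed r * W) = T + embed r * Q"
        by (simp add: add emb V(2) [symmetric] W [symmetric] algebra_simps)
    qed
  qed
  from ex [OF mem] obtain V where V: "V \<in> generated_by R" "V + \<Psi> V = U + \<Psi> U" by blast
  have "U - V = 0"
  proof (rule contraction_zero)
    show "- \<Psi> (U - V) = U - V" using V(2) by (simp add: diff algebra_simps)
  qed (blast intro: contr vanish_arith)
  with V(1) show ?thesis by simp
qed

section \<open>Calculus of congruences modulo the relations\<close>

lemma cong_base_refl: "cong_base R S S"
  by (simp add: cong_base_def generated_by_zero)

lemma cong_base_sym: "cong_base R S T \<Longrightarrow> cong_base R T S"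
  unfolding cong_base_def using generated_by_uminus by fastforce

lemma cong_base_trans [trans]: "cong_base R S T \<Longrightarrow> cong_base R T U \<Longrightarrow> cong_base R S U"
  unfolding cong_base_def using generated_by_add by fastforce

lemma cong_base_add: "cong_base R S T \<Longrightarrow> cong_base R S' T' \<Longrightarrow> cong_base R (S + S') (T + T')"
  unfolding cong_base_def using generated_by_add [of "S - T" R "S' - T'"] by (simp add: algebra_simps)

lemma cong_base_uminus: "cong_base R S T \<Longrightarrow> cong_base R (- S) (- T)"
  unfolding cong_base_def using generated_by_uminus [of "S - T" R] by simp

lemma cong_base_diff: "cong_base R S T \<Longrightarrow> cong_base R S' T' \<Longrightarrow> cong_base R (S - S') (T - T')"
  using cong_base_add [OF _ cong_base_uminus] by fastforce

lemma cong_base_mult: 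
  assumes "cong_base R S T" "cong_base R S' T'" shows "cong_base R (S * S') (T * T')"
proof -
  have "(S - T) * S' + T * (S' - T') \<in> generated_by R"
    using assms unfolding cong_base_def
    by (intro generated_by_add generated_by_mult_left generated_by_mult_right)
  then show ?thesis by (simp add: cong_base_def algebra_simps)
qed

lemma cong_base_sum: 
  "(\<And>i. i \<in> A \<Longrightarrow> cong_base R (f i) (g i)) \<Longrightarrow> cong_base R (\<Sum>i\<in>A. f i) (\<Sum>i\<in>A. g i)"
  by (induction A rule: infinite_finite_induct) (auto simp: cong_base_refl cong_base_add)

lemma cong_base_functional: 
  "is_ideal R \<Longrightarrow> endo_functional \<phi> \<Longrightarrow> cong_base R S T \<Longrightarrow> lift \<phi> S - lift \<phi> T \<in> R"
  unfolding cong_base_def using generated_by_functional by (simp add: lift_functional_arith [symmetric])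

lemma cong_base_embed: "f - g \<in> R \<Longrightarrow> cong_base R (embed f * Q) (embed g * Q)"
  using generated_by_embed [of "f - g" R Q] by (simp add: cong_base_def embed_diff algebra_simps)

text \<open>\<open>subst_scalar\<close> and \<open>subst_endo\<close> are the instances \<open>z = id\<close> and \<open>z = scalar_endo\<close>.\<close>

definition monomial_of :: "('v \<Rightarrow> ('w::finite, complex) mfps) \<Rightarrow> ('v::finite \<Rightarrow> nat) \<Rightarrow> ('w, complex) mfps" where
  "monomial_of \<phi> b = (\<Prod>p\<in>UNIV. \<phi> p ^ b p)"

definition subst_series :: "(complex \<Rightarrow> 'a) \<Rightarrow> ('v \<Rightarrow> ('v::finite, complex) mfps) \<Rightarrow>
    ('v, 'a::ring_1) mfps \<Rightarrow> ('v, 'a) mfps" where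
  "subst_series z \<phi> T = MFPS (\<lambda>a. \<Sum>b | mdeg b \<le> mdeg a. z (mcoeff (monomial_of \<phi> b) a) * mcoeff T b)"

section \<open>Substitution of series without constant term\<close>

lemma vanish_power: "vanish m f \<Longrightarrow> vanish (m * n) (f ^ n)"
proof (induction n)
  case (Suc n)
  from vanish_mult [OF Suc.prems Suc.IH [OF Suc.prems]] show ?case by simp
qed (simp add: vanish_arith)

lemma vanish_prod: 
  fixes f :: "'i \<Rightarrow> ('v::finite, 'a::comm_ring_1) mfps"
  assumes "finite S" "\<And>i. i \<in> S \<Longrightarrow> vanish (n i) (f i)"
  shows "vanish (\<Sum>i\<in>S. n i) (\<Prod>i\<in>S. f i)"
  using assms by (induction S) (auto simp: vanish_arith intro!: vanish_mult)

lemma monomial_of_zero: "monomial_of \<phi> (\<lambda>_. 0) = 1"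
  by (simp add: monomial_of_def)

lemma monomial_of_add: "monomial_of \<phi> (\<lambda>v. a v + b v) = monomial_of \<phi> a * monomial_of \<phi> b"
  by (simp add: monomial_of_def power_add prod.distrib)

lemma mcoeff_monomial_of:
  assumes "\<And>p. hom_part 0 (\<phi> p) = 0" "mdeg a < mdeg b"
  shows "mcoeff (monomial_of \<phi> b) a = 0"
proof -
  have "vanish (mdeg b) (monomial_of \<phi> b)"
    unfolding monomial_of_def mdeg_def
  proof (rule vanish_prod)
    show "vanish (b p) (\<phi> p ^ b p)" for p
      using vanish_power [of 1 "\<phi> p" "b p"] assms(1) [of p] by (simp add: vanish_def)
  qed simp
  with assms(2) show ?thesis by (simp add: vanish_mcoeff)
qed

context
  fixes z :: "complex \<Rightarrow> 'a::ring_1" and \<phi> :: "'v \<Rightarrow> ('v::finite, complex) mfps"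
  assumes z: "z 0 = 0" "z 1 = 1" "\<And>b c. z (b + c) = z b + z c" "\<And>b c. z (b * c) = z b * z c"
    and central: "\<And>c A. A * z c = z c * A"
    and \<phi>: "\<And>p. hom_part 0 (\<phi> p) = 0"
begin

text \<open>Monomials of larger total degree contribute nothing at \<open>a\<close>. A cut-off
  independent of \<open>a\<close> is what lets the factors of a product be expanded over the same
  index set.\<close>

lemma subst_series_bound:
  assumes "mdeg a \<le> n"
  shows "mcoeff (subst_series z \<phi> T) a = (\<Sum>b | mdeg b \<le> n. z (mcoeff (monomial_of \<phi> b) a) * mcoeff T b)"
  unfolding subst_series_def mcoeff_MFPS
  by (rule sum.mono_neutral_left) (use assms in \<open>auto simp: finite_mdeg_le mcoeff_monomial_of \<phi> z\<close>)

lemma subst_series_add: "subst_series z \<phi> (S + T) = subst_series z \<phi> S + subst_series z \<phi> T"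
  by (rule mfps_eqI) (simp add: subst_series_def distrib_left sum.distrib)

lemma subst_series_mconst: "subst_series z \<phi> (mconst A) = mconst A"
proof (rule mfps_eqI)
  fix a :: "'v \<Rightarrow> nat"
  have "mcoeff (subst_series z \<phi> (mconst A)) a =
     (\<Sum>b | mdeg b \<le> mdeg a. if b = (\<lambda>_. 0) then z (mcoeff (monomial_of \<phi> b) a) * A else 0)"
    by (simp add: subst_series_def mcoeff_mconst if_distrib [of "\<lambda>c. _ * c"] cong: if_cong)
  also have "\<dots> = z (mcoeff (monomial_of \<phi> (\<lambda>_. 0)) a) * A"
    by (subst sum.delta) (simp_all add: finite_mdeg_le, simp add: mdeg_def)
  finally show "mcoeff (subst_series z \<phi> (mconst A)) a = mcoeff (mconst A) a"
    by (simp add: monomial_of_zero mcoeff_one mcoeff_mconst z)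
qed

lemma sum_z: "z (\<Sum>i\<in>S. f i) = (\<Sum>i\<in>S. z (f i))"
  by (induction S rule: infinite_finite_induct) (auto simp: z)

lemma subst_series_mult: "subst_series z \<phi> (S * T) = subst_series z \<phi> S * subst_series z \<phi> T"
proof (rule mfps_eqI)
  fix a :: "'v \<Rightarrow> nat"
  define n where "n = mdeg a"
  let ?B = "{b :: 'v \<Rightarrow> nat. mdeg b \<le> n}"
  let ?m = "monomial_of \<phi>"
  have fin: "finite ?B" by (rule finite_mdeg_le)
  have swap: "z p * z q * (A * B) = (z p * A) * (z q * B)" for p q A B
    by (metis central mult.assoc)
  have "mcoeff (subst_series z \<phi> (S * T)) a =
     (\<Sum>b\<in>?B. \<Sum>c | c \<le> b. z (mcoeff (?m b) a) * (mcoeff S c * mcoeff T (b - c)))"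
    by (simp add: subst_series_def n_def mcoeff_mult sum_distrib_left)
  also have "\<dots> = (\<Sum>(b, c) \<in> (SIGMA b:?B. {c. c \<le> b}). z (mcoeff (?m b) a) * (mcoeff S c * mcoeff T (b - c)))"
    by (rule sum.Sigma) (auto simp: finite_exponents_le fin)
  also have "\<dots> = (\<Sum>(c, d) \<in> {(c, d). mdeg c + mdeg d \<le> n}.
      z (mcoeff (?m (\<lambda>v. c v + d v)) a) * (mcoeff S c * mcoeff T d))"
    by (rule sum.reindex_bij_witness
        [where j = "\<lambda>(b, c). (c, b - c)" and i = "\<lambda>(c, d). (\<lambda>v. c v + d v, c)"])
      (auto simp: le_fun_def fun_eq_iff mdeg_add mdeg_diff [symmetric])
  \<comment> \<open>The triangle of pairs is enlarged to a square, so that the sum factors. The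
    added pairs have total degree above that of \<open>a\<close>, and their monomials have no
    coefficient there.\<close>
  also have "\<dots> = (\<Sum>(c, d) \<in> ?B \<times> ?B. z (mcoeff (?m (\<lambda>v. c v + d v)) a) * (mcoeff S c * mcoeff T d))"
  proof (rule sum.mono_neutral_left)
    show "finite (?B \<times> ?B)" by (simp add: fin)
  next
    have "mcoeff (?m (\<lambda>v. c v + d v)) a = 0" if "\<not> mdeg c + mdeg d \<le> n" for c d
      using that by (intro mcoeff_monomial_of \<phi>) (simp add: mdeg_add n_def)
    then have "z (mcoeff (?m (\<lambda>v. c v + d v)) a) * (mcoeff S c * mcoeff T d) = 0"
      if "\<not> mdeg c + mdeg d \<le> n" for c d
      using that by (simp add: z)
    then show "\<forall>i\<in>?B \<times> ?B - {(c, d). mdeg c + mdeg d \<le> n}.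
        (case i of (c, d) \<Rightarrow> z (mcoeff (?m (\<lambda>v. c v + d v)) a) * (mcoeff S c * mcoeff T d)) = 0"
      by force
  qed auto
  also have "\<dots> = (\<Sum>c\<in>?B. \<Sum>d\<in>?B. z (mcoeff (?m (\<lambda>v. c v + d v)) a) * (mcoeff S c * mcoeff T d))"
    by (rule sum.cartesian_product [of "\<lambda>c d. z (mcoeff (?m (\<lambda>v. c v + d v)) a) * (mcoeff S c * mcoeff T d)" ?B ?B, symmetric])
  also have "\<dots> = (\<Sum>c\<in>?B. \<Sum>d\<in>?B. \<Sum>e | e \<le> a.
      (z (mcoeff (?m c) e) * mcoeff S c) * (z (mcoeff (?m d) (a - e)) * mcoeff T d))"
  proof (intro sum.cong refl)
    fix c d :: "'v \<Rightarrow> nat"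
    show "z (mcoeff (?m (\<lambda>v. c v + d v)) a) * (mcoeff S c * mcoeff T d) =
      (\<Sum>e | e \<le> a. (z (mcoeff (?m c) e) * mcoeff S c) * (z (mcoeff (?m d) (a - e)) * mcoeff T d))"
      unfolding monomial_of_add mcoeff_mult sum_z z(4) sum_distrib_right swap ..
  qed
  also have "\<dots> = (\<Sum>c\<in>?B. \<Sum>e | e \<le> a. \<Sum>d\<in>?B. 
      (z (mcoeff (?m c) e) * mcoeff S c) * (z (mcoeff (?m d) (a - e)) * mcoeff T d))"
    by (rule sum.cong, rule refl, rule sum.swap)
  also have "\<dots> = (\<Sum>e | e \<le> a. \<Sum>c\<in>?B. \<Sum>d\<in>?B. 
      (z (mcoeff (?m c) e) * mcoeff S c) * (z (mcoeff (?m d) (a - e)) * mcoeff T d))"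
    by (rule sum.swap)
  also have "\<dots> = (\<Sum>e | e \<le> a. mcoeff (subst_series z \<phi> S) e * mcoeff (subst_series z \<phi> T) (a - e))"
  proof (rule sum.cong [OF refl])
    fix e assume "e \<in> {e. e \<le> a}"
    then have "mdeg e \<le> n" "mdeg (a - e) \<le> n"
      using mdeg_diff [of e a] by (auto simp: n_def)
    then show "(\<Sum>c\<in>?B. \<Sum>d\<in>?B. 
        (z (mcoeff (?m c) e) * mcoeff S c) * (z (mcoeff (?m d) (a - e)) * mcoeff T d)) =
        mcoeff (subst_series z \<phi> S) e * mcoeff (subst_series z \<phi> T) (a - e)"
      by (simp only: subst_series_bound [where n = n] sum_product)
  qed
  finally show "mcoeff (subst_series z \<phi> (S * T)) a = mcoeff (subst_series z \<phi> S * subst_series z \<phi> T) a"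
    by (simp add: mcoeff_mult)
qed

end

lemma subst_scalar_eq: "subst_scalar = subst_series (\<lambda>c. c)"
  by (intro ext) (simp add: subst_scalar_def subst_series_def monomial_of_def)

lemma subst_endo_eq: "subst_endo = subst_series scalar_endo"
  by (intro ext) (simp add: subst_endo_def subst_series_def monomial_of_def)

context
  fixes \<phi> :: "param \<Rightarrow> scalar_series"
  assumes \<phi>: "\<And>p. hom_part 0 (\<phi> p) = 0"
begin

lemma subst_scalar_hom:
  "subst_scalar \<phi> (f + g) = subst_scalar \<phi> f + subst_scalar \<phi> g"
  "subst_scalar \<phi> (f * g) = subst_scalar \<phi> f * subst_scalar \<phi> g"
  "subst_scalar \<phi> (mconst c) = mconst c"
proof -
  show "subst_scalar \<phi> (f + g) = subst_scalar \<phi> f + subst_scalar \<phi> g"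
    unfolding subst_scalar_eq by (rule subst_series_add) (simp_all add: \<phi>)
  show "subst_scalar \<phi> (f * g) = subst_scalar \<phi> f * subst_scalar \<phi> g"
    unfolding subst_scalar_eq by (rule subst_series_mult) (simp_all add: \<phi>)
  show "subst_scalar \<phi> (mconst c) = mconst c"
    unfolding subst_scalar_eq by (rule subst_series_mconst) (simp_all add: \<phi>)
qed

lemma subst_endo_hom:
  "subst_endo \<phi> (S + T) = subst_endo \<phi> S + subst_endo \<phi> T"
  "subst_endo \<phi> (S * T) = subst_endo \<phi> S * subst_endo \<phi> T"
  "subst_endo \<phi> (mconst A) = mconst A"
proof -
  note z = scalar_endo_hom scalar_endo_commute [symmetric] \<phi>
  show "subst_endo \<phi> (S + T) = subst_endo \<phi> S + subst_endo \<phi> T"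
    unfolding subst_endo_eq by (rule subst_series_add) (rule z)+
  show "subst_endo \<phi> (S * T) = subst_endo \<phi> S * subst_endo \<phi> T"
    unfolding subst_endo_eq by (rule subst_series_mult) (rule z)+
  show "subst_endo \<phi> (mconst A) = mconst A"
    unfolding subst_endo_eq by (rule subst_series_mconst) (rule z)+
qed

lemma subst_endo_embed: "subst_endo \<phi> (embed f) = embed (subst_scalar \<phi> f)"
  by (auto intro!: mfps_eqI simp: subst_endo_def subst_scalar_def scalar_endo_sum scalar_endo_hom)

lemma subst_scalar_mvar: "subst_scalar \<phi> (mvar p) = \<phi> p"
proof (rule mfps_eqI)
  fix a :: "param \<Rightarrow> nat"
  let ?d = "\<lambda>w. if w = p then 1 else 0 :: nat"
  have d: "mdeg ?d = 1" by (simp add: mdeg_def)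
  have m: "monomial_of \<phi> ?d = \<phi> p"
    by (simp add: monomial_of_def if_distrib [of "\<lambda>n. _ ^ n"] cong: if_cong)
  have "mcoeff (subst_scalar \<phi> (mvar p)) a =
     (\<Sum>b | mdeg b \<le> mdeg a. if b = ?d then mcoeff (monomial_of \<phi> b) a else 0)"
    by (auto simp: subst_scalar_def mvar_def monomial_of_def intro!: sum.cong)
  also have "\<dots> = (if 1 \<le> mdeg a then mcoeff (\<phi> p) a else 0)"
    by (subst sum.delta) (use d in \<open>auto simp: finite_mdeg_le m\<close>)
  also have "\<dots> = mcoeff (\<phi> p) a"
    using mcoeff_hom_part [of 0 "\<phi> p" a] \<phi> [of p] by auto
  finally show "mcoeff (subst_scalar \<phi> (mvar p)) a = mcoeff (\<phi> p) a" .
qed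

lemma subst_diff: 
  "subst_scalar \<phi> (f - g) = subst_scalar \<phi> f - subst_scalar \<phi> g"
  "subst_endo \<phi> (S - T) = subst_endo \<phi> S - subst_endo \<phi> T"
  using subst_scalar_hom(1) [of "f - g" g] subst_endo_hom(1) [of "S - T" T] by simp_all

lemma subst_endo_uminus: "subst_endo \<phi> (- S) = - subst_endo \<phi> S"
  using subst_diff(2) [of 0 S] subst_diff(2) [of 0 0] by simp

lemma subst_endo_sum: "subst_endo \<phi> (\<Sum>i\<in>A. f i) = (\<Sum>i\<in>A. subst_endo \<phi> (f i))"
  using subst_diff(2) [of 0 0]
  by (induction A rule: infinite_finite_induct) (auto simp: subst_endo_hom)

lemma is_ideal_relations_between: 
  assumes "is_ideal R" shows "is_ideal (relations_between \<phi> R)"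
  using assms subst_diff(1) [of 0 0]
  by (auto simp: is_ideal_def relations_between_def subst_scalar_hom)

end

section \<open>Operators with constant coefficients\<close>

definition basis_symbol :: "weight \<Rightarrow> nat \<Rightarrow> symbols" where
  "basis_symbol i n = (\<chi> j. if j = i then monom 1 n else 0)"

lemma scale_symbols_nth [simp]: "scale_symbols c u $ i = smult c (u $ i)"
  by (simp add: scale_symbols_def)

lemma scale_symbols_sum: "scale_symbols c (\<Sum>i\<in>S. f i) = (\<Sum>i\<in>S. scale_symbols c (f i))"
  by (induction S rule: infinite_finite_induct) (simp_all add: scale_symbols_simps)

lemma app_sum: "app A (\<Sum>i\<in>S. f i) = (\<Sum>i\<in>S. app A (f i))"
proof -
  have "app A 0 = 0" using app_add [of A 0 0] by simp
  then show ?thesis by (induction S rule: infinite_finite_induct) (simp_all add: app_add)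
qed

lemma app_sum_left: "app (\<Sum>i\<in>S. f i) u = (\<Sum>i\<in>S. app (f i) u)"
  by (induction S rule: infinite_finite_induct) simp_all

text \<open>No growth condition is put on the values on monomials; operators of infinite order are
  thereby available without convergence questions.\<close>

definition from_basis :: "(weight \<Rightarrow> nat \<Rightarrow> symbols) \<Rightarrow> endo" where
  "from_basis v = Endo (\<lambda>u. \<Sum>i\<in>UNIV. \<Sum>n\<le>degree (u $ i). scale_symbols (coeff (u $ i) n) (v i n))"

lemma sum_coeff_bound:
  assumes "degree p \<le> N"
  shows "(\<Sum>n\<le>degree p. scale_symbols (coeff p n) (w n)) = (\<Sum>n\<le>N. scale_symbols (coeff p n) (w n))"
  using assms by (intro sum.mono_neutral_left) (auto simp: coeff_eq_0 scale_symbols_simps)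

lemma from_basis_linear:
  "clinear_symbols (\<lambda>u. \<Sum>i\<in>UNIV. \<Sum>n\<le>degree (u $ i). scale_symbols (coeff (u $ i) n) (v i n))"
  unfolding clinear_symbols_def
proof (intro conjI allI)
  fix u w :: symbols and c
  show "(\<Sum>i\<in>UNIV. \<Sum>n\<le>degree ((u + w) $ i). scale_symbols (coeff ((u + w) $ i) n) (v i n)) =
    (\<Sum>i\<in>UNIV. \<Sum>n\<le>degree (u $ i). scale_symbols (coeff (u $ i) n) (v i n)) +
    (\<Sum>i\<in>UNIV. \<Sum>n\<le>degree (w $ i). scale_symbols (coeff (w $ i) n) (v i n))"
    unfolding sum.distrib [symmetric]
  proof (rule sum.cong [OF refl])
    fix i
    define N where "N = max (degree (u $ i)) (degree (w $ i))"
    have N: "degree (u $ i) \<le> N" "degree (w $ i) \<le> N" "degree (u $ i + w $ i) \<le> N"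
      by (auto simp: N_def intro: degree_add_le)
    show "(\<Sum>n\<le>degree ((u + w) $ i). scale_symbols (coeff ((u + w) $ i) n) (v i n)) =
      (\<Sum>n\<le>degree (u $ i). scale_symbols (coeff (u $ i) n) (v i n)) +
      (\<Sum>n\<le>degree (w $ i). scale_symbols (coeff (w $ i) n) (v i n))"
      unfolding vector_add_component N [THEN sum_coeff_bound]
      by (simp add: scale_symbols_simps sum.distrib)
  qed
  show "(\<Sum>i\<in>UNIV. \<Sum>n\<le>degree (scale_symbols c u $ i). scale_symbols (coeff (scale_symbols c u $ i) n) (v i n)) =
    scale_symbols c (\<Sum>i\<in>UNIV. \<Sum>n\<le>degree (u $ i). scale_symbols (coeff (u $ i) n) (v i n))"
    unfolding scale_symbols_sum
  proof (rule sum.cong [OF refl])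
    fix i
    have "degree (smult c (u $ i)) \<le> degree (u $ i)" by (rule degree_smult_le)
    from sum_coeff_bound [OF this]
    show "(\<Sum>n\<le>degree (scale_symbols c u $ i). scale_symbols (coeff (scale_symbols c u $ i) n) (v i n)) =
      (\<Sum>n\<le>degree (u $ i). scale_symbols c (scale_symbols (coeff (u $ i) n) (v i n)))"
      by (simp add: scale_symbols_simps)
  qed
qed

lemma app_from_basis: 
  "app (from_basis v) u = (\<Sum>i\<in>UNIV. \<Sum>n\<le>degree (u $ i). scale_symbols (coeff (u $ i) n) (v i n))"
  by (simp add: from_basis_def app_Endo from_basis_linear)

lemma app_from_basis_symbol [simp]: "app (from_basis v) (basis_symbol i n) = v i n"
proof -
  have "(\<Sum>m\<le>degree (basis_symbol i n $ k). scale_symbols (coeff (basis_symbol i n $ k) m) (v k m)) =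
    (if k = i then v i n else 0)" for k
  proof (cases "k = i")
    case True
    have "(\<Sum>m\<le>n. scale_symbols (coeff (monom 1 n) m) (v i m)) = (\<Sum>m\<le>n. if m = n then v i m else 0)"
      by (intro sum.cong) (auto simp: scale_symbols_simps)
    then show ?thesis
      using True by (simp add: basis_symbol_def degree_monom_eq)
  qed (simp add: basis_symbol_def scale_symbols_simps)
  then show ?thesis by (simp add: app_from_basis)
qed

lemma symbols_decomp:
  "u = (\<Sum>i\<in>UNIV. \<Sum>n\<le>degree (u $ i). scale_symbols (coeff (u $ i) n) (basis_symbol i n))"
proof -
  have "(\<Sum>n\<le>degree (u $ i). smult (coeff (u $ i) n) (basis_symbol i n $ j)) = (if i = j then u $ j else 0)"
    for i j
    by (simp add: basis_symbol_def smult_monom poly_as_sum_of_monoms)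
  then show ?thesis
    by (simp add: vec_eq_iff)
qed

lemma endo_eq_basis:
  assumes "\<And>i n. app A (basis_symbol i n) = app B (basis_symbol i n)"
  shows "A = B"
proof (rule endo_eqI)
  fix u
  show "app A u = app B u"
    by (subst (1 2) symbols_decomp [of u]) (simp only: app_sum app_scale assms)
qed

definition dx :: endo where "dx = Endo (\<lambda>u. \<chi> i. pderiv (u $ i))"
definition mult_by :: "complex poly \<Rightarrow> endo" where "mult_by q = Endo (\<lambda>u. \<chi> i. q * u $ i)"
text \<open>The value at x = 0 is kept as an endomorphism, so that it is taken by left
  multiplication and annihilates everything with a left factor x.\<close>

definition ev0 :: endo where "ev0 = Endo (\<lambda>u. \<chi> i. [:coeff (u $ i) 0:])"
definition diag :: "(weight \<Rightarrow> complex) \<Rightarrow> endo" where "diag c = Endo (\<lambda>u. \<chi> i. smult (c i) (u $ i))"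
definition mat_unit :: "weight \<Rightarrow> weight \<Rightarrow> endo" where
  "mat_unit i j = Endo (\<lambda>u. \<chi> k. if k = j then u $ i else 0)"

abbreviation x_endo :: endo where "x_endo \<equiv> mult_by [:0, 1:]"
abbreviation weights :: endo where "weights \<equiv> diag (\<lambda>i. of_nat (wt i))"

lemma app_operators [simp]:
  "app dx u $ i = pderiv (u $ i)" "app (mult_by q) u $ i = q * u $ i"
  "app ev0 u $ i = [:coeff (u $ i) 0:]" "app (diag c) u $ i = smult (c i) (u $ i)"
  "app (mat_unit j k) u $ i = (if i = k then u $ j else 0)"
  unfolding dx_def mult_by_def ev0_def diag_def mat_unit_def
  by (subst app_Endo; simp add: clinear_symbols_def vec_eq_iff pderiv_add pderiv_smult algebra_simps
      smult_add_right)+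

lemma endo_eq_nth: "(\<And>u i. app A u $ i = app B u $ i) \<Longrightarrow> A = B"
  by (auto intro!: endo_eqI simp: vec_eq_iff)

lemma dx_mult_by: "dx * mult_by q = mult_by q * dx + mult_by (pderiv q)"
  by (rule endo_eq_nth) (simp add: pderiv_mult algebra_simps)

lemma mult_by_hom:
  "mult_by (p * q) = mult_by p * mult_by q" "mult_by (p + q) = mult_by p + mult_by q"
  "mult_by (smult c p) = scalar_endo c * mult_by p" "mult_by 0 = 0" "mult_by 1 = 1"
  by (rule endo_eq_nth; simp add: algebra_simps)+

lemma operator_commutes:
  "diag c * mult_by q = mult_by q * diag c" "diag c * dx = dx * diag c" "ev0 * diag c = diag c * ev0"
  "mat_unit i j * mult_by q = mult_by q * mat_unit i j" "mat_unit i j * dx = dx * mat_unit i j"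
  "ev0 * mat_unit i j = mat_unit i j * ev0" "diag c * diag e = diag e * diag c"
  "mult_by p * mult_by q = mult_by q * mult_by p"
  by (rule endo_eq_nth; simp add: pderiv_smult mult.commute pderiv_0 mult.left_commute)+

lemma ev0_x: "ev0 * x_endo = 0"
  by (rule endo_eq_nth) (simp add: coeff_mult)

lemma ev0_mult_by: "ev0 * mult_by q = scalar_endo (coeff q 0) * ev0"
  by (rule endo_eq_nth) (simp add: coeff_mult)

lemma lie_symbols_eq:
  "lie_symbols X = mult_by (Dx 0 X) * dx + mult_by (Dx 1 X) * weights"
proof -
  have "clinear_symbols (\<lambda>u. \<chi> i. lie_density (wt i) X (u $ i))"
    by (simp add: clinear_symbols_def vec_eq_iff lie_density_def pderiv_add pderiv_smult algebra_simps
        smult_add_right)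
  then show ?thesis
    by (intro endo_eq_nth) (simp add: lie_symbols_def app_Endo lie_density_def of_nat_poly mult.assoc)
qed

lemma basis_symbol_operators [simp]:
  "app dx (basis_symbol i 0) = 0"
  "app dx (basis_symbol i (Suc n)) = scale_symbols (of_nat (Suc n)) (basis_symbol i n)"
  "app x_endo (basis_symbol i n) = basis_symbol i (Suc n)"
  "app (diag c) (basis_symbol i n) = scale_symbols (c i) (basis_symbol i n)"
  by (auto simp: vec_eq_iff basis_symbol_def pderiv_monom smult_monom simp flip: monom_Suc)

section \<open>A right inverse of the commutator with \<partial>\<close>

definition poly_integral :: "complex poly \<Rightarrow> complex poly" where
  "poly_integral p = (\<Sum>n\<le>degree p. monom (coeff p n / of_nat (Suc n)) (Suc n))"

lemma coeff_poly_integral_0 [simp]: "coeff (poly_integral p) 0 = 0"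
  by (simp add: poly_integral_def coeff_sum)

lemma coeff_poly_integral_Suc [simp]: "coeff (poly_integral p) (Suc n) = coeff p n / of_nat (Suc n)"
proof -
  have "coeff (poly_integral p) (Suc n) = (\<Sum>m\<le>degree p. if m = n then coeff p m / of_nat (Suc m) else 0)"
    unfolding poly_integral_def coeff_sum by (intro sum.cong) auto
  also have "\<dots> = coeff p n / of_nat (Suc n)"
    by (subst sum.delta) (auto simp: coeff_eq_0)
  finally show ?thesis .
qed

lemma poly_integral_linear:
  "poly_integral (p + q) = poly_integral p + poly_integral q" "poly_integral (smult c p) = smult c (poly_integral p)"
  by (rule poly_eqI, rename_tac n, case_tac n, simp_all add: add_divide_distrib)+

lemma pderiv_poly_integral: "pderiv (poly_integral p) = p"
  by (rule poly_eqI) (simp add: coeff_pderiv del: of_nat_Suc)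

definition symbol_integral :: "symbols \<Rightarrow> symbols" where
  "symbol_integral u = (\<chi> i. poly_integral (u $ i))"

text \<open>The equation \<open>dx * J - J * dx = A\<close>, applied to x^n, says that the
  derivative of J x^n is A x^n + n J x^(n-1). Integrating from 0 gives the recursion and makes all
  values of J vanish at x = 0.\<close>

primrec antideriv_basis :: "endo \<Rightarrow> weight \<Rightarrow> nat \<Rightarrow> symbols" where
  "antideriv_basis A i 0 = symbol_integral (app A (basis_symbol i 0))"
| "antideriv_basis A i (Suc n) = symbol_integral (app A (basis_symbol i (Suc n)) +
     scale_symbols (of_nat (Suc n)) (antideriv_basis A i n))"

definition antideriv :: "endo \<Rightarrow> endo" where
  "antideriv A = from_basis (antideriv_basis A)"

lemma symbol_integral_linear:
  "symbol_integral (u + v) = symbol_integral u + symbol_integral v"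
  "symbol_integral (scale_symbols c u) = scale_symbols c (symbol_integral u)"
  by (simp_all add: symbol_integral_def vec_eq_iff poly_integral_linear)

lemma app_dx_symbol_integral: "app dx (symbol_integral u) = u"
  by (simp add: vec_eq_iff symbol_integral_def pderiv_poly_integral)

lemma app_ev0_symbol_integral: "app ev0 (symbol_integral u) = 0"
  by (simp add: vec_eq_iff symbol_integral_def)

lemma dx_antideriv: "dx * antideriv A - antideriv A * dx = A"
proof (rule endo_eq_basis)
  fix i n show "app (dx * antideriv A - antideriv A * dx) (basis_symbol i n) = app A (basis_symbol i n)"
    by (cases n) (simp_all add: antideriv_def app_dx_symbol_integral app_scale del: of_nat_Suc,
        metis app_scale scale_symbols_simps(1,5))
qed

lemma ev0_antideriv: "ev0 * antideriv A = 0"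
proof (rule endo_eq_basis)
  fix i n show "app (ev0 * antideriv A) (basis_symbol i n) = app 0 (basis_symbol i n)"
    by (cases n) (simp_all add: antideriv_def app_ev0_symbol_integral)
qed

lemma endo_linear_antideriv: "endo_linear antideriv"
proof -
  have "antideriv_basis (A + B) i n = antideriv_basis A i n + antideriv_basis B i n" for A B i n
    by (induction n) (simp_all add: symbol_integral_linear [symmetric] scale_symbols_simps algebra_simps del: of_nat_Suc)
  moreover have "antideriv_basis (scalar_endo c * A) i n = scale_symbols c (antideriv_basis A i n)" for A c i n
    by (induction n) (simp_all add: symbol_integral_linear [symmetric] scale_symbols_simps
        mult.commute flip: scale_symbols_simps(4) del: of_nat_Suc)
  ultimately show ?thesis
    unfolding endo_linear_def by (auto intro!: endo_eq_basis simp: antideriv_def)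
qed

text \<open>\<open>symbol_coeff k i j A\<close> is the coefficient of \<open>\<partial>\<^sup>k\<close> (from weight \<open>i\<close> to weight \<open>j\<close>) of the value at
  \<open>x = 0\<close> of \<open>A\<close>, viewed as a differential operator of possibly infinite order.\<close>

definition symbol_coeff :: "nat \<Rightarrow> weight \<Rightarrow> weight \<Rightarrow> endo \<Rightarrow> complex" where
  "symbol_coeff k i j A = coeff (app A (basis_symbol i k) $ j) 0 / fact k"

text \<open>The series of the operators \<open>g k i j\<close> times \<partial>^k over all k. It is
  locally finite: on x^n only k \<le> n contributes, with \<partial>^k x^n = n!/(n-k)!
  x^(n-k).\<close>

definition const_coeff_op :: "(nat \<Rightarrow> weight \<Rightarrow> weight \<Rightarrow> complex) \<Rightarrow> endo" where
  "const_coeff_op g = from_basis (\<lambda>i n. \<chi> j. \<Sum>k\<le>n. monom (g k i j * fact n / fact (n - k)) (n - k))"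

lemma endo_functional_symbol_coeff: "endo_functional (symbol_coeff k i j)"
  by (simp add: endo_functional_def symbol_coeff_def add_divide_distrib)

lemmas symbol_coeff_linear = endo_functionalD [OF endo_functional_symbol_coeff]

lemma symbol_coeff_const_coeff_op [simp]: "symbol_coeff k i j (const_coeff_op g) = g k i j"
proof -
  have "coeff (app (const_coeff_op g) (basis_symbol i k) $ j) 0 = 
    (\<Sum>m\<le>k. if m = k then g m i j * fact k else 0)"
    unfolding const_coeff_op_def by (auto simp: coeff_sum intro!: sum.cong)
  then show ?thesis by (simp add: symbol_coeff_def)
qed

lemma pderiv_sum: "pderiv (\<Sum>i\<in>S. f i) = (\<Sum>i\<in>S. pderiv (f i))"
  by (induction S rule: infinite_finite_induct) (simp_all add: pderiv_add)

lemma smult_sum_right: "smult c (\<Sum>i\<in>S. f i) = (\<Sum>i\<in>S. smult c (f i))"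
  by (induction S rule: infinite_finite_induct) (simp_all add: smult_add_right)

lemma const_coeff_op_dx: "dx * const_coeff_op g = const_coeff_op g * dx"
proof (rule endo_eq_basis)
  fix i n 
  show "app (dx * const_coeff_op g) (basis_symbol i n) = app (const_coeff_op g * dx) (basis_symbol i n)"
  proof (cases n)
    case 0
    have "app (const_coeff_op g) 0 = 0" by (metis app_scale scale_symbols_simps(1))
    with 0 show ?thesis
      by (simp add: vec_eq_iff const_coeff_op_def pderiv_monom)
  next
    case (Suc m)
    have *: "pderiv (\<Sum>k\<le>Suc m. monom (g k i j * fact (Suc m) / fact (Suc m - k)) (Suc m - k)) =
      smult (of_nat (Suc m)) (\<Sum>k\<le>m. monom (g k i j * fact m / fact (m - k)) (m - k))" for j
    proof -
      have "pderiv (\<Sum>k\<le>Suc m. monom (g k i j * fact (Suc m) / fact (Suc m - k)) (Suc m - k)) =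
        (\<Sum>k\<le>m. pderiv (monom (g k i j * fact (Suc m) / fact (Suc m - k)) (Suc m - k)))"
        by (simp add: pderiv_sum pderiv_add pderiv_monom)
      also have "\<dots> = (\<Sum>k\<le>m. smult (of_nat (Suc m)) (monom (g k i j * fact m / fact (m - k)) (m - k)))"
      proof (rule sum.cong [OF refl])
        fix k assume "k \<in> {..m}"
        then have "Suc m - k = Suc (m - k)" by auto
        then show "pderiv (monom (g k i j * fact (Suc m) / fact (Suc m - k)) (Suc m - k)) =
           smult (of_nat (Suc m)) (monom (g k i j * fact m / fact (m - k)) (m - k))"
          by (simp add: pderiv_monom smult_monom del: of_nat_Suc)
      qed
      finally show ?thesis by (simp only: smult_sum_right)
    qed
    show ?thesis
      unfolding Suc by (simp only: app_simps basis_symbol_operators app_scale vec_eq_iff app_operators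
          const_coeff_op_def app_from_basis_symbol vec_lambda_beta * scale_symbols_nth) simp
  qed
qed

text \<open>An operator commuting with \<partial> is determined by its values at x = 0: the
  derivative of the image of x^n is n times the image of x^(n-1), and the remaining constant of
  integration is a symbol coefficient.\<close>

lemma const_coeff_eqI:
  assumes "dx * A = A * dx" "dx * B = B * dx" "\<And>k i j. symbol_coeff k i j A = symbol_coeff k i j B"
  shows "A = B"
proof (rule endo_eq_basis)
  fix i n
  have comm: "app dx (app (A - B) u) = app (A - B) (app dx u)" for u
    using assms(1,2) by (metis app_simps(6) left_diff_distrib right_diff_distrib)
  have z: "app (A - B) 0 = 0" by (metis app_scale scale_symbols_simps(1))
  have "app (A - B) (basis_symbol i n) = 0"
  proof (induction n)
    case 0
    have "pderiv (app (A - B) (basis_symbol i 0) $ j) = 0" for j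
      using comm [of "basis_symbol i 0"] z by (simp add: vec_eq_iff)
    moreover have "coeff (app (A - B) (basis_symbol i 0) $ j) 0 = 0" for j
      using assms(3) [of 0 i j] by (simp add: symbol_coeff_def)
    ultimately show ?case
      by (metis vec_eq_iff zero_index pderiv_eq_0_iff degree_0_id of_nat_0 coeff_pCons_0 degree_eq_zeroE pCons_0_0)
  next
    case (Suc n)
    have "pderiv (app (A - B) (basis_symbol i (Suc n)) $ j) = 0" for j
      using comm [of "basis_symbol i (Suc n)"] Suc
      by (simp add: vec_eq_iff app_scale del: of_nat_Suc app_simps)
    moreover have "coeff (app (A - B) (basis_symbol i (Suc n)) $ j) 0 = 0" for j
      using assms(3) [of "Suc n" i j] by (simp add: symbol_coeff_def del: fact_Suc)
    ultimately show ?case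
      by (metis vec_eq_iff zero_index pderiv_eq_0_iff degree_0_id of_nat_0 coeff_pCons_0 degree_eq_zeroE pCons_0_0)
  qed
  then show "app A (basis_symbol i n) = app B (basis_symbol i n)" by simp
qed

lemma symbol_coeff_ev0: 
  assumes "ev0 * A = ev0 * B" shows "symbol_coeff k i j A = symbol_coeff k i j B"
proof -
  have "app (ev0 * A) (basis_symbol i k) $ j = app (ev0 * B) (basis_symbol i k) $ j"
    by (simp only: assms)
  then show ?thesis by (simp add: symbol_coeff_def)
qed

text \<open>The calculus of symbols at x = 0: right multiplication by x differentiates the symbol,
  right multiplication by \<partial> shifts its coefficients, and a left factor x is killed.\<close>

lemma symbol_coeff_operators:
  "symbol_coeff k i j (A * x_endo) = of_nat (Suc k) * symbol_coeff (Suc k) i j A"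
  "symbol_coeff k i j (x_endo * A) = 0"
  "symbol_coeff 0 i j (A * dx) = 0" "symbol_coeff (Suc k) i j (A * dx) = symbol_coeff k i j A"
  "symbol_coeff k i j (diag c * A) = c j * symbol_coeff k i j A"
  "symbol_coeff k i j (A * diag c) = c i * symbol_coeff k i j A"
proof -
  have z: "app A 0 = 0" by (metis app_scale scale_symbols_simps(1))
  have n: "(1 + of_nat k :: complex) \<noteq> 0" by (metis of_nat_Suc of_nat_eq_0_iff nat.simps(3))
  show "symbol_coeff k i j (A * x_endo) = of_nat (Suc k) * symbol_coeff (Suc k) i j A"
    using n by (simp add: symbol_coeff_def divide_simps)
  show "symbol_coeff k i j (x_endo * A) = 0"
    by (simp add: symbol_coeff_def coeff_mult)
  show "symbol_coeff 0 i j (A * dx) = 0" by (simp add: symbol_coeff_def z)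
  show "symbol_coeff (Suc k) i j (A * dx) = symbol_coeff k i j A" 
    using n by (simp add: symbol_coeff_def app_scale divide_simps del: of_nat_Suc)
  show "symbol_coeff k i j (diag c * A) = c j * symbol_coeff k i j A" by (simp add: symbol_coeff_def)
  show "symbol_coeff k i j (A * diag c) = c i * symbol_coeff k i j A"
    by (simp add: symbol_coeff_def app_scale)
qed

text \<open>Only the value of \<open>A\<close> at x = 0 is used, so the map is linear on all
  endomorphisms and can be lifted to series even where \<open>A\<close> does not commute with
  \<open>dx\<close>.\<close>

definition multiplier :: "(nat \<Rightarrow> weight \<Rightarrow> weight \<Rightarrow> complex) \<Rightarrow> endo \<Rightarrow> endo" where
  "multiplier m A = const_coeff_op (\<lambda>k i j. m k i j * symbol_coeff k i j A)"

lemma symbol_coeff_multiplier [simp]: "symbol_coeff k i j (multiplier m A) = m k i j * symbol_coeff k i j A"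
  by (simp add: multiplier_def)

lemma dx_multiplier: "dx * multiplier m A = multiplier m A * dx"
  by (simp add: multiplier_def const_coeff_op_dx)

lemma endo_linear_multiplier: "endo_linear (multiplier m)"
  unfolding endo_linear_def
proof (intro conjI allI)
  note fn = symbol_coeff_linear
  fix A B c
  show "multiplier m (A + B) = multiplier m A + multiplier m B"
    by (rule const_coeff_eqI) (simp_all add: fn dx_multiplier distrib_left distrib_right)
  show "multiplier m (scalar_endo c * A) = scalar_endo c * multiplier m A"
    by (rule const_coeff_eqI) (simp_all add: fn dx_multiplier scalar_endo_left_commute mult.assoc)
qed

section \<open>Gauge transformations\<close>

abbreviation DD :: endo_series where "DD \<equiv> mconst dx"
abbreviation XX :: endo_series where "XX \<equiv> mconst x_endo"
abbreviation WW :: endo_series where "WW \<equiv> mconst weights"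
abbreviation EE :: endo_series where "EE \<equiv> mconst ev0"

definition const_coeff :: "endo_series \<Rightarrow> bool" where
  "const_coeff T \<longleftrightarrow> DD * T = T * DD"

text \<open>The commutator with x differentiates a symbol with respect to the covariable.\<close>

definition symbol_deriv :: "endo_series \<Rightarrow> endo_series" where
  "symbol_deriv T = T * XX - XX * T"

text \<open>The constant coefficient series with the same value at x = 0. Through
  \<open>antideriv\<close> the difference from \<open>T\<close> is the image of the commutator with
  \<partial> under a coefficientwise linear map, and therefore lies in the ideal as soon as that
  commutator does.\<close>

definition const_part :: "endo_series \<Rightarrow> endo_series" where
  "const_part T = T - lift antideriv (DD * T - T * DD)"

lemma dx_x: "dx * x_endo = x_endo * dx + 1"
  using dx_mult_by [of "[:0, 1:]"] by (simp add: pderiv_pCons mult_by_hom(5) flip: one_pCons)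

lemma DD_XX: "DD * XX = XX * DD + 1"
  by (simp add: mconst_arith(4) [symmetric] dx_x) (simp add: mconst_arith)

lemma EE_XX: "EE * XX = 0" "EE * (XX * T) = 0"
  by (simp_all add: mconst_arith(4) [symmetric] ev0_x mult.assoc [symmetric])
   
lemma WW_commutes: "WW * DD = DD * WW" "WW * XX = XX * WW" "EE * WW = WW * EE"
  by (simp_all add: mconst_arith(4) [symmetric] operator_commutes)

lemma const_coeff_mcoeff: "const_coeff T \<longleftrightarrow> (\<forall>a. dx * mcoeff T a = mcoeff T a * dx)"
  unfolding const_coeff_def by (metis mfps_eqI mcoeff_mconst_mult mcoeff_mult_mconst)

lemma const_coeff_intros:
  "const_coeff S \<Longrightarrow> const_coeff T \<Longrightarrow> const_coeff (S + T)"
  "const_coeff S \<Longrightarrow> const_coeff T \<Longrightarrow> const_coeff (S - T)"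
  "const_coeff S \<Longrightarrow> const_coeff T \<Longrightarrow> const_coeff (S * T)"
  "const_coeff S \<Longrightarrow> const_coeff (- S)"
  "const_coeff 0" "const_coeff 1" "const_coeff DD" "const_coeff WW"
  unfolding const_coeff_def
  by (simp_all add: distrib_left distrib_right left_diff_distrib right_diff_distrib WW_commutes)
    (metis mult.assoc)

lemma const_coeff_embed: "const_coeff T \<Longrightarrow> const_coeff (embed f * T)"
  unfolding const_coeff_def by (metis embed_left_commute mult.assoc)

lemma const_coeff_symbol_deriv: 
  assumes "const_coeff T" shows "const_coeff (symbol_deriv T)"
proof -
  have T: "DD * T = T * DD" using assms by (simp add: const_coeff_def)
  have T': "DD * (T * S) = T * (DD * S)" for S
    by (simp add: T mult.assoc [symmetric])
  have D: "DD * (XX * S) = XX * (DD * S) + S" for S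
    by (simp add: DD_XX distrib_right mult.assoc [symmetric])
  show ?thesis
    by (simp add: const_coeff_def symbol_deriv_def algebra_simps T T' D DD_XX)
qed

lemma const_coeff_inverse:
  assumes "const_coeff P" "P * Q = 1" "Q * P = 1" shows "const_coeff Q"
proof -
  have "Q * DD = Q * (DD * P) * Q" by (simp add: mult.assoc assms(2))
  also have "\<dots> = Q * (P * DD) * Q" using assms(1) by (simp add: const_coeff_def)
  also have "\<dots> = DD * Q" by (simp add: mult.assoc [symmetric] assms(3))
  finally show ?thesis by (simp add: const_coeff_def)
qed

lemma const_coeff_lift_multiplier: "const_coeff (lift (multiplier m) T)"
  by (simp add: const_coeff_mcoeff dx_multiplier)

lemma const_coeff_mult_XX: "T * XX = XX * T + symbol_deriv T" "T * (XX * S) = XX * (T * S) + symbol_deriv T * S"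
  by (simp_all add: symbol_deriv_def algebra_simps)

lemma const_coeff_ev0_eqI:
  assumes "const_coeff S" "const_coeff T" "EE * S = EE * T" shows "S = T"
proof (rule mfps_eqI)
  fix a
  have "ev0 * mcoeff S a = ev0 * mcoeff T a" by (metis assms(3) mcoeff_mconst_mult)
  then show "mcoeff S a = mcoeff T a"
    using assms(1,2)
    by (intro const_coeff_eqI [of "mcoeff S a" "mcoeff T a"] symbol_coeff_ev0) (simp_all add: const_coeff_mcoeff)
qed

lemma DD_lift_antideriv: "DD * lift antideriv T - lift antideriv T * DD = T"
  by (rule mfps_eqI) (simp add: dx_antideriv)

lemma const_coeff_const_part: "const_coeff (const_part T)"
  using DD_lift_antideriv [of "DD * T - T * DD"]
  by (simp add: const_coeff_def const_part_def left_diff_distrib right_diff_distrib) (simp add: algebra_simps)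

lemma ev0_const_part: "EE * const_part T = EE * T"
proof -
  have "EE * lift antideriv S = 0" for S by (rule mfps_eqI) (simp add: ev0_antideriv)
  then show ?thesis by (simp add: const_part_def right_diff_distrib)
qed

lemma const_part_eqI: "const_coeff S \<Longrightarrow> EE * S = EE * T \<Longrightarrow> const_part T = S"
  by (rule const_coeff_ev0_eqI) (simp_all add: const_coeff_const_part ev0_const_part)

lemma const_part_id: "const_coeff T \<Longrightarrow> const_part T = T"
  by (rule const_part_eqI) simp_all

lemma const_part_arith:
  "const_part (S + T) = const_part S + const_part T" "const_part (S - T) = const_part S - const_part T"
  by (rule const_part_eqI; simp add: const_coeff_intros const_coeff_const_part ev0_const_part
      distrib_left right_diff_distrib)+

lemma cong_const_part:
  assumes "cong_base R (DD * T) (T * DD)" shows "cong_base R T (const_part T)"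
  using generated_by_lift [OF endo_linear_antideriv] assms
  by (simp add: cong_base_def const_part_def)

lemma const_part_generated_by:
  assumes "T \<in> generated_by R" shows "const_part T \<in> generated_by R"
  unfolding const_part_def
  by (intro generated_by_diff generated_by_lift endo_linear_antideriv generated_by_mult_left
      generated_by_mult_right assms)

lemma cong_base_const_part: "cong_base R S T \<Longrightarrow> cong_base R (const_part S) (const_part T)"
  unfolding cong_base_def const_part_arith(2) [symmetric] by (rule const_part_generated_by)

section \<open>Rigidity of the actions of 1, x and x^2\<close>

lemma hom_part_zero_mult: 
  fixes f g :: "('v::finite, 'a::ring_1) mfps"
  shows "hom_part 0 (f * g) = hom_part 0 f * hom_part 0 g"
  by (simp add: hom_part_mult)

text \<open>The equation \<open>P * T = DD * P\<close> says that the commutator of \<partial> with P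
  is P (T - \<partial>). Since T - \<partial> has order at least one, P = 1 + J (P (T -
  \<partial>)), with J the antiderivative, is a contraction.\<close>

lemma gauge_derivation:
  assumes "hom_part 0 T = DD"
  obtains P where "hom_part 0 P = 1" "P * T = DD * P"
proof -
  have v: "vanish 1 (T - DD)" using assms by (simp add: vanish_def hom_part_mconst)
  let ?J = "lift antideriv :: endo_series \<Rightarrow> endo_series"
  note J = lift_arith [OF endo_linear_antideriv]
  obtain P where P: "1 + ?J (P * (T - DD)) = P"
  proof (rule contraction_fixpoint [of "\<lambda>P. 1 + ?J (P * (T - DD))"])
    fix m and S S' :: endo_series assume "vanish m (S - S')"
    from vanish_lift [OF endo_linear_antideriv vanish_mult [OF this v]]
    show "vanish (Suc m) (1 + ?J (S * (T - DD)) - (1 + ?J (S' * (T - DD))))"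
      by (simp add: left_diff_distrib J)
  qed
  have "DD * P - P * DD = DD * ?J (P * (T - DD)) - ?J (P * (T - DD)) * DD"
    by (subst (1 2) P [symmetric]) (simp add: algebra_simps)
  also have "\<dots> = P * (T - DD)" by (rule DD_lift_antideriv)
  finally have eq: "P * T = DD * P" by (simp add: right_diff_distrib)
  have "vanish 1 (?J (P * (T - DD)))"
    by (intro vanish_lift endo_linear_antideriv vanish_mult_left v)
  then have "hom_part 0 P = 1"
    by (subst P [symmetric]) (simp add: vanish_def hom_part_one)
  with eq that show ?thesis by blast
qed

text \<open>In terms of symbols \<open>f\<close>, \<open>quad_solve\<close> inverts \<open>f \<mapsto> f'' \<partial> + 2 f' \<Lambda>\<close> on symbols without constant term,
  where \<open>\<Lambda>\<close> is the diagonal matrix of weights; it exists because the weights are positive.\<close>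

definition quad_solve :: "endo \<Rightarrow> endo" where
  "quad_solve A = multiplier (\<lambda>k i j. if k = 0 then 0 else 1 / of_nat (k * (k - 1 + 2 * wt i))) (A * dx)"

lemma wt_pos: "wt i > 0" by (cases i) auto

definition sderiv :: "endo \<Rightarrow> endo" where "sderiv A = A * x_endo - x_endo * A"

lemma dx_sderiv: 
  assumes "dx * A = A * dx" shows "dx * sderiv A = sderiv A * dx"
proof -
  have "const_coeff (mconst A)" using assms by (simp add: const_coeff_def flip: mconst_arith(4))
  then have "const_coeff (symbol_deriv (mconst A))" by (rule const_coeff_symbol_deriv)
  then have "const_coeff (mconst (sderiv A))"
    by (simp add: symbol_deriv_def sderiv_def mconst_arith)
  then have "mcoeff (mconst (dx * sderiv A) :: endo_series) (\<lambda>_. 0) = mcoeff (mconst (sderiv A * dx) :: endo_series) (\<lambda>_. 0)"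
    by (simp only: const_coeff_def mconst_arith(4))
  then show ?thesis by (simp add: mcoeff_mconst)
qed

lemma symbol_coeff_sderiv: "symbol_coeff k i j (sderiv A) = of_nat (Suc k) * symbol_coeff (Suc k) i j A"
  by (simp add: sderiv_def symbol_coeff_linear symbol_coeff_operators)

lemma endo_linear_quad_solve: "endo_linear quad_solve"
  unfolding quad_solve_def endo_linear_def
  by (simp add: distrib_right mult.assoc endo_linearD [OF endo_linear_multiplier])

lemma quad_coeff:
  assumes "dx * A = A * dx"
  shows "symbol_coeff k i j (sderiv (sderiv A) * dx + (sderiv A * weights + sderiv A * weights)) =
    of_nat (Suc k * (k + 2 * wt i)) * symbol_coeff (Suc k) i j A"
  by (cases k) (simp_all add: symbol_coeff_linear symbol_coeff_operators
     symbol_coeff_sderiv algebra_simps)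

lemma dx_quad:
  assumes "dx * A = A * dx"
  shows "dx * (sderiv (sderiv A) * dx + (sderiv A * weights + sderiv A * weights)) =
     (sderiv (sderiv A) * dx + (sderiv A * weights + sderiv A * weights)) * dx"
  using dx_sderiv [OF assms] dx_sderiv [OF dx_sderiv [OF assms]]
  by (simp add: distrib_left distrib_right mult.assoc operator_commutes)
   (simp add: mult.assoc [symmetric])

lemma quad_solve_right:
  assumes "dx * A = A * dx"
  defines "H \<equiv> quad_solve A"
  shows "sderiv (sderiv H) * dx + (sderiv H * weights + sderiv H * weights) = A"
proof (rule const_coeff_eqI)
  have H: "dx * H = H * dx" by (simp add: H_def quad_solve_def dx_multiplier)
  show "dx * (sderiv (sderiv H) * dx + (sderiv H * weights + sderiv H * weights)) =
     (sderiv (sderiv H) * dx + (sderiv H * weights + sderiv H * weights)) * dx"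
    by (rule dx_quad [OF H])
  fix k i j
  have "complex_of_nat (Suc k * (k + 2 * wt i)) \<noteq> 0"
    using wt_pos [of i] by (simp only: of_nat_eq_0_iff) auto
  then show "symbol_coeff k i j (sderiv (sderiv H) * dx + (sderiv H * weights + sderiv H * weights)) =
    symbol_coeff k i j A"
    unfolding quad_coeff [OF H] by (simp add: H_def quad_solve_def symbol_coeff_operators del: of_nat_mult of_nat_add of_nat_Suc)
qed (fact assms)

text \<open>The map to be inverted annihilates the constant term of a symbol, so only the rest of
  the symbol is recovered.\<close>

lemma quad_solve_left:
  assumes "dx * A = A * dx"
  shows "quad_solve (sderiv (sderiv A) * dx + (sderiv A * weights + sderiv A * weights)) =
    multiplier (\<lambda>k i j. if k = 0 then 0 else 1) A"
proof (rule const_coeff_eqI)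
  fix k i j
  show "symbol_coeff k i j (quad_solve (sderiv (sderiv A) * dx + (sderiv A * weights + sderiv A * weights))) =
    symbol_coeff k i j (multiplier (\<lambda>k i j. if k = 0 then 0 else 1) A)"
  proof (cases k)
    case (Suc l)
    have "complex_of_nat (Suc l * (l + 2 * wt i)) \<noteq> 0"
      using wt_pos [of i] by (simp only: of_nat_eq_0_iff) auto
    then show ?thesis
      unfolding Suc quad_solve_def symbol_coeff_multiplier symbol_coeff_operators(4) quad_coeff [OF assms]
      by (simp del: of_nat_mult of_nat_add of_nat_Suc)
  qed (simp add: quad_solve_def)
qed (simp_all add: quad_solve_def dx_multiplier)

lemma mcoeff_symbol_deriv [simp]: "mcoeff (symbol_deriv T) a = sderiv (mcoeff T a)"
  by (simp add: symbol_deriv_def sderiv_def)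

abbreviation KK :: "endo_series \<Rightarrow> endo_series" where "KK \<equiv> lift quad_solve"

definition quad :: "endo_series \<Rightarrow> endo_series" where
  "quad T = symbol_deriv (symbol_deriv T) * DD + (symbol_deriv T * WW + symbol_deriv T * WW)"

lemma quad_KK: "const_coeff T \<Longrightarrow> quad (KK T) = T"
  by (rule mfps_eqI) (simp add: quad_def const_coeff_mcoeff quad_solve_right)

lemma KK_quad: "const_coeff T \<Longrightarrow> KK (quad T) = lift (multiplier (\<lambda>k i j. if k = 0 then 0 else 1)) T"
  by (rule mfps_eqI) (simp add: quad_def const_coeff_mcoeff quad_solve_left)

lemma const_coeff_KK: "const_coeff (KK T)"
  by (simp add: const_coeff_mcoeff quad_solve_def dx_multiplier)

lemma symbol_deriv_const: "symbol_deriv (mconst A) = mconst (sderiv A)"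
  by (simp add: symbol_deriv_def sderiv_def mconst_arith)

lemma symbol_deriv_arith:
  "symbol_deriv (S + T) = symbol_deriv S + symbol_deriv T" "symbol_deriv (S - T) = symbol_deriv S - symbol_deriv T"
  "symbol_deriv 1 = 0" "symbol_deriv WW = 0" "symbol_deriv 0 = 0" "symbol_deriv DD = 1"
  "symbol_deriv (S * T) = S * symbol_deriv T + symbol_deriv S * T" "symbol_deriv (- S) = - symbol_deriv S"
  by (simp_all add: symbol_deriv_def algebra_simps WW_commutes DD_XX)

lemma symbol_deriv_embed: "symbol_deriv (embed f * T) = embed f * symbol_deriv T"
  by (simp add: symbol_deriv_def right_diff_distrib mult.assoc embed_left_commute)

lemma vanish_symbol_deriv: "vanish n T \<Longrightarrow> vanish n (symbol_deriv T)"
  unfolding symbol_deriv_def by (intro vanish_arith vanish_mult_left vanish_mult_right)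

text \<open>Put c1 = W + w. Moving x to the left in G (x^2 \<partial> + 2 x c1 + c) leaves the term
  G'' \<partial> + 2 G' c1 + G c without a factor x; the equation removes it. Its part free of
  \<open>w\<close> and \<open>c\<close> is \<open>quad\<close>, inverted by \<open>KK\<close>, and
  the rest raises the order in the parameters.\<close>

lemma gauge_quadratic:
  assumes w: "const_coeff w" "vanish 1 w" and c: "const_coeff c" "vanish 1 c"
  obtains G where "hom_part 0 G = 1" "const_coeff G"
    "symbol_deriv (symbol_deriv G) * DD + (symbol_deriv G * (WW + w) + symbol_deriv G * (WW + w)) + G * c = 0"
proof -
  define \<Psi> where "\<Psi> G = symbol_deriv G * w + symbol_deriv G * w + G * c" for G
  note K = lift_arith [OF endo_linear_quad_solve]
  have \<Psi>: "\<Psi> (S - T) = \<Psi> S - \<Psi> T" for S T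
    by (simp add: \<Psi>_def symbol_deriv_arith algebra_simps)
  have van: "vanish (Suc m) (\<Psi> S)" if "vanish m S" for m S
    using vanish_mult [OF vanish_symbol_deriv [OF that] w(2)] vanish_mult [OF that c(2)]
    unfolding \<Psi>_def by (simp add: vanish_arith)
  obtain G where G: "1 - KK (\<Psi> G) = G"
  proof (rule contraction_fixpoint [of "\<lambda>G. 1 - KK (\<Psi> G)"])
    fix m and S S' :: endo_series assume "vanish m (S - S')"
    from vanish_arith(3) [OF vanish_lift [OF endo_linear_quad_solve van [OF this]]]
    show "vanish (Suc m) (1 - KK (\<Psi> S) - (1 - KK (\<Psi> S')))"
      by (simp add: \<Psi> K)
  qed
  have ker: "const_coeff G"
    by (subst G [symmetric]) (intro const_coeff_intros const_coeff_KK)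
  then have "const_coeff (\<Psi> G)"
    unfolding \<Psi>_def by (intro const_coeff_intros const_coeff_symbol_deriv w c)
  then have "quad (KK (\<Psi> G)) = \<Psi> G" by (rule quad_KK)
  moreover have "quad G = - quad (KK (\<Psi> G))"
    by (subst G [symmetric]) (simp add: quad_def symbol_deriv_arith algebra_simps)
  ultimately have "quad G + \<Psi> G = 0" by simp
  then have eq: "symbol_deriv (symbol_deriv G) * DD + (symbol_deriv G * (WW + w) + symbol_deriv G * (WW + w)) + G * c = 0"
    by (simp add: quad_def \<Psi>_def algebra_simps)
  have "vanish 1 (KK (\<Psi> G))"
    using vanish_lift [OF endo_linear_quad_solve van [of 0 G]] by (simp add: vanish_arith)
  then have "hom_part 0 G = 1"
    by (subst G [symmetric]) (simp add: vanish_def hom_part_one)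
  with ker eq that show ?thesis by blast
qed

text \<open>The relation involves \<open>w\<close> through its derivative only, so the constant term
  \<open>v\<close> of the symbol is free. Applying \<open>KK\<close> turns the relation into u +
  \<Psi> u for the remaining part \<open>u\<close>, and \<open>generated_by_contraction\<close> puts
  \<open>u\<close> into the ideal.\<close>

lemma quadratic_rigidity:
  assumes w: "const_coeff w" "vanish 1 w"
    and mem: "symbol_deriv (symbol_deriv w) * DD + (symbol_deriv w * (WW + w) + symbol_deriv w * (WW + w)) \<in> generated_by R"
  obtains v where "const_coeff v" "symbol_deriv v = 0" "vanish 1 v" "cong_base R w v"
proof -
  define u where "u = lift (multiplier (\<lambda>k i j. if k = 0 then 0 else 1)) w"
  define v where "v = lift (multiplier (\<lambda>k i j. if k = 0 then 1 else 0)) w"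
  have w_eq: "w = v + u"
  proof (rule mfps_eqI)
    fix a
    show "mcoeff w a = mcoeff (v + u) a"
      using w(1) by - (rule const_coeff_eqI, simp_all add: u_def v_def const_coeff_mcoeff dx_multiplier
        distrib_left distrib_right symbol_coeff_linear)
  qed
  have v0: "symbol_deriv v = 0"
  proof (rule mfps_eqI)
    fix a
    show "mcoeff (symbol_deriv v) a = mcoeff 0 a"
      by (rule const_coeff_eqI) (simp_all add: v_def dx_sderiv dx_multiplier symbol_coeff_sderiv
        symbol_coeff_linear)
  qed
  have vv: "vanish 1 v" unfolding v_def by (intro vanish_lift endo_linear_multiplier w)
  have vc: "const_coeff v" by (simp add: v_def const_coeff_lift_multiplier)
  have du: "symbol_deriv w = symbol_deriv u"
    using v0 by (subst w_eq) (simp add: symbol_deriv_arith)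
  note K = lift_arith [OF endo_linear_quad_solve]
  define \<Psi> where "\<Psi> S = KK (symbol_deriv S * w + symbol_deriv S * w)" for S
  have "quad w + (symbol_deriv u * w + symbol_deriv u * w) \<in> generated_by R"
    using mem du by (simp add: quad_def algebra_simps)
  from generated_by_lift [OF endo_linear_quad_solve this]
  have "u + \<Psi> u \<in> generated_by R"
    unfolding K KK_quad [OF w(1)] by (simp add: \<Psi>_def u_def K)
  then have "u \<in> generated_by R"
  proof (rule generated_by_contraction [rotated 3])
    show "\<Psi> (S + T) = \<Psi> S + \<Psi> T" for S T
      by (simp add: \<Psi>_def K(1) [symmetric] symbol_deriv_arith algebra_simps)
    show "\<Psi> (embed f * T) = embed f * \<Psi> T" for f T
      by (simp add: \<Psi>_def K(5) [symmetric] symbol_deriv_embed algebra_simps)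
    show "vanish (Suc m) (\<Psi> S)" if "vanish m S" for m S
      using vanish_mult [OF vanish_symbol_deriv [OF that] w(2)]
      unfolding \<Psi>_def by (intro vanish_lift endo_linear_quad_solve vanish_arith) simp_all
  qed
  then have "cong_base R w v" by (simp add: cong_base_def w_eq)
  with vc v0 vv that show ?thesis by blast
qed

section \<open>Diagonalisation of a matrix perturbation of the weights\<close>

definition diag_part :: "endo \<Rightarrow> endo" where
  "diag_part A = diag (\<lambda>i. symbol_coeff 0 i i A)"

lemma endo_linear_diag_part: "endo_linear diag_part"
  unfolding endo_linear_def diag_part_def
  by (auto intro!: endo_eq_nth simp: symbol_coeff_linear smult_add_left)

lemma symbol_coeff_diag: "symbol_coeff k i j (diag c) = (if k = 0 \<and> i = j then c i else 0)"
  by (auto simp: symbol_coeff_def basis_symbol_def)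

text \<open>The inverse of the commutator with the weights on off-diagonal matrices; it exists
  because the five weights are distinct.\<close>

definition off_diag_solve :: "endo \<Rightarrow> endo" where
  "off_diag_solve = multiplier (\<lambda>k i j. if k = 0 \<and> i \<noteq> j then 1 / (of_nat (wt j) - of_nat (wt i)) else 0)"

lemma wt_inj: "wt i = wt j \<longleftrightarrow> i = j"
  by (cases i; cases j) auto

lemma off_diag_solve_right:
  assumes "dx * A = A * dx" "sderiv A = 0"
  shows "weights * off_diag_solve A - off_diag_solve A * weights = A - diag_part A"
proof (rule const_coeff_eqI)
  have O: "dx * off_diag_solve A = off_diag_solve A * dx" by (simp add: off_diag_solve_def dx_multiplier)
  have "dx * (weights * off_diag_solve A) = weights * off_diag_solve A * dx"
    "dx * (off_diag_solve A * weights) = off_diag_solve A * weights * dx"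
    by (metis O mult.assoc operator_commutes(2))+
  then show "dx * (weights * off_diag_solve A - off_diag_solve A * weights) =
    (weights * off_diag_solve A - off_diag_solve A * weights) * dx"
    by (simp add: left_diff_distrib right_diff_distrib)
  show "dx * (A - diag_part A) = (A - diag_part A) * dx"
    by (simp add: assms left_diff_distrib right_diff_distrib diag_part_def operator_commutes)
  fix k i j
  have z: "symbol_coeff (Suc l) i j A = 0" for l
    using symbol_coeff_sderiv [of l i j A] assms(2)
    by (simp add: symbol_coeff_linear del: of_nat_Suc)
  have "complex_of_nat (wt j) - of_nat (wt i) \<noteq> 0" if "i \<noteq> j" using that wt_inj [of i j] by auto
  then show "symbol_coeff k i j (weights * off_diag_solve A - off_diag_solve A * weights) =
    symbol_coeff k i j (A - diag_part A)"
    by (cases k) (auto simp: symbol_coeff_linear symbol_coeff_operators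
        off_diag_solve_def diag_part_def symbol_coeff_diag z field_simps)
qed

definition is_diag :: "endo_series \<Rightarrow> bool" where
  "is_diag a \<longleftrightarrow> (\<exists>Y. a = lift diag_part Y)"

lemma is_diag_commutes:
  assumes "is_diag a"
  shows "const_coeff a" "symbol_deriv a = 0" "EE * a = a * EE"
proof -
  obtain Y where a: "a = lift diag_part Y" using assms by (auto simp: is_diag_def)
  show "const_coeff a" by (simp add: a const_coeff_mcoeff diag_part_def operator_commutes)
  show "symbol_deriv a = 0" by (rule mfps_eqI) (simp add: a diag_part_def sderiv_def operator_commutes)
  show "EE * a = a * EE" by (rule mfps_eqI) (simp add: a diag_part_def operator_commutes)
qed

lemma lift_diag_left:
  assumes "is_diag a" and l: "endo_linear \<phi>" and d: "\<And>c A. \<phi> (diag c * A) = diag c * \<phi> A"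
  shows "lift \<phi> (a * T) = a * (lift \<phi> T :: endo_series)"
proof -
  obtain Y where a: "a = lift diag_part Y" using assms by (auto simp: is_diag_def)
  show ?thesis
    by (rule mfps_eqI) (simp add: a mcoeff_mult endo_linearD(6) [OF l] diag_part_def d)
qed

lemma lift_diag_right:
  assumes "is_diag a" and l: "endo_linear \<phi>" and d: "\<And>c A. \<phi> (A * diag c) = \<phi> A * diag c"
  shows "lift \<phi> (T * a) = (lift \<phi> T :: endo_series) * a"
proof -
  obtain Y where a: "a = lift diag_part Y" using assms by (auto simp: is_diag_def)
  show ?thesis
    by (rule mfps_eqI) (simp add: a mcoeff_mult endo_linearD(6) [OF l] diag_part_def d)
qed

text \<open>Perturbation theory of a simple spectrum. The required identity is [W, P] = P v - a P;
  with P normalised to have diagonal part 1, the diagonal of this equation forces a to be the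
  diagonal part of P v, and the commutator with W can be inverted on the rest.\<close>

lemma diagonalise_constant:
  assumes v: "const_coeff v" "symbol_deriv v = 0" "vanish 1 v"
  obtains P a where "hom_part 0 P = 1" "const_coeff P" "symbol_deriv P = 0" "is_diag a" "vanish 1 a"
    "P * (WW + v) = (WW + a) * P"
proof -
  let ?D = "lift diag_part :: endo_series \<Rightarrow> endo_series"
  let ?O = "lift off_diag_solve :: endo_series \<Rightarrow> endo_series"
  have lO: "endo_linear off_diag_solve" by (simp add: off_diag_solve_def endo_linear_multiplier)
  note D = lift_arith [OF endo_linear_diag_part] and O = lift_arith [OF lO]
  \<comment> \<open>The eigenvalues are eliminated by inserting the diagonal part of P v for them,
    which makes the equation quadratic in P.\<close>
  define \<Phi> where "\<Phi> P = 1 + ?O (P * v - ?D (P * v) * P)" for P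
  obtain P where P: "\<Phi> P = P"
  proof (rule contraction_fixpoint)
    fix m and S T :: endo_series assume m: "vanish m (S - T)"
    have 1: "vanish (Suc m) ((S - T) * v)" using vanish_mult [OF m v(3)] by simp
    have 2: "vanish (Suc m) (?D ((S - T) * v) * S)"
      by (intro vanish_mult_right vanish_lift endo_linear_diag_part 1)
    have "vanish 1 (?D (T * v))" by (intro vanish_lift endo_linear_diag_part vanish_mult_left v)
    from vanish_mult [OF this m] have 3: "vanish (Suc m) (?D (T * v) * (S - T))" by simp
    have "\<Phi> S - \<Phi> T = ?O ((S - T) * v - ?D ((S - T) * v) * S - ?D (T * v) * (S - T))"
      by (simp add: \<Phi>_def O(3) [symmetric] D(3) algebra_simps)
    also have "vanish (Suc m) \<dots>"
      by (intro vanish_lift lO vanish_arith 1 2 3)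
    finally show "vanish (Suc m) (\<Phi> S - \<Phi> T)" .
  qed
  define a where "a = ?D (P * v)"
  define B where "B = P * v - a * P"
  have PB: "P = 1 + ?O B" using P by (simp add: \<Phi>_def B_def a_def)
  have diag: "is_diag a" by (auto simp: is_diag_def a_def)
  have va: "vanish 1 a" unfolding a_def by (intro vanish_lift endo_linear_diag_part vanish_mult_left v)
  have "vanish 1 B" unfolding B_def by (intro vanish_arith vanish_mult_left vanish_mult_right v va)
  then have "vanish 1 (?O B)" by (intro vanish_lift lO)
  then have P0: "hom_part 0 P = 1" by (subst PB) (simp add: vanish_def hom_part_one)
  have Oc: "const_coeff (?O B)" by (simp add: off_diag_solve_def const_coeff_lift_multiplier)
  have Pc: "const_coeff P" by (subst PB) (intro const_coeff_intros Oc)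
  have "symbol_deriv (?O B) = 0"
  proof (rule mfps_eqI)
    fix a
    show "mcoeff (symbol_deriv (?O B)) a = mcoeff 0 a"
      by (rule const_coeff_eqI) (simp_all add: off_diag_solve_def dx_sderiv dx_multiplier symbol_coeff_sderiv
        symbol_coeff_linear)
  qed
  then have Pd: "symbol_deriv P = 0" by (subst PB) (simp add: symbol_deriv_arith)
  have Bc: "const_coeff B" unfolding B_def
    by (intro const_coeff_intros Pc v is_diag_commutes diag)
  have Bd: "symbol_deriv B = 0"
    by (simp add: B_def symbol_deriv_arith Pd v is_diag_commutes [OF diag])
  have "?D (a * P) = a * ?D P"
  proof (rule lift_diag_left [OF diag endo_linear_diag_part])
    show "diag_part (diag c * A) = diag c * diag_part A" for c A
      by (rule endo_eq_nth) (simp add: diag_part_def symbol_coeff_operators)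
  qed
  also have "?D P = 1"
  proof (rule mfps_eqI)
    fix e :: "param \<Rightarrow> nat"
    have "diag_part (mcoeff 1 e) = mcoeff 1 e"
      by (auto intro!: endo_eq_nth simp: mcoeff_one diag_part_def symbol_coeff_def basis_symbol_def)
    moreover have "diag_part (off_diag_solve (mcoeff B e)) = 0"
      by (rule endo_eq_nth) (simp add: diag_part_def off_diag_solve_def)
    ultimately show "mcoeff (?D P) e = mcoeff 1 e"
      by (subst PB) (simp add: endo_linearD [OF endo_linear_diag_part])
  qed
  \<comment> \<open>P v has diagonal part \<open>a\<close>, and so has \<open>a * P\<close> because
    P has diagonal part 1. Hence \<open>B\<close> is off-diagonal and is recovered exactly by the
    commutator with W.\<close>
  finally have "?D B = 0" by (simp add: B_def D a_def)
  then have DB: "diag_part (mcoeff B e) = 0" for e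
    by (metis mcoeff_lift mcoeff_simps(1))
  have "WW * ?O B - ?O B * WW = B"
  proof (rule mfps_eqI)
    fix e :: "param \<Rightarrow> nat"
    have "sderiv (mcoeff B e) = 0" by (metis Bd mcoeff_symbol_deriv mcoeff_simps(1))
    then show "mcoeff (WW * ?O B - ?O B * WW) e = mcoeff B e"
      using off_diag_solve_right [of "mcoeff B e"] Bc DB [of e] by (simp add: const_coeff_mcoeff)
  qed
  then have "WW * P - P * WW = B" by (subst (1 2) PB) (simp add: algebra_simps)
  then have "P * (WW + v) = (WW + a) * P" by (simp add: B_def algebra_simps)
  with P0 Pc Pd diag va that show ?thesis by blast
qed

section \<open>Normal form of the action of sl(2)\<close>

text \<open>The conditions of a deformation that survive conjugation by a series with constant term
  1. The first order part changes by a coboundary and is followed separately.\<close>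

definition is_rep :: "scalar_series set \<Rightarrow> (real poly \<Rightarrow> endo_series) \<Rightarrow> bool" where
  "is_rep R U \<longleftrightarrow> is_ideal R \<and> (\<forall>X Y. U (X + Y) = U X + U Y) \<and>
     (\<forall>c X. U (smult c X) = mconst (scalar_endo (of_real c)) * U X) \<and>
     (\<forall>X. hom_part 0 (U X) = mconst (lie_symbols X)) \<and>
     (\<forall>X Y. cong_base R (U X * U Y - U Y * U X) (U (vect_bracket X Y)))"

lemma mconst_scalar_commute:
  "mconst (scalar_endo c) * T = T * (mconst (scalar_endo c) :: endo_series)"
  using embed_commute [of "mconst c" T] by (simp only: embed_hom(5))

lemma is_rep_conj:
  assumes "is_rep R U" "P * Q = 1" "Q * P = 1" "hom_part 0 P = 1"
  shows "is_rep R (\<lambda>X. P * U X * Q)"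
proof -
  have U: "is_ideal R" "\<And>X Y. U (X + Y) = U X + U Y"
     "\<And>c X. U (smult c X) = mconst (scalar_endo (of_real c)) * U X"
     "\<And>X. hom_part 0 (U X) = mconst (lie_symbols X)"
     "\<And>X Y. cong_base R (U X * U Y - U Y * U X) (U (vect_bracket X Y))"
    using assms(1) by (auto simp: is_rep_def)
  have "hom_part 0 Q * hom_part 0 P = hom_part 0 1"
    by (simp only: hom_part_zero_mult [symmetric] assms(3))
  then have Q0: "hom_part 0 Q = 1" by (simp add: hom_part_one assms(4))
  have QP: "Q * (P * T) = T" for T by (simp add: mult.assoc [symmetric] assms)
  have "cong_base R (P * U X * Q * (P * U Y * Q) - P * U Y * Q * (P * U X * Q)) (P * U (vect_bracket X Y) * Q)"
    for X Y
    using cong_base_mult [OF cong_base_mult [OF cong_base_refl [of R P] U(5) [of X Y]] cong_base_refl [of R Q]]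
    by (simp add: algebra_simps QP)
  moreover have "P * (mconst (scalar_endo c) * S) * Q = mconst (scalar_endo c) * (P * S * Q)" for S c
    by (metis mconst_scalar_commute mult.assoc)
  ultimately show ?thesis
    using U by (simp add: is_rep_def distrib_left distrib_right hom_part_zero_mult Q0 assms(4))
qed

definition xpow :: "nat \<Rightarrow> real poly" where "xpow n = monom 1 n"

lemma Dx_xpow: "Dx 0 (xpow n) = monom 1 n" "Dx 1 (xpow n) = monom (of_nat n) (n - 1)"
  by (simp_all add: Dx_def xpow_def pderiv_monom map_poly_monom)

lemma lie_symbols_xpow:
  "lie_symbols (xpow 0) = dx" "lie_symbols (xpow 1) = x_endo * dx + weights"
  using lie_symbols_eq [of "xpow 0"] lie_symbols_eq [of "xpow 1"] unfolding Dx_xpow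
  by (simp_all add: mult_by_hom monom_0 monom_Suc flip: one_pCons)

lemma vect_bracket_xpow:
  "vect_bracket (xpow 0) (xpow (Suc n)) = smult (of_nat (Suc n)) (xpow n)"
  "vect_bracket (xpow 1) (xpow n) = smult (of_nat n - 1) (xpow n)"
  "vect_bracket (xpow 2) (xpow n) = smult (of_nat n - 2) (xpow (Suc n))"
proof -
  show "vect_bracket (xpow 0) (xpow (Suc n)) = smult (of_nat (Suc n)) (xpow n)"
    by (simp add: vect_bracket_def xpow_def pderiv_monom smult_monom mult_monom)
  show "vect_bracket (xpow 1) (xpow n) = smult (of_nat n - 1) (xpow n)"
    by (cases n) (simp_all add: vect_bracket_def xpow_def pderiv_monom smult_monom mult_monom diff_monom minus_monom one_pCons monom_0)
  show "vect_bracket (xpow 2) (xpow n) = smult (of_nat n - 2) (xpow (Suc n))"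
    by (cases n) (simp_all add: vect_bracket_def xpow_def pderiv_monom smult_monom mult_monom diff_monom minus_monom one_pCons monom_0)
qed

lemma mconst_scalar_of_nat: "mconst (scalar_endo (of_nat n)) = (of_nat n :: endo_series)"
  using embed_hom(3) [of "of_nat _" 1] 
  by (induction n) (simp_all add: scalar_endo_hom mconst_arith)

lemma is_rep_bracket:
  assumes "is_rep R U" "vect_bracket X Y = smult (of_nat n) Z"
  shows "cong_base R (U X * U Y - U Y * U X) (of_nat n * U Z)"
proof -
  have "U (smult (of_nat n) Z) = of_nat n * U Z"
    using assms(1) unfolding is_rep_def by (metis mconst_scalar_of_nat of_real_of_nat_eq)
  then show ?thesis using assms unfolding is_rep_def by metis
qed

text \<open>The bracket with 1 prescribes the commutator of \<partial> with the action of x^(n+1).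
  Two solutions differ, modulo the relations, by a constant coefficient operator, so after one
  solution \<open>N\<close> is known only the values at x = 0 remain to be compared.\<close>

lemma is_rep_step:
  assumes U: "is_rep R U" "cong_base R (U (xpow 0)) DD"
    and N: "cong_base R (DD * N - N * DD) (of_nat (Suc n) * U (xpow n))"
    and c: "cong_base R (const_part (U (xpow (Suc n)))) (const_part N + c)"
  shows "cong_base R (U (xpow (Suc n))) (N + c)"
proof -
  let ?V = "U (xpow (Suc n))"
  have "cong_base R (DD * ?V - ?V * DD) (U (xpow 0) * ?V - ?V * U (xpow 0))"
    by (intro cong_base_diff cong_base_mult cong_base_refl cong_base_sym [OF U(2)])
  also have "cong_base R \<dots> (of_nat (Suc n) * U (xpow n))"
    by (rule is_rep_bracket [OF U(1)]) (rule vect_bracket_xpow)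
  also have "cong_base R \<dots> (DD * N - N * DD)" by (rule cong_base_sym [OF N])
  finally have "cong_base R (DD * (?V - N)) ((?V - N) * DD)"
    by (simp add: cong_base_def algebra_simps)
  from cong_const_part [OF this] have "cong_base R (?V - N) (const_part ?V - const_part N)"
    by (simp add: const_part_arith)
  also have "cong_base R \<dots> (const_part N + c - const_part N)"
    by (intro cong_base_diff c cong_base_refl)
  finally have "cong_base R (?V - N + N) (const_part N + c - const_part N + N)"
    by (rule cong_base_add [OF _ cong_base_refl])
  then show ?thesis by (simp add: algebra_simps)
qed

lemma hom_part_const_part: "hom_part m (const_part T) = const_part (hom_part m T)"
proof -
  have "hom_part m (DD * T - T * DD) = DD * hom_part m T - hom_part m T * DD"
    by (rule mfps_eqI) simp
  then show ?thesis
    by (simp add: const_part_def lift_arith(6) [OF endo_linear_antideriv, symmetric])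
qed

lemma hom_part_symbol_deriv: "hom_part m (symbol_deriv T) = symbol_deriv (hom_part m T)"
  by (rule mfps_eqI) (simp add: sderiv_def)

lemma const_part_XX [simp]: "const_part (XX * T) = 0"
  by (rule const_part_eqI) (simp_all add: const_coeff_intros EE_XX)

lemma DD_rules:
  "const_coeff T \<Longrightarrow> DD * T = T * DD" "const_coeff T \<Longrightarrow> DD * (T * S) = T * (DD * S)"
  "DD * (XX * S) = XX * (DD * S) + S"
  by (simp_all add: const_coeff_def DD_XX distrib_right mult.assoc [symmetric])

lemma sl2_normal_form:
  assumes \<rho>: "is_rep R \<rho>"
  obtains P Q a where "hom_part 0 P = 1" "P * Q = 1" "Q * P = 1" "is_diag a" "vanish 1 a"
    "cong_base R (P * \<rho> (xpow 0) * Q) DD"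
    "cong_base R (P * \<rho> (xpow 1) * Q) (XX * DD + (WW + a))"
    "cong_base R (P * \<rho> (xpow 2) * Q) (XX * (XX * DD) + (XX * (WW + a) + XX * (WW + a)))"
proof -
  have hom0: "hom_part 0 (U X) = mconst (lie_symbols X)" if "is_rep R U" for U X
    using that by (simp add: is_rep_def)
  obtain P where P: "hom_part 0 P = 1" "P * \<rho> (xpow 0) = DD * P"
    by (rule gauge_derivation [of "\<rho> (xpow 0)"]) (simp_all add: hom0 [OF \<rho>] lie_symbols_xpow(1))
  obtain Pi where Pi: "P * Pi = 1" "Pi * P = 1" using invertible_series [OF P(1)] .
  define U where "U X = P * \<rho> X * Pi" for X
  have U: "is_rep R U" unfolding U_def by (rule is_rep_conj [OF \<rho> Pi P(1)])
  have U0: "U (xpow 0) = DD" by (simp add: U_def P(2) mult.assoc Pi)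
  define c1 where "c1 = const_part (U (xpow 1))"
  define c2 where "c2 = const_part (U (xpow 2))"
  have cc: "const_coeff c1" "const_coeff c2" by (simp_all add: c1_def c2_def const_coeff_const_part)
  have U1: "cong_base R (U (xpow 1)) (XX * DD + c1)"
    unfolding One_nat_def
    by (rule is_rep_step [OF U]) (simp_all add: U0 cong_base_refl c1_def DD_rules algebra_simps)
  have "cong_base R (U (xpow 1) + U (xpow 1)) (XX * DD + c1 + (XX * DD + c1))"
    by (intro cong_base_add U1)
  moreover define N where "N = XX * (XX * DD) + (XX * c1 + XX * c1)"
  moreover have "DD * N - N * DD = XX * DD + c1 + (XX * DD + c1)"
    by (simp add: N_def DD_rules cc algebra_simps)
  ultimately have step: "cong_base R (DD * N - N * DD) (of_nat (Suc 1) * U (xpow 1))"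
    by (simp add: mult_2 cong_base_sym)
  have "cong_base R (U (xpow (Suc 1))) (N + c2)"
    by (rule is_rep_step [OF U _ step]) (simp_all add: U0 cong_base_refl c2_def N_def const_part_arith numeral_2_eq_2)
  then have U2: "cong_base R (U (xpow 2)) (XX * (XX * DD) + (XX * c1 + XX * c1) + c2)"
    by (simp add: N_def numeral_2_eq_2)
  have c10: "hom_part 0 c1 = WW"
    unfolding c1_def hom_part_const_part hom0 [OF U] lie_symbols_xpow
    by (simp add: mconst_arith const_part_arith const_part_id const_coeff_intros)
  have w1: "vanish 1 (c1 - WW)" by (simp add: vanish_def c10 hom_part_mconst)
  have "lie_symbols (xpow 2) = x_endo * (x_endo * dx) + (x_endo * weights + x_endo * weights)"
    using lie_symbols_eq [of "xpow 2"] unfolding Dx_xpow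
    by (intro endo_eq_nth) (simp add: monom_Suc monom_0 numeral_2_eq_2 algebra_simps,
       simp add: numeral_poly mult.commute)
  then have "hom_part 0 c2 = 0"
    unfolding c2_def hom_part_const_part hom0 [OF U]
    by (simp add: mconst_arith const_part_arith)
  then have v2: "vanish 1 c2" by (simp add: vanish_def)
  obtain G where G: "hom_part 0 G = 1" "const_coeff G"
    "symbol_deriv (symbol_deriv G) * DD + (symbol_deriv G * (WW + (c1 - WW)) + symbol_deriv G * (WW + (c1 - WW))) + G * c2 = 0"
    by (rule gauge_quadratic [OF _ w1 cc(2) v2]) (intro const_coeff_intros cc)
  obtain H where H: "G * H = 1" "H * G = 1" using invertible_series [OF G(1)] .
  have Hc: "const_coeff H" by (rule const_coeff_inverse [OF G(2) H])
  define V where "V X = G * U X * H" for X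
  have V: "is_rep R V" unfolding V_def by (rule is_rep_conj [OF U H G(1)])
  \<comment> \<open>G commutes with \<partial>, and G x = x G + G'. So G (x \<partial> + c1) H = x
    \<partial> + (G' \<partial> + G c1) H, and \<open>A\<close> is the new constant term.\<close>
  define A where "A = (symbol_deriv G * DD + G * c1) * H"
  note G' = const_coeff_symbol_deriv [OF G(2)]
  have Ac: "const_coeff A" unfolding A_def by (intro const_coeff_intros G' G Hc cc)
  have GH: "G * (H * T) = T" for T by (simp add: mult.assoc [symmetric] H)
  have GDH: "G * (DD * H) = DD" "G * (DD * (H * T)) = DD * T" for T
    by (simp_all add: DD_rules(1,2) [OF Hc] GH)
  have V0: "V (xpow 0) = DD" by (simp add: V_def U0 mult.assoc GDH)
  have conj: "cong_base R (G * S * H) (G * T * H)" if "cong_base R S T" for S T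
    by (intro cong_base_mult that cong_base_refl)
  note GX = const_coeff_mult_XX [of G] const_coeff_mult_XX [of "symbol_deriv G"]
  have "G * (XX * DD + c1) * H = XX * DD + A"
    by (simp add: A_def algebra_simps GX GDH)
  with conj [OF U1] have V1: "cong_base R (V (xpow 1)) (XX * DD + A)" by (simp add: V_def)
  \<comment> \<open>The terms with one factor x combine to 2 x A for the same \<open>A\<close>;
    those without a factor x are the expression that G was chosen to annihilate.\<close>
  have "G * (XX * (XX * DD) + (XX * c1 + XX * c1) + c2) * H = XX * (XX * DD) + (XX * A + XX * A) +
     (symbol_deriv (symbol_deriv G) * DD + (symbol_deriv G * (WW + (c1 - WW)) + symbol_deriv G * (WW + (c1 - WW))) + G * c2) * H"
    by (simp add: A_def algebra_simps GX GDH)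
  with conj [OF U2] have V2: "cong_base R (V (xpow 2)) (XX * (XX * DD) + (XX * A + XX * A))"
    unfolding G(3) by (simp add: V_def)
  define w where "w = A - WW"
  have H0: "hom_part 0 H = 1"
    using arg_cong [OF H(1), of "hom_part 0"] by (simp add: hom_part_zero_mult G hom_part_one)
  have wc: "const_coeff w" unfolding w_def by (intro const_coeff_intros Ac)
  have wv: "vanish 1 w"
    by (simp add: vanish_def w_def A_def hom_part_zero_mult G H0 hom_part_symbol_deriv symbol_deriv_arith
        c10 hom_part_mconst)
  have AE: "A = WW + w" by (simp add: w_def)
  define E F where "E = XX * DD + A" and "F = XX * (XX * DD) + (XX * A + XX * A)"
  have "cong_base R (E * F - F * E) (V (xpow 1) * V (xpow 2) - V (xpow 2) * V (xpow 1))"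
    unfolding E_def F_def
    by (intro cong_base_diff cong_base_mult cong_base_sym [OF V1] cong_base_sym [OF V2])
  also have "cong_base R \<dots> (of_nat 1 * V (xpow 2))"
    by (rule is_rep_bracket [OF V]) (simp only: vect_bracket_xpow, simp)
  also have "cong_base R \<dots> F" using V2 by (simp add: F_def)
  finally have "E * F - F * E - F \<in> generated_by R" by (simp add: cong_base_def)
  \<comment> \<open>In [x \<partial> + A, x^2 \<partial> + 2 x A] all terms beyond F that retain a
    left factor x cancel; what remains is the expression treated by
    \<open>quadratic_rigidity\<close>.\<close>
  also have "E * F - F * E - F = symbol_deriv (symbol_deriv A) * DD + (symbol_deriv A * A + symbol_deriv A * A)"
    unfolding E_def F_def
    by (simp add: algebra_simps const_coeff_mult_XX [of A] const_coeff_mult_XX [of "symbol_deriv A"]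
       DD_rules Ac const_coeff_symbol_deriv DD_XX)
  also have "symbol_deriv A = symbol_deriv w" by (simp add: AE symbol_deriv_arith)
  finally have "symbol_deriv (symbol_deriv w) * DD + (symbol_deriv w * (WW + w) + symbol_deriv w * (WW + w)) \<in> generated_by R"
    by (simp add: AE)
  from quadratic_rigidity [OF wc wv this] obtain v where
    v: "const_coeff v" "symbol_deriv v = 0" "vanish 1 v" "cong_base R w v" .
  obtain K a where K: "hom_part 0 K = 1" "const_coeff K" "symbol_deriv K = 0" "is_diag a" "vanish 1 a"
    "K * (WW + v) = (WW + a) * K"
    using diagonalise_constant [OF v(1-3)] .
  obtain L where L: "K * L = 1" "L * K = 1" using invertible_series [OF K(1)] .
  have Lc: "const_coeff L" by (rule const_coeff_inverse [OF K(2) L])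
  have KL: "K * (L * T) = T" for T by (simp add: mult.assoc [symmetric] L)
  have KDL: "K * (DD * L) = DD" "K * (DD * (L * T)) = DD * T" for T
    by (simp_all add: DD_rules(1,2) [OF Lc] KL)
  \<comment> \<open>K has a constant symbol and commutes with x as well as with \<partial>, so this
    conjugation touches only the matrix W + v.\<close>
  have KX: "K * XX = XX * K" "K * (XX * T) = XX * (K * T)" for T
    using const_coeff_mult_XX [of K] by (simp_all add: K)
  have KX: "K * (XX * T) * L = XX * (K * T * L)" for T by (simp add: mult.assoc KX)
  have KS: "K * (S + T) * L = K * S * L + K * T * L" for S T by (simp add: distrib_left distrib_right)
  have KA: "K * (WW + v) * L = WW + a" unfolding K(6) by (simp add: mult.assoc L)
  have KD: "K * DD * L = DD" by (simp add: mult.assoc KDL)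
  define B where "B = WW + v"
  have AV: "cong_base R A (WW + v)" unfolding AE by (intro cong_base_add cong_base_refl v)
  have conj': "cong_base R (K * S * L) (K * T * L)" if "cong_base R S T" for S T
    by (intro cong_base_mult that cong_base_refl)
  have "cong_base R (V (xpow 1)) (XX * DD + (WW + v))"
    by (rule cong_base_trans [OF V1]) (intro cong_base_add cong_base_refl AV)
  from conj' [OF this] have 1: "cong_base R (K * V (xpow 1) * L) (XX * DD + (WW + a))"
    unfolding KA [folded B_def] B_def [symmetric] KS KX KD .
  have "cong_base R (V (xpow 2)) (XX * (XX * DD) + (XX * (WW + v) + XX * (WW + v)))"
    by (rule cong_base_trans [OF V2]) (intro cong_base_add cong_base_mult cong_base_refl AV)
  from conj' [OF this] have 2: "cong_base R (K * V (xpow 2) * L) (XX * (XX * DD) + (XX * (WW + a) + XX * (WW + a)))"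
    unfolding KA [folded B_def] B_def [symmetric] KS KX KD .
  have 0: "K * V (xpow 0) * L = DD" unfolding V0 mult.assoc KDL ..
  define P' where "P' = K * (G * P)"
  define Q' where "Q' = Pi * (H * L)"
  have e: "P' * \<rho> X * Q' = K * V X * L" for X
    by (simp add: P'_def Q'_def V_def U_def mult.assoc)
  have PPi: "P * (Pi * T) = T" "Pi * (P * T) = T" for T by (simp_all add: mult.assoc [symmetric] Pi)
  have HG: "H * (G * T) = T" for T by (simp add: mult.assoc [symmetric] H)
  have LK: "L * (K * T) = T" for T by (simp add: mult.assoc [symmetric] L)
  show ?thesis
  proof (rule that)
    show "hom_part 0 P' = 1" by (simp add: P'_def hom_part_zero_mult K G P)
    show "P' * Q' = 1" by (simp add: P'_def Q'_def mult.assoc PPi GH L)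
    show "Q' * P' = 1" by (simp add: P'_def Q'_def mult.assoc LK HG Pi)
    show "is_diag a" "vanish 1 a" by (fact K)+
    show "cong_base R (P' * \<rho> (xpow 0) * Q') DD" unfolding e 0 by (rule cong_base_refl)
  qed (unfold e, fact 1, fact 2)
qed

section \<open>Determination by the action of the third power of x\<close>

text \<open>\<open>degree_solve n\<close> inverts \<open>f \<mapsto> \<Lambda> f - f \<Lambda> - f' \<partial> - (n - 1) f\<close> on the symbols whose degree differs from \<open>n - 1\<close>.\<close>

definition degree_solve :: "nat \<Rightarrow> endo \<Rightarrow> endo" where
  "degree_solve n = multiplier (\<lambda>k i j. if wt j + 1 = wt i + k + n then 0 
     else 1 / (of_nat (wt j) + 1 - of_nat (wt i) - of_nat k - of_nat n))"

definition degree_part :: "nat \<Rightarrow> endo \<Rightarrow> endo" where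
  "degree_part n = multiplier (\<lambda>k i j. if wt j + 1 = wt i + k + n then 1 else 0)"

lemma degree_solve_left:
  assumes f: "dx * f = f * dx"
  shows "degree_solve n (weights * f - f * weights - sderiv f * dx - (scalar_endo (of_nat n - 1) * f)) =
    f - degree_part n f"
proof (rule const_coeff_eqI)
  show "dx * (f - degree_part n f) = (f - degree_part n f) * dx"
    by (simp add: degree_part_def left_diff_distrib right_diff_distrib dx_multiplier f)
  fix k i j
  have d: "of_nat (wt j) + 1 - of_nat (wt i) - of_nat k - of_nat n \<noteq> (0 :: complex)"
    if "wt j + 1 \<noteq> wt i + k + n"
  proof
    assume "of_nat (wt j) + 1 - of_nat (wt i) - of_nat k - of_nat n = (0 :: complex)"
    then have "of_nat (wt j + 1) = (of_nat (wt i + k + n) :: complex)" by (simp add: algebra_simps)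
    with that show False by (simp only: of_nat_eq_iff)
  qed
  have s: "symbol_coeff k i j (sderiv f * dx) = of_nat k * symbol_coeff k i j f"
    by (cases k) (simp_all add: symbol_coeff_operators symbol_coeff_sderiv)
  have "symbol_coeff k i j (weights * f - f * weights - sderiv f * dx - (scalar_endo (of_nat n - 1) * f)) =
    (of_nat (wt j) + 1 - of_nat (wt i) - of_nat k - of_nat n) * symbol_coeff k i j f"
    by (simp add: symbol_coeff_linear symbol_coeff_operators s algebra_simps)
  with d show "symbol_coeff k i j (degree_solve n (weights * f - f * weights - sderiv f * dx - (scalar_endo (of_nat n - 1) * f))) =
    symbol_coeff k i j (f - degree_part n f)"
    by (simp add: degree_solve_def degree_part_def symbol_coeff_linear)
qed (simp add: degree_solve_def dx_multiplier)

lemma multiplier_diag: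
  "multiplier m (diag c * A) = diag c * multiplier m A" "multiplier m (A * diag c) = multiplier m A * diag c"
proof -
  have "dx * (diag c * multiplier m A) = diag c * multiplier m A * dx"
    "dx * (multiplier m A * diag c) = multiplier m A * diag c * dx"
    by (metis dx_multiplier mult.assoc operator_commutes(2))+
  then show "multiplier m (diag c * A) = diag c * multiplier m A" "multiplier m (A * diag c) = multiplier m A * diag c"
    by (auto intro!: const_coeff_eqI [of "multiplier m _"] simp: dx_multiplier symbol_coeff_operators)
qed

text \<open>At x = 0 the bracket with the action of x says that f is, up to the perturbation [a, f],
  in the kernel of an operator acting on the coefficient of \<partial>^k from weight i to weight j
  by the integer wt j - wt i - k - (n - 1). Where this is nonzero it can be inverted, and the
  perturbation has positive order.\<close>

lemma degree_homogeneous: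
  assumes U: "is_rep R U" and a: "is_diag a" "vanish 1 a"
    and U1: "cong_base R (U (xpow 1)) (XX * DD + (WW + a))"
  shows "cong_base R (const_part (U (xpow n))) (lift (degree_part n) (const_part (U (xpow n))))"
proof -
  let ?V = "U (xpow n)"
  define f where "f = const_part ?V"
  have fc: "const_coeff f" by (simp add: f_def const_coeff_const_part)
  let ?M = "lift (degree_part n) :: endo_series \<Rightarrow> endo_series"
  let ?S = "lift (degree_solve n) :: endo_series \<Rightarrow> endo_series"
  have lM: "endo_linear (degree_part n)" and lS: "endo_linear (degree_solve n)"
    by (simp_all add: degree_part_def degree_solve_def endo_linear_multiplier)
  note ac = is_diag_commutes [OF a(1)]
  define z :: endo_series where "z = mconst (scalar_endo (of_nat n - 1))"
  have zc: "const_coeff (z * T)" if "const_coeff T" for T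
    using const_coeff_embed [OF that, of "mconst (of_nat n - 1)"] by (simp add: z_def embed_hom)
  have "EE * z = z * EE" unfolding z_def by (rule mconst_scalar_commute [symmetric])
  then have zE: "EE * (z * T) = z * (EE * T)" for T by (simp add: mult.assoc [symmetric])
  define E where "E = XX * DD + (WW + a)"
  have "U (vect_bracket (xpow 1) (xpow n)) = z * ?V"
    using U unfolding is_rep_def vect_bracket_xpow z_def by simp
  moreover have "cong_base R (E * ?V - ?V * E) (U (xpow 1) * ?V - ?V * U (xpow 1))"
    unfolding E_def by (intro cong_base_diff cong_base_mult cong_base_refl cong_base_sym [OF U1])
  moreover have "cong_base R (U (xpow 1) * ?V - ?V * U (xpow 1)) (U (vect_bracket (xpow 1) (xpow n)))"
    using U by (simp add: is_rep_def)
  ultimately have "cong_base R (E * ?V - ?V * E) (z * ?V)" using cong_base_trans by simp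
  then have "E * ?V - ?V * E - z * ?V \<in> generated_by R" by (simp add: cong_base_def)
  then have g: "const_part (E * ?V - ?V * E - z * ?V) \<in> generated_by R" by (rule const_part_generated_by)
  define r where "r S = a * S - S * a" for S
  have "const_part (E * ?V - ?V * E - z * ?V) = WW * f - f * WW - symbol_deriv f * DD - z * f + r f"
  proof (rule const_part_eqI)
    show "const_coeff (WW * f - f * WW - symbol_deriv f * DD - z * f + r f)"
      unfolding r_def by (intro const_coeff_intros const_coeff_symbol_deriv zc fc ac)
    have EV': "EE * ?V = EE * f" by (simp add: f_def ev0_const_part)
    have EV: "EE * (?V * S) = EE * (f * S)" for S by (simp add: EV' mult.assoc [symmetric])
    have Ea: "EE * (a * T) = a * (EE * T)" for T by (simp add: ac(3) mult.assoc [symmetric])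
    have Ew: "EE * (WW * T) = WW * (EE * T)" for T by (simp add: WW_commutes(3) mult.assoc [symmetric])
    show "EE * (WW * f - f * WW - symbol_deriv f * DD - z * f + r f) = EE * (E * ?V - ?V * E - z * ?V)"
      by (simp add: E_def r_def algebra_simps zE Ea Ew EV EV' EE_XX const_coeff_mult_XX [of f])
  qed
  with g have "WW * f - f * WW - symbol_deriv f * DD - z * f + r f \<in> generated_by R" by simp
  from generated_by_lift [OF lS this]
  have "?S (WW * f - f * WW - symbol_deriv f * DD - z * f) + ?S (r f) \<in> generated_by R"
    by (simp only: lift_arith [OF lS])
  also have "?S (WW * f - f * WW - symbol_deriv f * DD - z * f) = f - ?M f"
    by (rule mfps_eqI) (use fc in \<open>simp add: z_def const_coeff_mcoeff degree_solve_left\<close>)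
  \<comment> \<open>The commutator with the diagonal \<open>a\<close> preserves the homogeneous
    part, which \<open>degree_solve\<close> annihilates. This makes the equation one for f - ?M f
    alone.\<close>
  also have "?S (r f) = ?S (r (f - ?M f))"
  proof -
    have "?S (r (?M f)) = a * ?S (?M f) - ?S (?M f) * a"
      unfolding r_def lift_arith(3) [OF lS]
      by (subst lift_diag_left [OF a(1) lS], simp add: degree_solve_def multiplier_diag,
          subst lift_diag_right [OF a(1) lS], simp_all add: degree_solve_def multiplier_diag)
    moreover have "?S (?M f) = 0"
    proof (rule mfps_eqI)
      fix b
      show "mcoeff (?S (?M f)) b = mcoeff 0 b"
        by (rule const_coeff_eqI) (simp_all add: degree_solve_def degree_part_def dx_multiplier
          symbol_coeff_linear)
    qed
    moreover have "r (f - ?M f) = r f - r (?M f)" by (simp add: r_def algebra_simps)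
    ultimately show ?thesis by (simp add: lift_arith [OF lS])
  qed
  finally have "(f - ?M f) + ?S (r (f - ?M f)) \<in> generated_by R" .
  then have "f - ?M f \<in> generated_by R"
  proof (rule generated_by_contraction [rotated 3])
    show "?S (r (S + T)) = ?S (r S) + ?S (r T)" for S T
      by (simp add: r_def lift_arith(1) [OF lS, symmetric] algebra_simps)
    show "?S (r (embed h * T)) = embed h * ?S (r T)" for h T
      by (simp add: r_def lift_arith(5) [OF lS, symmetric] right_diff_distrib mult.assoc embed_left_commute)
    show "vanish (Suc m) (?S (r T))" if "vanish m T" for m T
      unfolding r_def using vanish_mult [OF that a(2)] vanish_mult [OF a(2) that]
      by (intro vanish_lift lS vanish_arith) simp_all
  qed
  then show ?thesis by (simp add: cong_base_def f_def)
qed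

section \<open>The model action determined by A and y\<close>

definition field_mult :: "real poly \<Rightarrow> endo_series" where
  "field_mult X = mconst (mult_by (map_poly of_real X))"

lemma map_poly_of_real_arith:
  "map_poly complex_of_real (p + q) = map_poly of_real p + map_poly of_real q"
  "map_poly complex_of_real (smult c p) = smult (of_real c) (map_poly of_real p)"
  "map_poly complex_of_real (pderiv p) = pderiv (map_poly of_real p)"
  by (rule poly_eqI; simp add: coeff_map_poly coeff_pderiv)+

lemma field_mult_arith:
  "field_mult (X + Y) = field_mult X + field_mult Y"
  "field_mult (smult c X) = mconst (scalar_endo (of_real c)) * field_mult X"
  "field_mult 0 = 0"
  by (simp_all add: field_mult_def map_poly_of_real_arith mult_by_hom mconst_arith)

lemma DD_field_mult: 
  "DD * field_mult X = field_mult X * DD + field_mult (pderiv X)"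
  "DD * (field_mult X * T) = field_mult X * (DD * T) + field_mult (pderiv X) * T"
  by (simp_all add: field_mult_def mult.assoc [symmetric] distrib_right [symmetric] map_poly_of_real_arith)
    (simp_all add: mconst_arith(1,4) [symmetric] dx_mult_by)

lemma EE_field_mult: 
  "EE * field_mult X = mconst (scalar_endo (of_real (coeff X 0))) * EE"
  "EE * (field_mult X * T) = mconst (scalar_endo (of_real (coeff X 0))) * (EE * T)"
  by (simp_all add: field_mult_def mult.assoc [symmetric])
    (simp_all add: mconst_arith(4) [symmetric] ev0_mult_by coeff_map_poly)

text \<open>In a representation in which \<open>x\<close> acts as \<open>x \<partial> + A\<close> and \<open>x\<^sup>2\<close> as \<open>x\<^sup>2 \<partial> + 2 x A\<close>, the value at
  \<open>x = 0\<close> of \<open>[x\<^sup>2, x\<^sup>n]\<close> is \<open>next_symbol A f\<close> if that of \<open>x\<^sup>n\<close> is \<open>f\<close>. The operator \<open>A\<close> and the value \<open>y\<close>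
  of \<open>x\<^sup>3\<close> determine everything.\<close>

definition next_symbol :: "endo_series \<Rightarrow> endo_series \<Rightarrow> endo_series" where
  "next_symbol A f = - (symbol_deriv (symbol_deriv f) * DD + (symbol_deriv f * A + symbol_deriv f * A))"

text \<open>A Taylor expansion of X, with values at x = 0 as coefficients: 1/6 = 1/3! goes with the
  value \<open>y\<close> at x^3. As [x^2, x^3] = x^4, the next coefficient is 1/4!; as [x^2, x^4] =
  2 x^5, the last one is 1/(2 5!) = 1/240. There is no X'' term, because the action of x^2 has value
  0 at x = 0.\<close>

definition normal_rep :: "endo_series \<Rightarrow> endo_series \<Rightarrow> real poly \<Rightarrow> endo_series" where
  "normal_rep A y X = field_mult X * DD + field_mult (pderiv X) * A +
     field_mult (smult (1/6) ((pderiv ^^ 3) X)) * y +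
     field_mult (smult (1/24) ((pderiv ^^ 4) X)) * next_symbol A y +
     field_mult (smult (1/240) ((pderiv ^^ 5) X)) * next_symbol A (next_symbol A y)"

lemma const_coeff_next_symbol: "const_coeff A \<Longrightarrow> const_coeff f \<Longrightarrow> const_coeff (next_symbol A f)"
  unfolding next_symbol_def by (intro const_coeff_intros const_coeff_symbol_deriv)

lemma pderiv_funpow_arith:
  "(pderiv ^^ n) (p + q) = (pderiv ^^ n) p + (pderiv ^^ n) q" 
  "(pderiv ^^ n) (smult c p) = smult c ((pderiv ^^ n) p)"
  by (induction n arbitrary: p q) (simp_all add: pderiv_add pderiv_smult)

lemma normal_rep_arith:
  "normal_rep A y (X + Y) = normal_rep A y X + normal_rep A y Y"
  "normal_rep A y (smult c X) = mconst (scalar_endo (of_real c)) * normal_rep A y X"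
  by (simp_all add: normal_rep_def pderiv_funpow_arith field_mult_arith pderiv_add pderiv_smult
     smult_add_right algebra_simps)
    (simp add: mult.assoc [symmetric] flip: mconst_arith(4) scalar_endo_hom(4))

lemma DD_normal_rep:
  assumes "const_coeff A" "const_coeff y"
  shows "DD * normal_rep A y X - normal_rep A y X * DD = normal_rep A y (pderiv X)"
  using assms const_coeff_next_symbol [OF assms(1)]
  by (simp add: normal_rep_def algebra_simps DD_rules(1) DD_field_mult pderiv_smult
      flip: funpow.simps(2)) (simp add: funpow_swap1)

lemma coeff_pderiv_funpow_xpow: "coeff ((pderiv ^^ k) (xpow n)) 0 = (if k = n then fact n else 0)"
proof -
  have "(pderiv ^^ k) (monom c n) = (if k \<le> n then monom (c * fact n / fact (n - k)) (n - k) else 0)" for c :: real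
  proof (induction k)
    case (Suc k)
    show ?case
    proof (cases "Suc k \<le> n")
      case True
      then have "n - k = Suc (n - Suc k)" by simp
      then show ?thesis using True Suc by (simp add: pderiv_monom)
    qed (use Suc in \<open>auto simp: pderiv_monom not_le less_Suc_eq\<close>)
  qed simp
  then show ?thesis by (auto simp: xpow_def)
qed

lemma EE_normal_rep:
  "EE * normal_rep A y (xpow n) =
    (if n = 0 then EE * DD else if n = 1 then EE * A else if n = 3 then EE * y
     else if n = 4 then EE * next_symbol A y 
     else if n = 5 then mconst (scalar_endo (1/2)) * (EE * next_symbol A (next_symbol A y)) else 0)"
proof -
  have c: "coeff (pderiv (xpow n)) 0 = (if n = 1 then 1 else 0)"  "coeff (xpow n) 0 = (if n = 0 then 1 else 0)"
    using coeff_pderiv_funpow_xpow [of 1 n] coeff_pderiv_funpow_xpow [of 0 n] by auto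
  have f: "fact 5 = (120 :: real)" "fact 4 = (24 :: real)" "fact 3 = (6 :: real)" by (simp_all add: fact_numeral)
  show ?thesis
    unfolding normal_rep_def distrib_left EE_field_mult c coeff_smult coeff_pderiv_funpow_xpow
    by (simp add: f scalar_endo_hom) 
qed

lemma cong_base_scale_iff:
  assumes "cong_base R (of_nat (Suc n) * S) (of_nat (Suc n) * T)" shows "cong_base R S T"
proof -
  have "embed (mconst (1 / of_nat (Suc n))) * (of_nat (Suc n) * V) = V" for V
    by (simp add: mult.assoc [symmetric] embed_hom(5) mconst_scalar_of_nat [symmetric]
       mconst_arith(4) [symmetric] scalar_endo_hom(4) [symmetric] scalar_endo_hom(2) del: of_nat_Suc)
  with cong_base_mult [OF cong_base_refl assms, of "embed (mconst (1 / of_nat (Suc n)))"] 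
  show ?thesis by simp
qed

lemma rep_eq_normal_rep:
  assumes U: "is_rep R U" and a: "is_diag a" "vanish 1 a"
    and A: "A = WW + a"
    and U0: "cong_base R (U (xpow 0)) DD"
    and U1: "cong_base R (U (xpow 1)) (XX * DD + A)"
    and U2: "cong_base R (U (xpow 2)) (XX * (XX * DD) + (XX * A + XX * A))"
    and y: "const_coeff y" "cong_base R (const_part (U (xpow 3))) y"
  shows "cong_base R (U X) (normal_rep A y X)"
proof -
  let ?N = "normal_rep A y"
  note ac = is_diag_commutes [OF a(1)]
  have Ac: "const_coeff A" unfolding A by (intro const_coeff_intros ac)
  have Ad: "symbol_deriv A = 0" by (simp add: A symbol_deriv_arith ac)
  note nc = const_coeff_next_symbol [OF Ac]
  have xp: "map_poly of_real (xpow 0) = 1" "map_poly complex_of_real (xpow (Suc n)) = [:0, 1:] * map_poly of_real (xpow n)" for n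
    by (simp_all add: xpow_def map_poly_monom flip: monom_Suc)
  have fx: "field_mult (xpow 0) = 1" "field_mult (xpow (Suc n)) = XX * field_mult (xpow n)" for n
    unfolding field_mult_def xp by (simp_all only: mult_by_hom mconst_arith mconst_hom)
  have px: "pderiv (xpow (Suc n)) = smult (of_nat (Suc n)) (xpow n)" "pderiv (xpow 0) = 0" for n
    by (simp_all add: xpow_def pderiv_monom smult_monom monom_0)
  have two: "mconst (scalar_endo 2) * T = T + T" for T :: endo_series
    using mconst_scalar_of_nat [of 2] by (simp add: mult_2)
  have N0: "?N (xpow 0) = DD"
    by (simp add: normal_rep_def eval_nat_numeral px fx field_mult_arith)
  have N1: "?N (xpow 1) = XX * DD + A"
    by (simp add: normal_rep_def eval_nat_numeral px fx field_mult_arith pderiv_smult scalar_endo_hom)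
  have N2: "?N (xpow 2) = XX * (XX * DD) + (XX * A + XX * A)"
    by (simp add: normal_rep_def eval_nat_numeral px fx field_mult_arith pderiv_smult scalar_endo_hom
       two algebra_simps)
  have NA: "DD * ?N X - ?N X * DD = ?N (pderiv X)" for X
    by (rule DD_normal_rep [OF Ac y(1)])
  \<comment> \<open>The product with the action of x^2 on the left vanishes at x = 0, so only the
    other product contributes; this is the sign in \<open>next_symbol\<close>.\<close>
  have bracket2: "EE * (?N (xpow 2) * T - T * ?N (xpow 2)) = EE * next_symbol A f"
    if "EE * T = EE * f" "const_coeff f" for T f
  proof -
    have "EE * (T * S) = EE * (f * S)" for S using that(1) by (metis mult.assoc)
    then show ?thesis
      using that(2) unfolding N2 next_symbol_def
      by (simp add: algebra_simps EE_XX const_coeff_mult_XX [of f] const_coeff_mult_XX [of "symbol_deriv f"])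
  qed
  have bracketU: "cong_base R (of_nat m * const_part (U (xpow (Suc n)))) (next_symbol A f)"
    if n: "cong_base R (U (xpow n)) (?N (xpow n))" and f: "EE * ?N (xpow n) = EE * f" "const_coeff f"
      and m: "n = m + 2" for m n f
  proof -
    have "const_part (of_nat m * T) = of_nat m * const_part T" for T
      by (induction m) (simp_all add: const_part_arith distrib_right const_part_id const_coeff_intros)
    moreover have "cong_base R (U (xpow 2) * U (xpow n) - U (xpow n) * U (xpow 2)) (of_nat m * U (xpow (Suc n)))"
      using is_rep_bracket [OF U, of "xpow 2" "xpow n" m "xpow (Suc n)"] m vect_bracket_xpow(3) [of n] by simp
    moreover have "cong_base R (?N (xpow 2) * ?N (xpow n) - ?N (xpow n) * ?N (xpow 2)) 
        (U (xpow 2) * U (xpow n) - U (xpow n) * U (xpow 2))"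
      by (intro cong_base_diff cong_base_mult cong_base_sym [OF n] cong_base_sym [OF U2 [folded N2]])
    ultimately have "cong_base R (const_part (?N (xpow 2) * ?N (xpow n) - ?N (xpow n) * ?N (xpow 2)))
       (of_nat m * const_part (U (xpow (Suc n))))"
      using cong_base_const_part [OF cong_base_trans] by metis
    also have "const_part (?N (xpow 2) * ?N (xpow n) - ?N (xpow n) * ?N (xpow 2)) = next_symbol A f"
      using bracket2 [OF f] by (intro const_part_eqI nc f) simp
    finally show ?thesis by (rule cong_base_sym)
  qed
  have main: "cong_base R (U (xpow n)) (?N (xpow n))" for n
  proof (induction n)
    case 0
    then show ?case using U0 by (simp add: N0)
  next
    case (Suc n)
    have step: "cong_base R (DD * ?N (xpow (Suc n)) - ?N (xpow (Suc n)) * DD) (of_nat (Suc n) * U (xpow n))"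
    proof -
      have "DD * ?N (xpow (Suc n)) - ?N (xpow (Suc n)) * DD = of_nat (Suc n) * ?N (xpow n)"
        unfolding NA px normal_rep_arith by (metis mconst_scalar_of_nat of_real_of_nat_eq)
      then show ?thesis by (simp only:) (intro cong_base_mult cong_base_refl cong_base_sym [OF Suc])
    qed
    \<comment> \<open>The commutators with \<partial> agree by induction, which leaves the constant
      parts.\<close>
    have reduce: ?case if "cong_base R (const_part (U (xpow (Suc n)))) (const_part (?N (xpow (Suc n))))"
      using is_rep_step [OF U U0 step, of 0] that by simp
    have cN: "const_part (?N (xpow m)) = f" if "EE * ?N (xpow m) = EE * f" "const_coeff f" for m f
      using that by (intro const_part_eqI) simp_all
    consider "Suc n = 1" | "Suc n = 2" | "Suc n = 3" | "Suc n = 4" | "Suc n = 5" | "Suc n \<ge> 6" by linarith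
    then show ?case
    proof cases
      case 1
      with U1 show ?thesis by (simp only: N1)
    next
      case 2
      with U2 show ?thesis by (simp only: N2)
    next
      case 3
      show ?thesis
      proof (rule reduce)
        have "const_part (?N (xpow (Suc n))) = y"
          by (rule cN) (simp_all add: 3 EE_normal_rep y)
        then show "cong_base R (const_part (U (xpow (Suc n)))) (const_part (?N (xpow (Suc n))))"
          using y(2) 3 by simp
      qed
    next
      case 4
      then have n: "n = 1 + 2" by simp
      show ?thesis
      proof (rule reduce)
        have "const_part (?N (xpow (Suc n))) = next_symbol A y"
          by (rule cN) (simp_all add: 4 EE_normal_rep nc y)
        moreover have "cong_base R (of_nat 1 * const_part (U (xpow (Suc n)))) (next_symbol A y)"
          by (rule bracketU [OF Suc _ y(1) n]) (simp add: n EE_normal_rep)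
        ultimately show "cong_base R (const_part (U (xpow (Suc n)))) (const_part (?N (xpow (Suc n))))"
          by simp
      qed
    next
      case 5
      then have n: "n = 2 + 2" by simp
      have ny: "const_coeff (next_symbol A y)" by (rule nc [OF y(1)])
      show ?thesis
      proof (rule reduce, rule cong_base_scale_iff [of _ 1])
        let ?h = "mconst (scalar_endo (1/2)) * next_symbol A (next_symbol A y)"
        have "const_coeff (embed (mconst (1/2)) * next_symbol A (next_symbol A y))"
          by (intro const_coeff_embed nc ny)
        then have h: "const_coeff ?h" by (simp add: embed_hom)
        have "EE * ?N (xpow (Suc n)) = EE * ?h"
          unfolding 5 by (simp add: EE_normal_rep) (metis mconst_scalar_commute mult.assoc)
        then have "const_part (?N (xpow (Suc n))) = ?h" using h by (rule cN)
        moreover have "of_nat (Suc 1) * ?h = next_symbol A (next_symbol A y)"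
          by (simp add: mult.assoc [symmetric] mconst_scalar_of_nat [symmetric]
            mconst_arith(4) [symmetric] scalar_endo_hom(4) [symmetric] scalar_endo_hom(2) del: of_nat_Suc)
            (simp add: scalar_endo_hom)
        moreover have "cong_base R (of_nat 2 * const_part (U (xpow (Suc n)))) (next_symbol A (next_symbol A y))"
          by (rule bracketU [OF Suc _ ny n]) (simp add: n EE_normal_rep)
        ultimately show "cong_base R (of_nat (Suc 1) * const_part (U (xpow (Suc n)))) 
            (of_nat (Suc 1) * const_part (?N (xpow (Suc n))))"
          by (simp add: numeral_2_eq_2 del: of_nat_Suc)
      qed
    next
      case 6
      show ?thesis
      proof (rule reduce)
        have "const_part (?N (xpow (Suc n))) = 0"
          by (rule cN) (use 6 in \<open>simp_all add: EE_normal_rep const_coeff_intros\<close>)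
        moreover have "lift (degree_part (Suc n)) T = (0 :: endo_series)" for T
        proof (rule mfps_eqI)
          fix b
          have "wt j + 1 \<noteq> wt i + k + Suc n" for i j k using 6 by (cases i; cases j) auto
          then show "mcoeff (lift (degree_part (Suc n)) T) b = mcoeff (0 :: endo_series) b"
            by (intro const_coeff_eqI [of "mcoeff _ _"]) (simp_all add: degree_part_def dx_multiplier
              symbol_coeff_linear)
        qed
        ultimately show "cong_base R (const_part (U (xpow (Suc n)))) (const_part (?N (xpow (Suc n))))"
          using degree_homogeneous [OF U a U1 [unfolded A], of "Suc n"] by simp
      qed
    qed
  qed
  show ?thesis
  proof -
    have "cong_base R (U (\<Sum>i\<in>S. monom (coeff X i) i)) (?N (\<Sum>i\<in>S. monom (coeff X i) i))" if "finite S" for S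
      using that
    proof (induction S)
      case empty
      have "U (0 + 0) = U 0 + U 0" using U unfolding is_rep_def by blast
      moreover have "?N 0 = 0" using normal_rep_arith(1) [of A y 0 0] by simp
      ultimately show ?case by (simp add: cong_base_refl)
    next
      case (insert i S)
      have m: "monom (coeff X i) i = smult (coeff X i) (xpow i)" by (simp add: xpow_def smult_monom)
      have "U (smult (coeff X i) (xpow i)) = mconst (scalar_endo (of_real (coeff X i))) * U (xpow i)"
        using U by (simp add: is_rep_def)
      moreover have "cong_base R \<dots> (mconst (scalar_endo (of_real (coeff X i))) * ?N (xpow i))"
        by (intro cong_base_mult cong_base_refl main)
      ultimately have "cong_base R (U (monom (coeff X i) i)) (?N (monom (coeff X i) i))"
        by (simp add: m normal_rep_arith)
      moreover have "U (S + T) = U S + U T" for S T using U by (simp add: is_rep_def)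
      ultimately show ?case using insert by (simp add: normal_rep_arith cong_base_add)
    qed
    from this [of "{..degree X}"] show ?thesis by (simp add: poly_as_sum_of_monoms)
  qed
qed

section \<open>The deformation parameters\<close>

lemma Dx_pderiv: "pderiv (Dx n X) = Dx (Suc n) X"
  by (simp add: Dx_def map_poly_of_real_arith)

lemma coeff_Dx_xpow: "coeff (Dx m (xpow n)) 0 = (if m = n then fact n else 0)"
  by (simp add: Dx_def coeff_map_poly coeff_pderiv_funpow_xpow)

lemma app_dx_power [simp]: "app (dx ^ n) u $ i = (pderiv ^^ n) (u $ i)"
  by (induction n arbitrary: u) (simp_all add: funpow_swap1)

lemma symbol_coeff_elementary:
  "symbol_coeff k i j (mat_unit a b * (mult_by q * dx ^ n)) = (if i = a \<and> j = b \<and> k = n then coeff q 0 else 0)"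
proof -
  have "(pderiv ^^ n) (monom (1 :: complex) k) = (if n \<le> k then monom (fact k / fact (k - n)) (k - n) else 0)"
  proof (induction n)
    case (Suc n)
    show ?case
    proof (cases "Suc n \<le> k")
      case True
      then have "k - n = Suc (k - Suc n)" by simp
      then show ?thesis using True Suc by (simp add: pderiv_monom)
    qed (use Suc in \<open>auto simp: pderiv_monom not_le less_Suc_eq\<close>)
  qed simp
  moreover have "(pderiv ^^ n) (0 :: complex poly) = 0" by (induction n) simp_all
  ultimately show ?thesis
    by (auto simp: symbol_coeff_def basis_symbol_def coeff_mult)
qed

lemma symbol_coeff_scalar: "symbol_coeff k i j (scalar_endo c * A) = c * symbol_coeff k i j A"
  by (rule symbol_coeff_linear)

lemma numeral_poly_mult:
  "numeral k * p = smult (numeral k) p" "numeral k * (p * q) = smult (numeral k) (p * q)"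
  "of_nat n * p = smult (of_nat n) p"
  for p q :: "complex poly"
  by (simp_all add: numeral_poly of_nat_poly)

lemma app_cocycle_symbols:
  "app (cocycle_symbols a b X) u $ j = (if j = b then cocycle (wt a) (wt b) X (u $ a) else 0)"
proof -
  have "clinear_symbols (\<lambda>u. \<chi> k. if k = b then cocycle (wt a) (wt b) X (u $ a) else 0)"
    by (simp add: clinear_symbols_def vec_eq_iff cocycle_def pderiv_funpow_arith pderiv_add pderiv_smult algebra_simps
        smult_add_right smult_diff_right numeral_poly_mult)
  then show ?thesis unfolding cocycle_symbols_def by (simp add: app_Endo)
qed

lemma cocycle_symbols_eq:
  "wt b = wt a \<Longrightarrow> cocycle_symbols a b X = mat_unit a b * (mult_by (Dx 1 X) * dx ^ 0)"
  "wt b = wt a + 2 \<Longrightarrow> cocycle_symbols a b X = mat_unit a b * (mult_by (Dx 3 X) * dx ^ 0) +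
     scalar_endo 2 * (mat_unit a b * (mult_by (Dx 2 X) * dx ^ 1))"
  "wt b = wt a + 3 \<Longrightarrow> cocycle_symbols a b X = mat_unit a b * (mult_by (Dx 3 X) * dx ^ 1) +
     mat_unit a b * (mult_by (Dx 2 X) * dx ^ 2)"
  "wt b = wt a + 4 \<Longrightarrow> cocycle_symbols a b X = scalar_endo (- of_nat (wt a)) * (mat_unit a b * (mult_by (Dx 5 X) * dx ^ 0)) +
     mat_unit a b * (mult_by (Dx 4 X) * dx ^ 1) -
     scalar_endo 6 * (mat_unit a b * (mult_by (Dx 3 X) * dx ^ 2)) -
     scalar_endo 4 * (mat_unit a b * (mult_by (Dx 2 X) * dx ^ 3))"
  by (rule endo_eq_nth; simp add: app_cocycle_symbols cocycle_def numeral_poly_mult mult.assoc del: One_nat_def)+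

definition lincomb :: "(param \<Rightarrow> scalar_series) \<Rightarrow> (param \<Rightarrow> endo) \<Rightarrow> endo_series" where
  "lincomb s f = (\<Sum>p\<in>UNIV. embed (s p) * mconst (f p))"

abbreviation param_order :: "param \<Rightarrow> nat" where "param_order p \<equiv> wt (tgt p) - wt (src p)"

text \<open>For an off-diagonal parameter of order \<open>k\<close> and source weight \<open>l\<close>, subtracting from the cocycle the
  coboundary of \<open>gauge_coeff p\<close> times \<open>\<partial>\<^sup>k\<close> makes it vanish on \<open>1, x, x\<^sup>2\<close>; the result is a transvectant
  with the third derivative of \<open>X\<close>, whose value at \<open>X = x\<^sup>3\<close>, \<open>x = 0\<close> is \<open>transvectant_coeff p\<close> times
  \<open>\<partial>\<^sup>k\<^sup>-\<^sup>2\<close>. For \<open>k = 2\<close> these numbers are \<open>2 / (2 l + 1)\<close> and \<open>6 / (2 l + 1)\<close>, for \<open>k = 3\<close> they are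
  \<open>1 / (3 (l + 1))\<close> and \<open>4 / (l + 1)\<close>.\<close>

fun gauge_coeff :: "param \<Rightarrow> complex" where
  "gauge_coeff T13 = 2/3" | "gauge_coeff T24 = 2/5" | "gauge_coeff T35 = 2/7"
| "gauge_coeff T14 = 1/6" | "gauge_coeff T25 = 1/9" | "gauge_coeff T15 = - 2/5"
| "gauge_coeff T11 = 0" | "gauge_coeff T22 = 0" | "gauge_coeff T33 = 0"
| "gauge_coeff T44 = 0" | "gauge_coeff T55 = 0"

fun transvectant_coeff :: "param \<Rightarrow> complex" where
  "transvectant_coeff T13 = 2" | "transvectant_coeff T24 = 6/5" | "transvectant_coeff T35 = 6/7"
| "transvectant_coeff T14 = 2" | "transvectant_coeff T25 = 4/3" | "transvectant_coeff T15 = - 12"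
| "transvectant_coeff T11 = 1" | "transvectant_coeff T22 = 1" | "transvectant_coeff T33 = 1"
| "transvectant_coeff T44 = 1" | "transvectant_coeff T55 = 1"

definition a_op :: "param \<Rightarrow> endo" where
  "a_op p = (if src p = tgt p then mat_unit (src p) (src p) else 0)"

text \<open>The order of the operator is forced by homogeneity at x^3; the factor makes the linear
  part of the normal form cohomologous to the cocycle with coefficient 1.\<close>

definition y_op :: "param \<Rightarrow> endo" where
  "y_op p = (if src p = tgt p then 0
     else scalar_endo (transvectant_coeff p) * (mat_unit (src p) (tgt p) * dx ^ (param_order p - 2)))"

definition g_op :: "param \<Rightarrow> endo" where
  "g_op p = scalar_endo (gauge_coeff p) * (mat_unit (src p) (tgt p) * dx ^ param_order p)"

lemma symbol_coeff_elementary':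
  "symbol_coeff k i j (mat_unit a b * dx ^ n) = (if i = a \<and> j = b \<and> k = n then 1 else 0)"
  using symbol_coeff_elementary [of k i j a b 1 n] by (simp add: mult_by_hom)

lemma dx_mat_unit: "dx * (mat_unit a b * dx ^ n) = mat_unit a b * dx ^ n * dx"
  by (simp add: mult.assoc [symmetric] operator_commutes(5) [symmetric])
    (simp add: mult.assoc power_commutes)

lemma dx_y_op: "dx * y_op p = y_op p * dx"
  by (simp add: y_op_def scalar_endo_left_commute [of dx] dx_mat_unit) (simp add: mult.assoc)

lemma sum_param: "(\<Sum>p\<in>UNIV. f p) = f T11 + (f T13 + (f T14 + (f T15 + (f T22 + (f T24 + (f T25 + (f T33 + (f T35 + (f T44 + f T55)))))))))"
  by (simp add: UNIV_param)

lemma lincomb_diag: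
  assumes "is_diag a"
  shows "lincomb (\<lambda>p. lift (symbol_coeff 0 (src p) (tgt p)) a) a_op = a"
proof (rule mfps_eqI)
  fix e
  obtain Y where a: "a = lift diag_part Y" using assms by (auto simp: is_diag_def)
  have "mcoeff (lincomb (\<lambda>p. lift (symbol_coeff 0 (src p) (tgt p)) a) a_op) e =
     (\<Sum>p\<in>UNIV. scalar_endo (symbol_coeff 0 (src p) (tgt p) (diag_part (mcoeff Y e))) * a_op p)"
    by (simp add: lincomb_def mcoeff_sum a)
  also have "\<dots> = diag_part (mcoeff Y e)"
  proof (rule endo_eq_nth)
    fix u i
    show "app (\<Sum>p\<in>UNIV. scalar_endo (symbol_coeff 0 (src p) (tgt p) (diag_part (mcoeff Y e))) * a_op p) u $ i =
      app (diag_part (mcoeff Y e)) u $ i"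
      by (cases i) (simp_all add: sum_param a_op_def diag_part_def symbol_coeff_diag scale_symbols_simps)
  qed
  finally show "mcoeff (lincomb (\<lambda>p. lift (symbol_coeff 0 (src p) (tgt p)) a) a_op) e = mcoeff a e"
    by (simp add: a)
qed

text \<open>For x^3, homogeneity leaves only k = wt j - wt i - 2. This needs a rise of 2, 3 or 4 in
  the weight, and the six such pairs of weights are those of the off-diagonal parameters.\<close>

lemma degree_part_3:
  "degree_part 3 A = (\<Sum>p\<in>UNIV. scalar_endo (symbol_coeff (param_order p - 2) (src p) (tgt p) A / transvectant_coeff p) * y_op p)"
proof (rule const_coeff_eqI)
  have "dx * (scalar_endo c * y_op p) = scalar_endo c * y_op p * dx" for c p
    by (simp add: scalar_endo_left_commute [of dx] dx_y_op mult.assoc)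
  then show "dx * (\<Sum>p\<in>UNIV. scalar_endo (symbol_coeff (param_order p - 2) (src p) (tgt p) A / transvectant_coeff p) * y_op p) =
    (\<Sum>p\<in>UNIV. scalar_endo (symbol_coeff (param_order p - 2) (src p) (tgt p) A / transvectant_coeff p) * y_op p) * dx"
    by (simp add: sum_distrib_left sum_distrib_right)
  fix k i j
  have y: "symbol_coeff k i j (scalar_endo c * y_op p) =
     (if src p \<noteq> tgt p \<and> i = src p \<and> j = tgt p \<and> k = param_order p - 2 then c * transvectant_coeff p else 0)" for c p
    by (auto simp: y_op_def symbol_coeff_scalar symbol_coeff_elementary' symbol_coeff_linear)
  show "symbol_coeff k i j (degree_part 3 A) = symbol_coeff k i j
    (\<Sum>p\<in>UNIV. scalar_endo (symbol_coeff (param_order p - 2) (src p) (tgt p) A / transvectant_coeff p) * y_op p)"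
    unfolding symbol_coeff_linear(6) y
    by (cases i; cases j) (simp_all add: sum_param degree_part_def)
qed (simp add: degree_part_def dx_multiplier)

lemma lincomb_cong:
  assumes "\<And>p. f p \<noteq> 0 \<Longrightarrow> s p - s' p \<in> R"
  shows "cong_base R (lincomb s f) (lincomb s' f)"
  unfolding lincomb_def
proof (rule cong_base_sum)
  fix p
  show "cong_base R (embed (s p) * mconst (f p)) (embed (s' p) * mconst (f p))"
    using assms [of p] by (cases "f p = 0") (auto intro: cong_base_embed simp: cong_base_refl)
qed

section \<open>Reading off the parameters to first order\<close>

lemma hom_part_one_mult: 
  fixes f g :: "('v::finite, 'a::ring_1) mfps"
  shows "hom_part 1 (f * g) = hom_part 0 f * hom_part 1 g + hom_part 1 f * hom_part 0 g"
  by (simp add: hom_part_mult)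

text \<open>The linear part of \<open>P * Q = 1\<close> gives
  \<open>hom_part 1 Q = - hom_part 1 P\<close>, so to first order a gauge transformation adds a
  coboundary.\<close>

lemma hom_part_one_conj:
  fixes P Q :: endo_series
  assumes "P * Q = 1" "hom_part 0 P = 1"
  shows "hom_part 0 (P * T * Q) = hom_part 0 T"
    "hom_part 1 (P * T * Q) = hom_part 1 T + (hom_part 1 P * hom_part 0 T - hom_part 0 T * hom_part 1 P)"
proof -
  have Q0: "hom_part 0 Q = 1"
    using arg_cong [OF assms(1), of "hom_part 0"] assms(2) by (simp add: hom_part_zero_mult hom_part_one)
  have "hom_part 1 Q + hom_part 1 P = 0"
    using arg_cong [OF assms(1), of "hom_part 1"] unfolding hom_part_one_mult
    by (simp add: assms(2) hom_part_one Q0)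
  then have "hom_part 1 Q = - hom_part 1 P" by (simp add: eq_neg_iff_add_eq_0)
  then show "hom_part 1 (P * T * Q) = hom_part 1 T + (hom_part 1 P * hom_part 0 T - hom_part 0 T * hom_part 1 P)"
    unfolding hom_part_one_mult by (simp add: hom_part_zero_mult assms(2) Q0 algebra_simps)
  show "hom_part 0 (P * T * Q) = hom_part 0 T"
    by (simp add: hom_part_zero_mult assms(2) Q0)
qed

text \<open>\<open>leading_symbol\<close> reads off the off-diagonal parameters. The correction by the action of \<open>x\<^sup>2\<close>, which
  is trivial modulo the relations, makes the linear part independent of the gauge transformation.\<close>

definition gauge_ratio :: "param \<Rightarrow> complex" where
  "gauge_ratio p = (of_nat (param_order p) - 1) * (of_nat (param_order p) - 2 + 3 * of_nat (wt (src p))) /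
     (of_nat (param_order p) - 1 + 2 * of_nat (wt (src p)))"

definition leading_symbol :: "param \<Rightarrow> endo \<Rightarrow> endo \<Rightarrow> complex" where
  "leading_symbol p A B = symbol_coeff (param_order p - 2) (src p) (tgt p) B -
     gauge_ratio p * symbol_coeff (param_order p - 1) (src p) (tgt p) A"

lemma lie_symbols_xpow_23:
  "lie_symbols (xpow 2) = x_endo * (x_endo * dx) + scalar_endo 2 * (x_endo * weights)"
  "lie_symbols (xpow 3) = x_endo * (x_endo * (x_endo * dx)) + scalar_endo 3 * (x_endo * (x_endo * weights))"
  using lie_symbols_eq [of "xpow 2"] lie_symbols_eq [of "xpow 3"] unfolding Dx_xpow
  by (auto intro!: endo_eq_nth simp: monom_Suc monom_0 numeral_2_eq_2 numeral_3_eq_3 algebra_simps)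

text \<open>For a parameter of order N, index N - 1 for x^2 and index N - 2 for x^3 both lead to the
  coefficient of \<partial>^N in \<open>A\<close>. The quotient of the two factors is
  \<open>gauge_ratio\<close>, which is why the combination in \<open>leading_symbol\<close> does not
  see coboundaries.\<close>

lemma symbol_coeff_lie_commutator:
  "symbol_coeff k i j (A * lie_symbols (xpow 2) - lie_symbols (xpow 2) * A) =
     of_nat (Suc k * (k + 2 * wt i)) * symbol_coeff (Suc k) i j A"
  "symbol_coeff k i j (A * lie_symbols (xpow 3) - lie_symbols (xpow 3) * A) =
     of_nat (Suc k * Suc (Suc k) * (k + 3 * wt i)) * symbol_coeff (Suc (Suc k)) i j A"
proof -
  have x0: "symbol_coeff k i j (x_endo * T * S) = 0" for T S
    by (simp add: mult.assoc symbol_coeff_operators)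
  have 1: "symbol_coeff k i j (A * x_endo * x_endo * dx) = of_nat (k * Suc k) * symbol_coeff (Suc k) i j A"
    by (cases k; simp add: symbol_coeff_operators; simp add: algebra_simps)
  have 2: "symbol_coeff k i j (A * x_endo * x_endo * x_endo * dx) = of_nat (k * Suc k * Suc (Suc k)) * symbol_coeff (Suc (Suc k)) i j A"
    by (cases k; simp add: symbol_coeff_operators; simp add: algebra_simps)
  have "A * lie_symbols (xpow 2) - lie_symbols (xpow 2) * A = A * x_endo * x_endo * dx + scalar_endo 2 * (A * x_endo * weights) -
      (x_endo * (x_endo * dx) * A + scalar_endo 2 * (x_endo * weights * A))"
    by (simp add: lie_symbols_xpow_23 distrib_left distrib_right scalar_endo_left_commute mult.assoc)
  then show "symbol_coeff k i j (A * lie_symbols (xpow 2) - lie_symbols (xpow 2) * A) =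
     of_nat (Suc k * (k + 2 * wt i)) * symbol_coeff (Suc k) i j A"
    by (simp add: symbol_coeff_linear x0 1 symbol_coeff_operators) (simp add: algebra_simps)
  have "A * lie_symbols (xpow 3) - lie_symbols (xpow 3) * A = A * x_endo * x_endo * x_endo * dx + scalar_endo 3 * (A * x_endo * x_endo * weights) -
      (x_endo * (x_endo * (x_endo * dx)) * A + scalar_endo 3 * (x_endo * (x_endo * weights) * A))"
    by (simp add: lie_symbols_xpow_23 distrib_left distrib_right scalar_endo_left_commute mult.assoc)
  then show "symbol_coeff k i j (A * lie_symbols (xpow 3) - lie_symbols (xpow 3) * A) =
     of_nat (Suc k * Suc (Suc k) * (k + 3 * wt i)) * symbol_coeff (Suc (Suc k)) i j A"
    by (simp add: symbol_coeff_linear x0 2 symbol_coeff_operators) (simp add: algebra_simps)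
qed

lemma leading_symbol_commutator:
  assumes "src p \<noteq> tgt p"
  shows "leading_symbol p (A * lie_symbols (xpow 2) - lie_symbols (xpow 2) * A)
    (A * lie_symbols (xpow 3) - lie_symbols (xpow 3) * A) = 0"
  using assms unfolding leading_symbol_def gauge_ratio_def symbol_coeff_lie_commutator
  by (cases p) (simp_all add: eval_nat_numeral)

lemma symbol_coeff_elementary_low:
  "symbol_coeff k i j (mat_unit a b * mult_by q) = (if i = a \<and> j = b \<and> k = 0 then coeff q 0 else 0)"
  "symbol_coeff k i j (mat_unit a b * (mult_by q * dx)) = (if i = a \<and> j = b \<and> k = 1 then coeff q 0 else 0)"
  using symbol_coeff_elementary [of k i j a b q 0] symbol_coeff_elementary [of k i j a b q 1] by simp_all

lemma symbol_coeff_mat_unit: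
  "symbol_coeff k i j (mat_unit a b) = (if i = a \<and> j = b \<and> k = 0 then 1 else 0)"
  using symbol_coeff_elementary_low(1) [of k i j a b 1] by (simp add: mult_by_hom)

lemma leading_symbol_cocycle:
  assumes "src p \<noteq> tgt p"
  shows "leading_symbol p (cocycle_symbols (src q) (tgt q) (xpow 2)) (cocycle_symbols (src q) (tgt q) (xpow 3)) =
    (if p = q then transvectant_coeff p else 0)"
  using assms
  by (cases p; cases q) (simp_all add: leading_symbol_def gauge_ratio_def cocycle_symbols_eq symbol_coeff_linear
      symbol_coeff_elementary symbol_coeff_elementary_low coeff_Dx_xpow fact_numeral)

definition leading_series :: "param \<Rightarrow> endo_series \<Rightarrow> endo_series \<Rightarrow> scalar_series" where
  "leading_series p S T = lift (symbol_coeff (param_order p - 2) (src p) (tgt p)) T -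
     mconst (gauge_ratio p) * lift (symbol_coeff (param_order p - 1) (src p) (tgt p)) S"

lemma mcoeff_leading_series [simp]: "mcoeff (leading_series p S T) e = leading_symbol p (mcoeff S e) (mcoeff T e)"
  by (simp add: leading_series_def leading_symbol_def)

lemma embed_mvar: "embed (mvar p) = mvar p"
  by (rule mfps_eqI) (simp add: mvar_def scalar_endo_hom)

lemma infinitesimal_eq: "infinitesimal X = lincomb mvar (\<lambda>p. cocycle_symbols (src p) (tgt p) X)"
  by (simp add: infinitesimal_def lincomb_def embed_mvar)

lemma mcoeff_lincomb: "mcoeff (lincomb s f) e = (\<Sum>p\<in>UNIV. scalar_endo (mcoeff (s p) e) * f p)"
  by (simp add: lincomb_def mcoeff_sum)

lemma is_diag_lincomb: "is_diag (lincomb s a_op)"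
proof -
  have "lincomb s a_op = lift diag_part (lincomb s a_op)"
  proof (rule mfps_eqI)
    fix e
    have "diag_part (a_op p) = a_op p" for p
      by (rule endo_eq_nth) (auto simp: a_op_def diag_part_def symbol_coeff_mat_unit symbol_coeff_linear)
    then show "mcoeff (lincomb s a_op) e = mcoeff (lift diag_part (lincomb s a_op)) e"
      by (simp add: mcoeff_lincomb endo_linearD [OF endo_linear_diag_part])
  qed
  then show ?thesis unfolding is_diag_def by (rule exI)
qed

lemma vanish_lincomb: "(\<And>p. vanish n (s p)) \<Longrightarrow> vanish n (lincomb s f)"
  by (simp add: vanish_mcoeff mcoeff_lincomb scalar_endo_hom)

lemma const_coeff_lincomb_y: "const_coeff (lincomb s y_op)"
proof -
  have "dx * (scalar_endo c * y_op p) = scalar_endo c * y_op p * dx" for c p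
    by (simp add: scalar_endo_left_commute [of dx] dx_y_op mult.assoc)
  then show ?thesis
    by (simp add: const_coeff_mcoeff mcoeff_lincomb sum_distrib_left sum_distrib_right)
qed

lemma hom_part_mvar: "hom_part m (mvar p :: scalar_series) = (if m = 1 then mvar p else 0)"
proof (rule mfps_eqI)
  fix a
  let ?d = "\<lambda>w. if w = p then 1 else 0 :: nat"
  have "mdeg ?d = 1" by (simp add: mdeg_def)
  moreover have "mcoeff (mvar p :: scalar_series) b = (if b = ?d then 1 else 0)" for b
    by (simp add: mvar_def)
  ultimately show "mcoeff (hom_part m (mvar p :: scalar_series)) a = mcoeff (if m = 1 then mvar p else 0) a"
    by (cases "a = ?d"; cases "m = 1") simp_all
qed

lemma deformation_normal_form:
  assumes \<rho>: "is_rep R \<rho>" and inf: "\<And>X. hom_part 1 (\<rho> X) = infinitesimal X"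
  obtains P Q s where "hom_part 0 P = 1" "P * Q = 1" "Q * P = 1"
    "\<And>p. hom_part 0 (s p) = 0" "\<And>p. hom_part 1 (s p) = mvar p"
    "\<And>X. cong_base R (P * \<rho> X * Q) (normal_rep (WW + lincomb s a_op) (lincomb s y_op) X)"
proof -
  obtain P Q a where PQ: "hom_part 0 P = 1" "P * Q = 1" "Q * P = 1" and a: "is_diag a" "vanish 1 a"
    and U0: "cong_base R (P * \<rho> (xpow 0) * Q) DD"
    and U1: "cong_base R (P * \<rho> (xpow 1) * Q) (XX * DD + (WW + a))"
    and U2: "cong_base R (P * \<rho> (xpow 2) * Q) (XX * (XX * DD) + (XX * (WW + a) + XX * (WW + a)))"
    using sl2_normal_form [OF \<rho>] .
  define U where "U X = P * \<rho> X * Q" for X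
  have U: "is_rep R U" unfolding U_def by (rule is_rep_conj [OF \<rho> PQ(2,3,1)])
  have R: "is_ideal R" using \<rho> by (simp add: is_rep_def)
  note U012 = U0 [folded U_def] U1 [folded U_def] U2 [folded U_def]
  note fn = endo_functional_symbol_coeff
  \<comment> \<open>The readings are taken from U itself. The linear parts of \<open>a\<close> and
    of the homogeneous part of the action of x^3 are not controlled, since these are related to U
    only modulo R.\<close>
  define s where "s p = (if src p = tgt p 
     then lift (symbol_coeff 0 (src p) (tgt p)) (U (xpow 1) - XX * DD - WW)
     else mconst (1 / transvectant_coeff p) * leading_series p (U (xpow 2)) (U (xpow 3)))" for p
  have tc: "transvectant_coeff p \<noteq> 0" for p by (cases p) simp_all

  define p1 where "p1 = hom_part 1 P"
  have hom0: "hom_part 0 (U X) = mconst (lie_symbols X)" for X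
    using U by (simp add: is_rep_def)
  have hom1: "hom_part 1 (U X) = infinitesimal X + (p1 * mconst (lie_symbols X) - mconst (lie_symbols X) * p1)" for X
    unfolding U_def p1_def hom_part_one_conj(2) [OF PQ(2,1)] inf
    using \<rho> by (simp add: is_rep_def)
  have hl: "hom_part m (lift (symbol_coeff k i j) T) = lift (symbol_coeff k i j) (hom_part m T)" for m k i j and T :: endo_series
    by (simp add: lift_functional_arith(5) [OF fn])
  have hls: "hom_part m (leading_series p S T) = leading_series p (hom_part m S) (hom_part m T)" for m p S T
    by (rule mfps_eqI) (simp add: leading_symbol_def symbol_coeff_linear)
  have hmc: "hom_part m (mconst c * f) = mconst c * hom_part m f" for m c and f :: scalar_series
    by (rule mfps_eqI) simp
  have s0: "hom_part 0 (s p) = 0" for p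
  proof (cases "src p = tgt p")
    case True
    have "hom_part 0 (U (xpow 1) - XX * DD - WW) = 0"
      by (simp add: hom0 lie_symbols_xpow hom_part_mconst mconst_arith hom_part_zero_mult del: One_nat_def)
    with True show ?thesis by (simp add: s_def hl lift_functional_arith(2) [OF fn] del: One_nat_def)
  next
    case False
    have "symbol_coeff (param_order p - 2) (src p) (tgt p) (lie_symbols (xpow 3)) = 0"
      "symbol_coeff (param_order p - 1) (src p) (tgt p) (lie_symbols (xpow 2)) = 0"
      using symbol_coeff_operators(2) [of _ _ _ 1]
      by (simp_all add: lie_symbols_xpow_23 symbol_coeff_linear symbol_coeff_operators)
    then have "leading_series p (mconst (lie_symbols (xpow 2))) (mconst (lie_symbols (xpow 3))) = 0"
      by (intro mfps_eqI) (simp add: leading_symbol_def mcoeff_mconst symbol_coeff_linear)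
    with False show ?thesis by (simp add: s_def hmc hls hom0)
  qed
  have s1: "hom_part 1 (s p) = mvar p" for p
  proof (cases "src p = tgt p")
    case True
    have "lift (symbol_coeff 0 (src p) (tgt p)) (hom_part 1 (U (xpow 1) - XX * DD - WW)) = (mvar p :: scalar_series)"
    proof (rule mfps_eqI)
      fix e
      \<comment> \<open>A coboundary is invisible on the diagonal: source and target have the same
        weight, and the term with \<partial> on the right has no constant coefficient.\<close>
      have l: "symbol_coeff 0 (src p) (tgt p) (A * lie_symbols (xpow 1) - lie_symbols (xpow 1) * A) = 0" for A
        using True by (simp add: lie_symbols_xpow distrib_left distrib_right mult.assoc [symmetric] symbol_coeff_linear
            symbol_coeff_operators del: One_nat_def) (simp add: mult.assoc symbol_coeff_operators)
      have q: "symbol_coeff 0 (src p) (tgt p) (cocycle_symbols (src q) (tgt q) (xpow 1)) = (if q = p then 1 else 0)" for q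
        using True by (cases p; cases q) (simp_all add: cocycle_symbols_eq symbol_coeff_linear symbol_coeff_scalar
          symbol_coeff_elementary symbol_coeff_elementary_low coeff_Dx_xpow)
      have "mcoeff (hom_part 1 (U (xpow 1) - XX * DD - WW)) e = mcoeff (infinitesimal (xpow 1)) e +
          (mcoeff p1 e * lie_symbols (xpow 1) - lie_symbols (xpow 1) * mcoeff p1 e)"
        unfolding hom_part_arith hom1 by (simp add: hom_part_mconst hom_part_one_mult del: mcoeff_hom_part One_nat_def)
      then show "mcoeff (lift (symbol_coeff 0 (src p) (tgt p)) (hom_part 1 (U (xpow 1) - XX * DD - WW))) e =
        mcoeff (mvar p :: scalar_series) e"
        by (simp add: infinitesimal_eq mcoeff_lincomb symbol_coeff_linear(1,6) l q symbol_coeff_scalar if_distrib [of "\<lambda>c. _ * c"]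
            cong: if_cong del: mcoeff_hom_part One_nat_def)
    qed
    with True show ?thesis by (simp add: s_def hl del: One_nat_def)
  next
    case False
    have "leading_series p (hom_part 1 (U (xpow 2))) (hom_part 1 (U (xpow 3))) = mconst (transvectant_coeff p) * mvar p"
    proof (rule mfps_eqI)
      fix e
      have add: "leading_symbol p (A + A') (B + B') = leading_symbol p A B + leading_symbol p A' B'" for A A' B B'
        by (simp add: leading_symbol_def symbol_coeff_linear algebra_simps)
      have sum: "leading_symbol p (\<Sum>q\<in>S. scalar_endo (c q) * f q) (\<Sum>q\<in>S. scalar_endo (c q) * g q) =
         (\<Sum>q\<in>S. c q * leading_symbol p (f q) (g q))" for S :: "param set" and c f g
        by (simp add: leading_symbol_def symbol_coeff_linear symbol_coeff_scalar sum_distrib_left 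
           sum_subtractf [symmetric] right_diff_distrib mult.left_commute)
      show "mcoeff (leading_series p (hom_part 1 (U (xpow 2))) (hom_part 1 (U (xpow 3)))) e =
         mcoeff (mconst (transvectant_coeff p) * mvar p) e"
        unfolding hom1 mcoeff_leading_series infinitesimal_eq
        by (simp add: add mcoeff_lincomb sum leading_symbol_commutator [OF False] leading_symbol_cocycle [OF False]
            if_distrib [of "\<lambda>c. _ * c"] mult.commute cong: if_cong)
    qed
    then have "hom_part 1 (s p) = mconst (1 / transvectant_coeff p) * (mconst (transvectant_coeff p) * mvar p)"
      using False by (simp add: s_def hls hmc del: One_nat_def)
    also have "\<dots> = mvar p"
      by (simp add: mult.assoc [symmetric] mconst_arith(4) [symmetric] tc)
    finally show ?thesis .
  qed

  have "cong_base R (U (xpow 1) - XX * DD - WW) (XX * DD + (WW + a) - XX * DD - WW)"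
    by (intro cong_base_diff U012 cong_base_refl)
  then have c1: "cong_base R (U (xpow 1) - XX * DD - WW) a" by (simp add: algebra_simps)
  have "cong_base R (lincomb s a_op) (lincomb (\<lambda>p. lift (symbol_coeff 0 (src p) (tgt p)) a) a_op)"
  proof (rule lincomb_cong)
    fix p assume "a_op p \<noteq> 0"
    then have "src p = tgt p" by (auto simp: a_op_def split: if_splits)
    then show "s p - lift (symbol_coeff 0 (src p) (tgt p)) a \<in> R"
      using cong_base_functional [OF R fn c1] by (simp add: s_def)
  qed
  then have "cong_base R a (lincomb s a_op)" by (simp add: lincomb_diag [OF a(1)] cong_base_sym)
  then have ca: "cong_base R (WW + a) (WW + lincomb s a_op)" by (intro cong_base_add cong_base_refl)
  have U1': "cong_base R (U (xpow 1)) (XX * DD + (WW + lincomb s a_op))"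
    by (rule cong_base_trans [OF U012(2)]) (intro cong_base_add [of R "XX * DD"] ca cong_base_refl)
  have U2': "cong_base R (U (xpow 2)) (XX * (XX * DD) + (XX * (WW + lincomb s a_op) + XX * (WW + lincomb s a_op)))"
    by (rule cong_base_trans [OF U012(3)])
      (intro cong_base_add [of R "XX * _"] cong_base_mult [of R XX] ca cong_base_refl)

  define f where "f = const_part (U (xpow 3))"
  have "cong_base R f (lift (degree_part 3) f)"
    unfolding f_def by (rule degree_homogeneous [OF U a U012(2)])
  also have "lift (degree_part 3) f = 
     lincomb (\<lambda>p. mconst (1 / transvectant_coeff p) * lift (symbol_coeff (param_order p - 2) (src p) (tgt p)) f) y_op"
    by (rule mfps_eqI) (simp add: mcoeff_lincomb degree_part_3)
  also have "cong_base R \<dots> (lincomb s y_op)"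
  proof (rule cong_base_sym, rule lincomb_cong)
    fix p assume "y_op p \<noteq> 0"
    then have p: "src p \<noteq> tgt p" by (auto simp: y_op_def)
    have "lift (symbol_coeff (param_order p - 2) (src p) (tgt p)) f = lift (symbol_coeff (param_order p - 2) (src p) (tgt p)) (U (xpow 3))"
    proof (rule lift_cong)
      fix e
      have "EE * f = EE * U (xpow 3)" by (simp add: f_def ev0_const_part)
      then have "mcoeff (EE * f) e = mcoeff (EE * U (xpow 3)) e" by simp
      then show "symbol_coeff (param_order p - 2) (src p) (tgt p) (mcoeff f e) = symbol_coeff (param_order p - 2) (src p) (tgt p) (mcoeff (U (xpow 3)) e)"
        by (intro symbol_coeff_ev0) simp
    qed
    \<comment> \<open>In the normal form the action of x^2 has a left factor x, so its symbol at x =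
      0 lies in R; the correction in \<open>leading_series\<close> thus changes s p by an element of
      R.\<close>
    moreover have "lift (symbol_coeff (param_order p - 1) (src p) (tgt p)) (U (xpow 2)) \<in> R"
    proof -
      have "lift (symbol_coeff (param_order p - 1) (src p) (tgt p)) (XX * T) = (0 :: scalar_series)" for T
        by (rule mfps_eqI) (simp add: symbol_coeff_operators)
      then show ?thesis
        using cong_base_functional [OF R fn U012(3), of "param_order p - 1" "src p" "tgt p"]
        by (simp add: lift_functional_arith [OF fn])
    qed
    then have "(- (mconst (1 / transvectant_coeff p) * mconst (gauge_ratio p))) * lift (symbol_coeff (param_order p - 1) (src p) (tgt p)) (U (xpow 2)) \<in> R"
      using R unfolding is_ideal_def by blast
    ultimately show "s p - mconst (1 / transvectant_coeff p) * lift (symbol_coeff (param_order p - 2) (src p) (tgt p)) f \<in> R"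
      using p by (simp add: s_def leading_series_def right_diff_distrib mult.assoc)
  qed
  finally have y: "cong_base R (const_part (U (xpow 3))) (lincomb s y_op)" by (simp add: f_def)
  have va: "vanish 1 (lincomb s a_op)" by (rule vanish_lincomb) (simp add: vanish_def s0)
  have "cong_base R (U X) (normal_rep (WW + lincomb s a_op) (lincomb s y_op) X)" for X
    by (rule rep_eq_normal_rep [OF U is_diag_lincomb va refl U012(1) U1' U2' const_coeff_lincomb_y y])
  with PQ s0 s1 that show ?thesis unfolding U_def by blast
qed

section \<open>A polynomial representative\<close>

abbreviation unit_series :: "weight \<Rightarrow> endo_series" where "unit_series i \<equiv> mconst (mat_unit i i)"

lemma mat_unit_mult: "mat_unit i j * mat_unit k l = (if l = i then mat_unit k j else 0)"
  by (rule endo_eq_nth) auto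

lemma sum_weight: "(\<Sum>i\<in>UNIV. f i) = f W1 + (f W2 + (f W3 + (f W4 + f W5)))"
  by (simp add: UNIV_weight)

lemma sum_unit_series: "(\<Sum>i\<in>UNIV. unit_series i) = 1"
proof -
  have "(\<Sum>i\<in>UNIV. mat_unit i i) = 1"
  proof (rule endo_eq_nth)
    fix u j show "app (\<Sum>i\<in>UNIV. mat_unit i i) u $ j = app 1 u $ j"
      by (cases j) (simp_all add: sum_weight)
  qed
  then show ?thesis by (simp add: sum_weight mconst_arith(1) [symmetric])
qed

section \<open>The filtration by the rise of the weight\<close>

definition level :: "nat \<Rightarrow> endo_series \<Rightarrow> bool" where
  "level l T \<longleftrightarrow> (\<forall>i j. wt j < wt i + l \<longrightarrow> unit_series j * T * unit_series i = 0)"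

lemma level_arith:
  "level l S \<Longrightarrow> level l T \<Longrightarrow> level l (S + T)" "level l S \<Longrightarrow> level l T \<Longrightarrow> level l (S - T)"
  "level l S \<Longrightarrow> level l (- S)" "level l 0"
  by (simp_all add: level_def distrib_left distrib_right left_diff_distrib right_diff_distrib)

lemma level_mult:
  assumes "level l S" "level m T" shows "level (l + m) (S * T)"
  unfolding level_def
proof (intro allI impI)
  fix i j assume ij: "wt j < wt i + (l + m)"
  have "unit_series j * (S * T) * unit_series i = unit_series j * S * (\<Sum>k\<in>UNIV. unit_series k) * T * unit_series i"
    by (simp only: sum_unit_series mult_1_right mult.assoc)
  also have "\<dots> = (\<Sum>k\<in>UNIV. unit_series j * S * unit_series k * T * unit_series i)"
    by (simp add: sum_distrib_left sum_distrib_right)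
  also have "\<dots> = (\<Sum>k\<in>(UNIV :: weight set). 0)"
  proof (rule sum.cong [OF refl])
    fix k
    have "unit_series k * unit_series k = unit_series k"
      by (simp add: mconst_arith(4) [symmetric] mat_unit_mult)
    then have "unit_series k * (unit_series k * V) = unit_series k * V" for V
      by (simp add: mult.assoc [symmetric])
    then have "unit_series j * S * unit_series k * T * unit_series i =
      (unit_series j * S * unit_series k) * (unit_series k * T * unit_series i)"
      by (simp add: mult.assoc)
    also have "\<dots> = 0"
    proof (cases "wt j < wt k + l")
      case True
      with assms(1) show ?thesis by (simp add: level_def)
    next
      case False
      with ij have "wt k < wt i + m" by simp
      with assms(2) show ?thesis by (simp add: level_def)
    qed
    finally show "unit_series j * S * unit_series k * T * unit_series i = 0" .
  qed
  finally show "unit_series j * (S * T) * unit_series i = 0" by simp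
qed

lemma level_mono: "level l T \<Longrightarrow> m \<le> l \<Longrightarrow> level m T"
  by (auto simp: level_def)

text \<open>Weights run from 1 to 5, so no block can raise the weight by more than 4.\<close>

lemma level_zero:
  assumes "level l T" "l \<ge> 5" shows "T = 0"
proof -
  have "T = (\<Sum>j\<in>UNIV. unit_series j) * T * (\<Sum>i\<in>UNIV. unit_series i)" by (simp add: sum_unit_series)
  also have "\<dots> = (\<Sum>j\<in>UNIV. \<Sum>i\<in>UNIV. unit_series j * T * unit_series i)"
    by (simp add: sum_distrib_left sum_distrib_right) (rule sum.swap)
  also have "\<dots> = (\<Sum>j\<in>(UNIV :: weight set). \<Sum>i\<in>(UNIV :: weight set). 0)"
  proof (intro sum.cong refl)
    fix i j
    have "wt j < wt i + 5" by (cases i; cases j) auto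
    with assms show "unit_series j * T * unit_series i = 0" by (simp add: level_def)
  qed
  finally show ?thesis by simp
qed

lemma level_embed: "level l T \<Longrightarrow> level l (embed f * T)"
  by (simp add: level_def embed_left_commute mult.assoc)

lemma level_lincomb: "(\<And>p. level l (mconst (f p))) \<Longrightarrow> level l (lincomb s f)"
  unfolding lincomb_def
  by (simp add: sum_param level_arith level_embed)

lemma level_commuting:
  assumes "\<And>i. mat_unit i i * A = A * mat_unit i i"
  shows "level 0 (mconst A)"
  unfolding level_def
proof (intro allI impI)
  fix i j assume "wt j < wt i + 0"
  then have "i \<noteq> j" by auto
  then have "mat_unit j j * A * mat_unit i i = 0"
    by (simp add: assms mult.assoc mat_unit_mult)
  then show "unit_series j * mconst A * unit_series i = 0"
    by (simp add: mconst_arith(4) [symmetric])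
qed

lemma mat_unit_diag: "mat_unit i i * diag c = diag c * mat_unit i i"
  by (rule endo_eq_nth) simp

lemma level_operators:
  "level 0 DD" "level 0 XX" "level 0 WW" "level 0 (field_mult X)" "level 0 1"
  by (auto intro!: level_commuting simp: field_mult_def operator_commutes mat_unit_diag simp flip: mconst_hom(2))

lemma level_mat_unit:
  assumes "wt i + l \<le> wt j" shows "level l (mconst (mat_unit i j))"
  unfolding level_def
proof (intro allI impI)
  fix a b assume "wt b < wt a + l"
  with assms have "a \<noteq> i \<or> b \<noteq> j" by auto
  then have "mat_unit b b * mat_unit i j * mat_unit a a = 0" by (auto simp: mat_unit_mult)
  then show "unit_series b * mconst (mat_unit i j) * unit_series a = 0"
    by (simp add: mconst_arith(4) [symmetric])
qed

lemma level_elementary: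
  assumes "wt i + l \<le> wt j \<or> c = 0" shows "level l (mconst (scalar_endo c * (mat_unit i j * dx ^ n)))"
proof (cases "c = 0")
  case False
  have "level 0 (mconst (dx ^ n))"
  proof (rule level_commuting)
    show "mat_unit i i * dx ^ n = dx ^ n * mat_unit i i" for i
    proof (induction n)
      case (Suc n)
      have "mat_unit i i * dx ^ Suc n = dx * (mat_unit i i * dx ^ n)"
        by (simp add: mult.assoc [symmetric] operator_commutes(5))
      also have "\<dots> = dx ^ Suc n * mat_unit i i" by (simp add: Suc mult.assoc)
      finally show ?case .
    qed simp
  qed
  from level_mult [OF level_mat_unit this, of i l j] show ?thesis
    using False assms by (auto simp: mconst_arith(4) simp flip: embed_hom(5) intro!: level_embed)
qed (simp add: scalar_endo_hom level_arith)

lemma level_symbol_deriv: "level l T \<Longrightarrow> level l (symbol_deriv T)"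
  using level_mult [OF _ level_operators(2), of l T] level_mult [OF level_operators(2), of l T]
  unfolding symbol_deriv_def by (intro level_arith) simp_all

lemma sderiv_mult: "sderiv (A * B) = A * sderiv B + sderiv A * B"
  by (simp add: sderiv_def algebra_simps)

lemma sderiv_dx_power: "sderiv (dx ^ n) = scalar_endo (of_nat n) * dx ^ (n - 1)"
proof (induction n)
  case (Suc n)
  have d: "sderiv dx = 1" by (simp add: sderiv_def dx_x)
  have "sderiv (dx ^ Suc n) = scalar_endo (of_nat n) * (dx * dx ^ (n - 1)) + dx ^ n"
    by (simp add: sderiv_mult Suc d scalar_endo_left_commute [of dx])
  also have "scalar_endo (of_nat n) * (dx * dx ^ (n - 1)) = scalar_endo (of_nat n) * dx ^ n"
    by (cases n) (simp_all add: scalar_endo_hom)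
  finally show ?case by (simp add: scalar_endo_hom distrib_right)
qed (simp add: sderiv_def scalar_endo_hom)

lemma sderiv_elementary:
  "sderiv (scalar_endo c * (mat_unit i j * dx ^ n)) = scalar_endo (c * of_nat n) * (mat_unit i j * dx ^ (n - 1))"
proof -
  have "sderiv (mat_unit i j) = 0" by (simp add: sderiv_def operator_commutes)
  moreover have "sderiv (scalar_endo c) = 0" by (simp add: sderiv_def scalar_endo_commute)
  ultimately show ?thesis
    by (simp add: sderiv_mult sderiv_dx_power scalar_endo_left_commute [of "mat_unit i j"] scalar_endo_hom mult.assoc)
qed

lemma symbol_deriv_lincomb: "symbol_deriv (lincomb s f) = lincomb s (\<lambda>p. sderiv (f p))"
  by (simp add: lincomb_def sum_param symbol_deriv_arith(1) symbol_deriv_embed symbol_deriv_const)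

lemma sderiv_y_op:
  "sderiv (y_op p) = (if src p = tgt p then 0 else
     scalar_endo (transvectant_coeff p * of_nat (param_order p - 2)) * (mat_unit (src p) (tgt p) * dx ^ (param_order p - 3)))"
  "sderiv (sderiv (y_op p)) = (if src p = tgt p then 0 else
     scalar_endo (transvectant_coeff p * of_nat (param_order p - 2) * of_nat (param_order p - 3)) * (mat_unit (src p) (tgt p) * dx ^ (param_order p - 4)))"
  by (simp_all add: y_op_def sderiv_elementary diff_diff_add eval_nat_numeral sderiv_def [of 0])

text \<open>The last factor is the inverse of 1 + g: since g raises the weight by at least 2, its
  cube is 0.\<close>

definition poly_rep :: "(param \<Rightarrow> scalar_series) \<Rightarrow> real poly \<Rightarrow> endo_series" where
  "poly_rep s X = (1 + lincomb s g_op) * normal_rep (WW + lincomb s a_op) (lincomb s y_op) X *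
     (1 - lincomb s g_op + lincomb s g_op * lincomb s g_op)"

text \<open>The entry of \<open>y\<close> with rise N in the weight has order N - 2. One derivative
  of the symbol therefore leaves only the entries with N \<ge> 3, and two derivatives only the one
  with N = 4: differentiation gains level.\<close>

lemma level_ops:
  "level 0 (lincomb s a_op)" "level 2 (lincomb s y_op)" "level 2 (lincomb s g_op)"
  "level 3 (symbol_deriv (lincomb s y_op))" "level 4 (symbol_deriv (symbol_deriv (lincomb s y_op)))"
proof -
  show "level 0 (lincomb s a_op)"
  proof (rule level_lincomb)
    show "level 0 (mconst (a_op p))" for p by (simp add: a_op_def level_mat_unit level_arith)
  qed
  show "level 2 (lincomb s y_op)"
  proof (rule level_lincomb)
    fix p
    show "level 2 (mconst (y_op p))"
    proof (cases "src p = tgt p")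
      case False
      then show ?thesis
        unfolding y_op_def if_not_P [OF False] by (intro level_elementary) (cases p; simp)
    qed (simp add: y_op_def level_arith)
  qed
  show "level 2 (lincomb s g_op)"
  proof (rule level_lincomb)
    show "level 2 (mconst (g_op p))" for p
      unfolding g_op_def by (rule level_elementary) (cases p; simp)
  qed
  show "level 3 (symbol_deriv (lincomb s y_op))"
    unfolding symbol_deriv_lincomb
  proof (rule level_lincomb)
    fix p
    show "level 3 (mconst (sderiv (y_op p)))"
    proof (cases "src p = tgt p")
      case False
      then show ?thesis
        unfolding sderiv_y_op(1) if_not_P [OF False] by (intro level_elementary) (cases p; simp)
    qed (simp add: sderiv_y_op level_arith)
  qed
  show "level 4 (symbol_deriv (symbol_deriv (lincomb s y_op)))"
    unfolding symbol_deriv_lincomb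
  proof (rule level_lincomb)
    fix p
    show "level 4 (mconst (sderiv (sderiv (y_op p))))"
    proof (cases "src p = tgt p")
      case False
      then show ?thesis
        unfolding sderiv_y_op(2) if_not_P [OF False] by (intro level_elementary) (cases p; simp)
    qed (simp add: sderiv_y_op(2) level_arith)
  qed
qed

lemma gauge_inverse:
  fixes s defines "g \<equiv> lincomb s g_op"
  shows "(1 + g) * (1 - g + g * g) = 1" "(1 - g + g * g) * (1 + g) = 1"
proof -
  have "level (2 + (2 + 2)) (g * (g * g))" unfolding g_def by (intro level_mult level_ops)
  then have "g * (g * g) = 0" by (rule level_zero) simp
  then show "(1 + g) * (1 - g + g * g) = 1" "(1 - g + g * g) * (1 + g) = 1" by (simp_all add: algebra_simps)
qed

lemma hom_part_lincomb: "hom_part m (lincomb s f) = lincomb (\<lambda>p. hom_part m (s p)) f"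
  by (rule mfps_eqI) (simp add: mcoeff_lincomb scalar_endo_hom)

lemma hom_part_mvar_lincomb: "hom_part m (lincomb mvar f) = (if m = 1 then lincomb mvar f else 0)"
  by (simp add: hom_part_lincomb hom_part_mvar) (simp add: lincomb_def embed_hom)

lemma pdeg_mvar_lincomb: "pdeg 1 (lincomb mvar f)"
  by (simp add: pdeg_def hom_part_mvar_lincomb)

lemma pdeg_symbol_deriv: "pdeg n T \<Longrightarrow> pdeg n (symbol_deriv T)"
  using pdeg_mult [of n T 0 XX] pdeg_mult [of 0 XX n T] unfolding symbol_deriv_def by (intro pdeg_arith) simp_all

text \<open>Terms of high degree in the parameters also raise the weight a lot. \<open>N3\<close>
  (degree 2) and \<open>N4\<close> (degree 3) have levels 3 and 4, and \<open>g\<close> has level 2,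
  so the gauge transformation leaves them alone; it acts only on \<open>N0\<close> and
  \<open>N2\<close>, which have degree 1.\<close>

lemma pdeg_poly_rep: "pdeg 3 (poly_rep mvar X)"
proof -
  define g where "g = lincomb mvar g_op"
  define a where "a = lincomb mvar a_op"
  define y where "y = lincomb mvar y_op"
  define N0 where "N0 = field_mult X * DD + field_mult (pderiv X) * (WW + a)"
  define N2 where "N2 = field_mult (smult (1/6) ((pderiv ^^ 3) X)) * y"
  define N3 where "N3 = field_mult (smult (1/24) ((pderiv ^^ 4) X)) * next_symbol (WW + a) y"
  define N4 where "N4 = field_mult (smult (1/240) ((pderiv ^^ 5) X)) * next_symbol (WW + a) (next_symbol (WW + a) y)"
  have pd: "pdeg 1 g" "pdeg 1 a" "pdeg 1 y" unfolding g_def a_def y_def by (rule pdeg_mvar_lincomb)+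
  have pA: "pdeg 1 (WW + a)" by (intro pdeg_arith pd) simp
  have pf: "pdeg 0 (field_mult Z)" for Z by (simp add: field_mult_def)
  have pfm: "pdeg n T \<Longrightarrow> pdeg n (field_mult Z * T)" for n Z T using pdeg_mult [OF pf] by fastforce
  have pnext: "pdeg (Suc n) (next_symbol (WW + a) f)" if "pdeg n f" for n f
  proof -
    note f' = pdeg_symbol_deriv [OF that]
    have "pdeg n (symbol_deriv (symbol_deriv f) * DD)" 
      using pdeg_mult [OF pdeg_symbol_deriv [OF f'], of 0 DD] by simp
    then show ?thesis
      unfolding next_symbol_def using pdeg_mult [OF f' pA]
      by (intro pdeg_arith) (auto intro: pdeg_mono)
  qed
  have p0: "pdeg 1 N0" unfolding N0_def by (intro pdeg_arith pfm pA) simp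
  have p2: "pdeg 1 N2" unfolding N2_def by (intro pfm pd)
  have p3: "pdeg 2 N3" unfolding N3_def using pnext [OF pd(3)] by (intro pfm) (simp add: numeral_2_eq_2)
  have p4: "pdeg 3 N4" unfolding N4_def using pnext [OF pnext [OF pd(3)]] by (intro pfm) (simp add: numeral_3_eq_3 numeral_2_eq_2)
  have lA: "level 0 (WW + a)" unfolding a_def by (intro level_arith level_operators level_ops)
  have ad: "symbol_deriv a = 0" by (simp add: a_def is_diag_commutes [OF is_diag_lincomb])
  have lfm: "level n T \<Longrightarrow> level n (field_mult Z * T)" for n Z T using level_mult [OF level_operators(4)] by fastforce
  have lr: "level n T \<Longrightarrow> level n (T * DD)" "level n T \<Longrightarrow> level n (T * (WW + a))" for n T
    using level_mult [OF _ level_operators(1)] level_mult [OF _ lA] by fastforce+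
  have ly: "level 2 y" "level 3 (symbol_deriv y)" "level 4 (symbol_deriv (symbol_deriv y))" "level 2 g"
    unfolding y_def g_def by (rule level_ops)+
  have l3: "level 3 (next_symbol (WW + a) y)"
    unfolding next_symbol_def by (intro level_arith lr ly level_mono [OF ly(3)]) simp
  have "symbol_deriv (next_symbol (WW + a) y) = - (symbol_deriv (symbol_deriv (symbol_deriv y)) * DD + symbol_deriv (symbol_deriv y)
     + (symbol_deriv (symbol_deriv y) * (WW + a) + symbol_deriv (symbol_deriv y) * (WW + a)))"
    by (simp add: next_symbol_def symbol_deriv_arith ad algebra_simps)
  then have l3': "level 4 (symbol_deriv (next_symbol (WW + a) y))"
    by (simp only:) (intro level_arith lr ly level_symbol_deriv)
  have l4: "level 4 (next_symbol (WW + a) (next_symbol (WW + a) y))"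
    by (subst next_symbol_def) (intro level_arith lr l3' level_symbol_deriv)
  have l: "level 0 N0" "level 2 N2" "level 3 N3" "level 4 N4"
    unfolding N0_def N2_def N3_def N4_def by (intro level_arith lfm lr level_operators lA ly l3 l4)+
  have z: "S * T = 0" if "level m S" "level n T" "m + n \<ge> 5" for m n S T
    using level_zero [OF level_mult [OF that(1,2)] that(3)] .
  have gg: "level 4 (g * g)" using level_mult [OF ly(4) ly(4)] by simp
  have zs: "g * N3 = 0" "g * N4 = 0" "N3 * g = 0" "N4 * g = 0"
    using z [OF ly(4) l(3)] z [OF ly(4) l(4)] z [OF l(3) ly(4)] z [OF l(4) ly(4)] by simp_all
  have zg: "N2 * (g * g) = 0" "g * (N2 * g) = 0" "g * (N0 * (g * g)) = 0"
    using z [OF l(2) gg] z [OF ly(4) level_mult [OF l(2) ly(4)]] z [OF ly(4) level_mult [OF l(1) gg]] by simp_all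
  have zs': "g * (N3 * T) = 0" "g * (N4 * T) = 0" "N3 * (g * T) = 0" "N4 * (g * T) = 0" for T
    by (simp_all add: mult.assoc [symmetric] zs)
  have N: "normal_rep (WW + a) y X = N0 + N2 + N3 + N4"
    by (simp add: normal_rep_def N0_def N2_def N3_def N4_def algebra_simps)
  have "poly_rep mvar X = (1 + g) * (N0 + N2 + N3 + N4) * (1 - g + g * g)"
    unfolding poly_rep_def by (fold g_def a_def y_def) (simp only: N)
  \<comment> \<open>All words of level 5 or more are dropped. Of the words containing
    \<open>g\<close>, the longest that survive are g N0 g and N0 g g, of degree 3.\<close>
  also have "\<dots> = N0 + N2 + N3 + N4 + (g * N0 + g * N2 - N0 * g - N2 * g) + (N0 * (g * g) - g * (N0 * g))"
    by (simp add: algebra_simps zs zs' zg)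
  also have "pdeg 3 \<dots>"
  proof -
    have 2: "pdeg 3 (S * T)" if "pdeg 1 S" "pdeg 1 T" for S T
      by (rule pdeg_mono [OF pdeg_mult [OF that]]) simp
    have 3: "pdeg 3 (S * (T * V))" if "pdeg 1 S" "pdeg 1 T" "pdeg 1 V" for S T V
      using pdeg_mult [OF that(1) pdeg_mult [OF that(2,3)]] by (simp add: numeral_3_eq_3)
    show ?thesis
      by (intro pdeg_arith(1,2) 2 [OF pd(1) p0] 2 [OF pd(1) p2] 2 [OF p0 pd(1)] 2 [OF p2 pd(1)]
        3 [OF p0 pd(1) pd(1)] 3 [OF pd(1) p0 pd(1)] p4 pdeg_mono [OF p0] pdeg_mono [OF p2] pdeg_mono [OF p3]) simp_all
  qed
  finally show ?thesis .
qed

section \<open>The linear part of the representative and the prescribed cocycles\<close>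

definition next_endo :: "endo \<Rightarrow> endo" where
  "next_endo f = - (sderiv (sderiv f) * dx + (sderiv f * weights + sderiv f * weights))"

text \<open>The part of \<open>normal_rep\<close> that is linear in the parameter p: in the linear
  part, \<open>next_symbol\<close> is taken at the unshifted weights.\<close>

definition transvectant :: "real poly \<Rightarrow> param \<Rightarrow> endo" where
  "transvectant X p = mult_by (Dx 1 X) * a_op p + scalar_endo (1/6) * (mult_by (Dx 3 X) * y_op p) +
     scalar_endo (1/24) * (mult_by (Dx 4 X) * next_endo (y_op p)) +
     scalar_endo (1/240) * (mult_by (Dx 5 X) * next_endo (next_endo (y_op p)))"

lemma lincomb_arith:
  "lincomb s f + lincomb s g = lincomb s (\<lambda>p. f p + g p)" "- lincomb s f = lincomb s (\<lambda>p. - f p)"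
  "lincomb s f - lincomb s g = lincomb s (\<lambda>p. f p - g p)"
  "lincomb s f * mconst A = lincomb s (\<lambda>p. f p * A)" "mconst A * lincomb s f = lincomb s (\<lambda>p. A * f p)"
  by (rule mfps_eqI; simp add: mcoeff_lincomb sum.distrib distrib_left right_diff_distrib sum_subtractf sum_negf
      sum_distrib_left sum_distrib_right scalar_endo_left_commute [of A] mult.assoc)+

lemma next_symbol_lincomb: "next_symbol WW (lincomb s f) = lincomb s (\<lambda>p. next_endo (f p))"
  by (simp add: next_symbol_def next_endo_def symbol_deriv_lincomb lincomb_arith)

lemma poly_eq_pointwise: "(\<And>z. poly p z = poly q z) \<Longrightarrow> p = (q :: complex poly)"
  using poly_eq_poly_eq_iff by blast

lemma next_endo_elementary:
  "next_endo (scalar_endo c * (mat_unit i j * dx ^ n)) =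
     scalar_endo (- c * of_nat n * (of_nat (n - 1) + 2 * of_nat (wt i))) * (mat_unit i j * dx ^ (n - 1))"
proof -
  have wu: "mat_unit i j * (dx ^ n * weights) = scalar_endo (of_nat (wt i)) * (mat_unit i j * dx ^ n)" for n
  proof (rule endo_eq_nth)
    fix u k
    have "(pderiv ^^ n) (smult c p) = smult c ((pderiv ^^ n) p)" for c :: complex and p by (rule pderiv_funpow_arith)
    then show "app (mat_unit i j * (dx ^ n * weights)) u $ k = app (scalar_endo (of_nat (wt i)) * (mat_unit i j * dx ^ n)) u $ k"
      by simp
  qed
  have d: "scalar_endo (c * of_nat n * of_nat (n - 1)) * (mat_unit i j * dx ^ (n - 1 - 1)) * dx =
    scalar_endo (c * of_nat n * of_nat (n - 1)) * (mat_unit i j * dx ^ (n - 1))"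
  proof (cases "n - 1")
    case (Suc m)
    then show ?thesis by (simp add: mult.assoc power_commutes)
  qed (simp add: scalar_endo_hom)
  have "next_endo (scalar_endo c * (mat_unit i j * dx ^ n)) =
     - (scalar_endo (c * of_nat n * of_nat (n - 1)) * (mat_unit i j * dx ^ (n - 1)) +
       (scalar_endo (c * of_nat n * of_nat (wt i)) * (mat_unit i j * dx ^ (n - 1)) +
        scalar_endo (c * of_nat n * of_nat (wt i)) * (mat_unit i j * dx ^ (n - 1))))"
    unfolding next_endo_def sderiv_elementary d by (simp only: mult.assoc wu) (simp only: scalar_endo_hom mult.assoc)
  also have "\<dots> = scalar_endo (- (c * of_nat n * of_nat (n - 1) + (c * of_nat n * of_nat (wt i) + c * of_nat n * of_nat (wt i)))) *
     (mat_unit i j * dx ^ (n - 1))"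
    by (rule endo_eq_nth, rule poly_eq_pointwise) (simp add: algebra_simps)
  finally show ?thesis by (simp add: algebra_simps)
qed

lemma next_endo_zero: "next_endo 0 = 0"
  by (simp add: next_endo_def sderiv_def)

lemma next_endo_y_op:
  "next_endo (y_op p) = (if src p = tgt p then 0 else
     scalar_endo (- transvectant_coeff p * of_nat (param_order p - 2) * (of_nat (param_order p - 3) + 2 * of_nat (wt (src p)))) *
     (mat_unit (src p) (tgt p) * dx ^ (param_order p - 3)))"
  "next_endo (next_endo (y_op p)) = (if src p = tgt p then 0 else
     scalar_endo (transvectant_coeff p * of_nat (param_order p - 2) * (of_nat (param_order p - 3) + 2 * of_nat (wt (src p))) *
       of_nat (param_order p - 3) * (of_nat (param_order p - 4) + 2 * of_nat (wt (src p)))) *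
     (mat_unit (src p) (tgt p) * dx ^ (param_order p - 4)))"
  by (simp_all add: y_op_def next_endo_elementary next_endo_zero diff_diff_add eval_nat_numeral)

text \<open>This identity determines the two tables of constants: the coboundary of
  \<open>g_op p\<close> is the whole difference between the cocycle and its transvectant form, so
  conjugation by 1 + g restores the prescribed first order term. Evaluating at a point turns each of
  the eleven cases into an identity of complex numbers.\<close>

lemma cocycle_transvectant:
  "cocycle_symbols (src p) (tgt p) X = transvectant X p + (g_op p * lie_symbols X - lie_symbols X * g_op p)"
proof (rule endo_eq_nth, rule poly_eq_pointwise)
  fix u j z
  show "poly (app (cocycle_symbols (src p) (tgt p) X) u $ j) z =
    poly (app (transvectant X p + (g_op p * lie_symbols X - lie_symbols X * g_op p)) u $ j) z"
    unfolding transvectant_def unfolding next_endo_y_op(2) unfolding next_endo_y_op(1)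
    by (cases p; cases "j = tgt p") 
      (simp_all add: cocycle_symbols_eq a_op_def g_op_def y_op_def lie_symbols_eq
        pderiv_mult pderiv_minus pderiv_add pderiv_smult Dx_pderiv eval_nat_numeral algebra_simps)
qed

lemma hom_part_mconst_mult: "hom_part m (mconst A * T) = mconst A * (hom_part m T :: endo_series)"
  "hom_part m (T * mconst A) = hom_part m T * (mconst A :: endo_series)"
  by (rule mfps_eqI; simp)+

lemma hom_part_next_symbol:
  assumes "hom_part 0 a = 0" "hom_part 0 f = 0"
  shows "hom_part 0 (next_symbol (WW + a) f) = 0"
    "hom_part 1 (next_symbol (WW + a) f) = next_symbol WW (hom_part 1 f)"
  unfolding next_symbol_def
  by (simp_all add: hom_part_mconst_mult hom_part_zero_mult hom_part_one_mult hom_part_symbol_deriv assms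
      symbol_deriv_arith(5) hom_part_mconst del: One_nat_def)

lemma field_mult_Dx: "field_mult (smult c ((pderiv ^^ n) X)) = mconst (scalar_endo (of_real c) * mult_by (Dx n X))"
  by (simp add: field_mult_def map_poly_of_real_arith mult_by_hom Dx_def)

lemma hom_part_poly_rep:
  "hom_part 0 (poly_rep mvar X) = mconst (lie_symbols X)"
  "hom_part 1 (poly_rep mvar X) = infinitesimal X"
proof -
  define g a y where "g = lincomb mvar g_op" and "a = lincomb mvar a_op" and "y = lincomb mvar y_op"
  have h0: "hom_part 0 g = 0" "hom_part 0 a = 0" "hom_part 0 y = 0"
    and h1: "hom_part 1 g = g" "hom_part 1 a = a" "hom_part 1 y = y"
    by (simp_all add: g_def a_def y_def hom_part_mvar_lincomb)
  note nx = hom_part_next_symbol [OF h0(2) h0(3)] hom_part_next_symbol [OF h0(2) hom_part_next_symbol(1) [OF h0(2) h0(3)]]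
  have f: "field_mult X = mconst (mult_by (Dx 0 X))" "field_mult (pderiv X) = mconst (mult_by (Dx 1 X))"
    by (simp_all add: field_mult_def Dx_def)
  define N where "N = normal_rep (WW + a) y X"
  have N0: "hom_part 0 N = mconst (lie_symbols X)"
    unfolding N_def normal_rep_def f field_mult_Dx
    by (simp add: hom_part_mconst_mult nx h0 hom_part_mconst) (simp add: lie_symbols_eq mconst_arith)
  have "hom_part 1 N = mconst (mult_by (Dx 1 X)) * a + mconst (scalar_endo (1/6) * mult_by (Dx 3 X)) * y +
     mconst (scalar_endo (1/24) * mult_by (Dx 4 X)) * next_symbol WW y +
     mconst (scalar_endo (1/240) * mult_by (Dx 5 X)) * next_symbol WW (next_symbol WW y)"
    unfolding N_def normal_rep_def f field_mult_Dx
    by (simp add: hom_part_mconst_mult nx h1 hom_part_mconst del: One_nat_def)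
  also have "\<dots> = lincomb mvar (transvectant X)"
    unfolding a_def y_def next_symbol_lincomb lincomb_arith
    by (simp add: transvectant_def [abs_def] mult.assoc)
  finally have N1: "hom_part 1 N = lincomb mvar (transvectant X)" .
  have P: "poly_rep mvar X = (1 + g) * N * (1 - g + g * g)"
    by (simp add: poly_rep_def N_def g_def a_def y_def)
  show "hom_part 0 (poly_rep mvar X) = mconst (lie_symbols X)"
    by (simp add: P hom_part_zero_mult h0 N0 hom_part_one)
  have "hom_part 1 (poly_rep mvar X) = lincomb mvar (transvectant X) + (g * mconst (lie_symbols X) - mconst (lie_symbols X) * g)"
    unfolding P hom_part_one_mult hom_part_zero_mult
    by (simp add: hom_part_zero_mult hom_part_one_mult h0 h1 N0 N1 hom_part_one del: One_nat_def)
  also have "\<dots> = infinitesimal X"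
    unfolding g_def infinitesimal_eq cocycle_transvectant lincomb_arith ..
  finally show "hom_part 1 (poly_rep mvar X) = infinitesimal X" .
qed

lemma poly_rep_arith:
  "poly_rep s (X + Y) = poly_rep s X + poly_rep s Y"
  "poly_rep s (smult c X) = mconst (scalar_endo (of_real c)) * poly_rep s X"
proof -
  show "poly_rep s (X + Y) = poly_rep s X + poly_rep s Y"
    by (simp add: poly_rep_def normal_rep_arith distrib_left distrib_right)
  have l': "S * (mconst (scalar_endo c) * T) = mconst (scalar_endo c) * (S * T)" for S T :: endo_series and c
    using embed_left_commute [of S "mconst c" T] by (simp only: embed_hom(5))
  show "poly_rep s (smult c X) = mconst (scalar_endo (of_real c)) * poly_rep s X"
    unfolding poly_rep_def normal_rep_arith mult.assoc by (rule l')
qed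

section \<open>Compatibility of the representative with substitution\<close>

context
  fixes \<phi> :: "param \<Rightarrow> scalar_series"
  assumes \<phi>: "\<And>p. hom_part 0 (\<phi> p) = 0"
begin

lemma subst_endo_lincomb: "subst_endo \<phi> (lincomb mvar f) = lincomb \<phi> f"
  by (simp add: lincomb_def subst_endo_sum [OF \<phi>] subst_endo_hom [OF \<phi>] subst_endo_embed [OF \<phi>] subst_scalar_mvar [OF \<phi>])

lemma subst_endo_symbol_deriv: "subst_endo \<phi> (symbol_deriv T) = symbol_deriv (subst_endo \<phi> T)"
  by (simp add: symbol_deriv_def subst_diff [OF \<phi>] subst_endo_hom [OF \<phi>])

lemma subst_endo_one: "subst_endo \<phi> 1 = 1"
  using subst_endo_hom(3) [OF \<phi>, where A = 1] by simp

lemma subst_endo_next_symbol: "subst_endo \<phi> (next_symbol A f) = next_symbol (subst_endo \<phi> A) (subst_endo \<phi> f)"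
  by (simp add: next_symbol_def subst_endo_uminus [OF \<phi>] subst_endo_hom [OF \<phi>] subst_diff [OF \<phi>]
      subst_endo_symbol_deriv)

lemma subst_endo_poly_rep: "subst_endo \<phi> (poly_rep mvar X) = poly_rep \<phi> X"
  by (simp add: poly_rep_def normal_rep_def subst_endo_hom [OF \<phi>] subst_diff [OF \<phi>] subst_endo_one subst_endo_lincomb
      subst_endo_next_symbol field_mult_def)

end

section \<open>Differential operators and relations between the new parameters\<close>

text \<open>Coefficients are padded by zeros, so that operators of different orders can be written
  with one common bound.\<close>

lemma is_diff_opE:
  assumes "is_diff_op A"
  obtains N p where "\<forall>M\<ge>N. \<forall>u j. app A u $ j = (\<Sum>i\<in>UNIV. \<Sum>k\<le>M. p i j k * (pderiv ^^ k) (u $ i))"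
proof -
  obtain N p where A: "\<And>u j. app A u $ j = (\<Sum>i\<in>UNIV. \<Sum>k\<le>N. p i j k * (pderiv ^^ k) (u $ i))"
    using assms unfolding is_diff_op_def by blast
  define q where "q i j k = (if k \<le> N then p i j k else 0)" for i j k
  have "app A u $ j = (\<Sum>i\<in>UNIV. \<Sum>k\<le>M. q i j k * (pderiv ^^ k) (u $ i))" if "M \<ge> N" for M u j
    unfolding A
  proof (rule sum.cong [OF refl])
    fix i
    show "(\<Sum>k\<le>N. p i j k * (pderiv ^^ k) (u $ i)) = (\<Sum>k\<le>M. q i j k * (pderiv ^^ k) (u $ i))"
      using that by (intro sum.mono_neutral_cong_left) (auto simp: q_def)
  qed
  then show ?thesis by (intro that [of N q]) blast
qed

lemma is_diff_opI:
  assumes "\<And>u j. app A u $ j = (\<Sum>i\<in>UNIV. \<Sum>k\<le>N. p i j k * (pderiv ^^ k) (u $ i))"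
  shows "is_diff_op A"
  unfolding is_diff_op_def using assms by blast

lemma is_diff_op_add:
  assumes "is_diff_op A" "is_diff_op B" shows "is_diff_op (A + B)"
proof -
  obtain N p where A: "\<forall>M\<ge>N. \<forall>u j. app A u $ j = (\<Sum>i\<in>UNIV. \<Sum>k\<le>M. p i j k * (pderiv ^^ k) (u $ i))"
    by (rule is_diff_opE [OF assms(1)])
  obtain N' p' where B: "\<forall>M\<ge>N'. \<forall>u j. app B u $ j = (\<Sum>i\<in>UNIV. \<Sum>k\<le>M. p' i j k * (pderiv ^^ k) (u $ i))"
    by (rule is_diff_opE [OF assms(2)])
  have "app (A + B) u $ j = (\<Sum>i\<in>UNIV. \<Sum>k\<le>max N N'. (p i j k + p' i j k) * (pderiv ^^ k) (u $ i))" for u j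
    using A [rule_format, of "max N N'"] B [rule_format, of "max N N'"] by (simp add: distrib_right sum.distrib)
  then show ?thesis by (rule is_diff_opI)
qed

lemma is_diff_op_one: "is_diff_op 1"
proof (rule is_diff_opI [where N = 0 and p = "\<lambda>i j k. if i = j then 1 else 0"])
  fix u j
  show "app 1 u $ j = (\<Sum>i\<in>UNIV. \<Sum>k\<le>0. (if i = j then 1 else 0) * (pderiv ^^ k) (u $ i))"
    by (simp add: if_distrib [of "\<lambda>c. c * _"] cong: if_cong)
qed

lemma is_diff_op_zero: "is_diff_op 0"
  by (rule is_diff_opI [where N = 0 and p = "\<lambda>i j k. 0"]) simp

lemma is_diff_op_sum: "(\<And>i. i \<in> S \<Longrightarrow> is_diff_op (f i)) \<Longrightarrow> is_diff_op (\<Sum>i\<in>S. f i)"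
  by (induction S rule: infinite_finite_induct) (auto intro: is_diff_op_zero is_diff_op_add)

lemma is_diff_op_left:
  assumes "is_diff_op A"
  shows "is_diff_op (mult_by q * A)" "is_diff_op (mat_unit a b * A)" "is_diff_op (dx * A)"
proof -
  obtain N p where A: "\<forall>M\<ge>N. \<forall>u j. app A u $ j = (\<Sum>i\<in>UNIV. \<Sum>k\<le>M. p i j k * (pderiv ^^ k) (u $ i))"
    by (rule is_diff_opE [OF assms(1)])
  note AN = A [rule_format, OF order_refl]
  show "is_diff_op (mult_by q * A)"
    by (rule is_diff_opI [where N = N and p = "\<lambda>i j k. q * p i j k"]) (simp add: AN sum_distrib_left mult.assoc)
  show "is_diff_op (mat_unit a b * A)"
    by (rule is_diff_opI [where N = N and p = "\<lambda>i j k. if j = b then p i a k else 0"]) (simp add: AN)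
  show "is_diff_op (dx * A)"
  proof (rule is_diff_opI)
    fix u :: symbols and j
    let ?D = "\<lambda>i k. (pderiv ^^ k) (u $ i)"
    \<comment> \<open>By the product rule, the coefficient of \<partial>^k becomes p_k' + p_(k-1);
      the sum is split accordingly and the second half shifted by one.\<close>
    have "(\<Sum>k\<le>N. pderiv (p i j k * ?D i k)) =
       (\<Sum>k\<le>Suc N. (if k \<le> N then pderiv (p i j k) * ?D i k else 0)) + (\<Sum>k\<le>Suc N. (if k = 0 then 0 else p i j (k - 1) * ?D i k))" for i
    proof -
      have "(\<Sum>k\<le>Suc N. (if k = 0 then 0 else p i j (k - 1) * ?D i k)) = (\<Sum>k\<le>N. p i j k * ?D i (Suc k))"
        by (subst sum.atMost_Suc_shift) simp
      then show ?thesis by (simp add: pderiv_mult sum.distrib add.commute mult.commute)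
    qed
    also have "\<And>i. \<dots> i = (\<Sum>k\<le>Suc N. ((if k \<le> N then pderiv (p i j k) else 0) + (if k = 0 then 0 else p i j (k - 1))) * ?D i k)"
      unfolding sum.distrib [symmetric] by (intro sum.cong) (auto simp: distrib_right)
    finally show "app (dx * A) u $ j = (\<Sum>i\<in>UNIV. \<Sum>k\<le>Suc N. ((if k \<le> N then pderiv (p i j k) else 0) +
        (if k = 0 then 0 else p i j (k - 1))) * (pderiv ^^ k) (u $ i))"
      by (simp only: app_simps app_operators AN pderiv_sum)
  qed
qed

text \<open>The left factor is decomposed into multiplications, matrix units and powers of
  \<partial>, so that only left multiplication by these has to be understood.\<close>

lemma is_diff_op_mult:
  assumes "is_diff_op A" "is_diff_op B" shows "is_diff_op (A * B)"
proof -
  obtain N p where A: "\<forall>M\<ge>N. \<forall>u j. app A u $ j = (\<Sum>i\<in>UNIV. \<Sum>k\<le>M. p i j k * (pderiv ^^ k) (u $ i))"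
    by (rule is_diff_opE [OF assms(1)])
  have pw: "is_diff_op (dx ^ k * B)" for k
    by (induction k) (use assms(2) in \<open>auto simp: mult.assoc intro: is_diff_op_left\<close>)
  have "A = (\<Sum>j\<in>UNIV. \<Sum>i\<in>UNIV. \<Sum>k\<le>N. mult_by (p i j k) * (mat_unit i j * dx ^ k))"
  proof (rule endo_eq_nth)
    fix u l
    have "(\<Sum>j\<in>UNIV. \<Sum>i\<in>UNIV. \<Sum>k\<le>N. app (mult_by (p i j k) * (mat_unit i j * dx ^ k)) u) $ l =
       (\<Sum>j\<in>UNIV. \<Sum>i\<in>UNIV. \<Sum>k\<le>N. if l = j then p i l k * (pderiv ^^ k) (u $ i) else 0)"
      by (auto intro!: sum.cong)
    also have "\<dots> = (\<Sum>j\<in>UNIV. if l = j then \<Sum>i\<in>UNIV. \<Sum>k\<le>N. p i l k * (pderiv ^^ k) (u $ i) else 0)"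
      by (intro sum.cong) auto
    also have "\<dots> = app A u $ l" by (simp add: A [rule_format, OF order_refl])
    finally show "app A u $ l = app (\<Sum>j\<in>UNIV. \<Sum>i\<in>UNIV. \<Sum>k\<le>N. mult_by (p i j k) * (mat_unit i j * dx ^ k)) u $ l"
      by (simp add: app_sum_left)
  qed
  then have "A * B = (\<Sum>j\<in>UNIV. \<Sum>i\<in>UNIV. \<Sum>k\<le>N. mult_by (p i j k) * (mat_unit i j * (dx ^ k * B)))"
    by (simp add: sum_distrib_right mult.assoc)
  also have "is_diff_op \<dots>"
    by (intro is_diff_op_sum is_diff_op_left pw)
  finally show ?thesis .
qed

lemma is_diff_op_operators:
  "is_diff_op dx" "is_diff_op (mult_by q)" "is_diff_op (mat_unit a b)" "is_diff_op (scalar_endo c)"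
  "is_diff_op (dx ^ n)" "is_diff_op (diag d)"
proof -
  show d: "is_diff_op dx" "is_diff_op (mult_by q)" "is_diff_op (mat_unit a b)" for q a b
    using is_diff_op_left [OF is_diff_op_one] by simp_all
  have "scalar_endo c = mult_by [:c:]" by (rule endo_eq_nth) simp
  then show "is_diff_op (scalar_endo c)" by (simp add: d)
  show "is_diff_op (dx ^ n)" by (induction n) (auto intro: is_diff_op_one is_diff_op_mult d)
  have "diag d = (\<Sum>i\<in>UNIV. mult_by [:d i:] * mat_unit i i)"
  proof (rule endo_eq_nth)
    fix u i show "app (diag d) u $ i = app (\<Sum>i\<in>UNIV. mult_by [:d i:] * mat_unit i i) u $ i"
      by (cases i) (simp_all add: sum_weight)
  qed
  then show "is_diff_op (diag d)" by (simp only:) (intro is_diff_op_sum is_diff_op_mult d)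
qed

definition diff_op_series :: "endo_series \<Rightarrow> bool" where
  "diff_op_series T \<longleftrightarrow> (\<forall>a. is_diff_op (mcoeff T a))"

lemma diff_op_series_intros:
  "is_diff_op A \<Longrightarrow> diff_op_series (mconst A)" "diff_op_series (embed f)" "diff_op_series 1"
  "diff_op_series S \<Longrightarrow> diff_op_series T \<Longrightarrow> diff_op_series (S + T)"
  "diff_op_series S \<Longrightarrow> diff_op_series T \<Longrightarrow> diff_op_series (S * T)"
  by (auto simp: diff_op_series_def mcoeff_mconst mcoeff_one mcoeff_mult is_diff_op_zero is_diff_op_one is_diff_op_add
      is_diff_op_operators intro!: is_diff_op_sum is_diff_op_mult)

lemma diff_op_series_uminus: "diff_op_series T \<Longrightarrow> diff_op_series (- T)"
  using diff_op_series_intros(5) [OF diff_op_series_intros(2), of T "- 1"]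
  by (simp add: embed_uminus embed_hom)

lemma diff_op_series_diff: "diff_op_series S \<Longrightarrow> diff_op_series T \<Longrightarrow> diff_op_series (S - T)"
  using diff_op_series_intros(4) [OF _ diff_op_series_uminus] by fastforce

lemma diff_op_series_lincomb: "(\<And>p. is_diff_op (f p)) \<Longrightarrow> diff_op_series (lincomb s f)"
  by (simp add: diff_op_series_def mcoeff_lincomb is_diff_op_sum is_diff_op_mult is_diff_op_operators)

lemma diff_op_series_poly_rep: "diff_op_series (poly_rep s X)"
proof -
  have op: "is_diff_op (a_op p)" "is_diff_op (y_op p)" "is_diff_op (g_op p)" for p
    by (auto simp: a_op_def y_op_def g_op_def is_diff_op_zero is_diff_op_operators intro!: is_diff_op_mult)
  note i = diff_op_series_intros diff_op_series_diff diff_op_series_uminus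
  have c: "diff_op_series DD" "diff_op_series XX" "diff_op_series WW" "diff_op_series (field_mult Z)" for Z
    by (simp_all add: field_mult_def diff_op_series_intros is_diff_op_operators)
  have sd: "diff_op_series (symbol_deriv T)" if "diff_op_series T" for T
    unfolding symbol_deriv_def by (intro i c that)
  have nx: "diff_op_series (next_symbol A T)" if "diff_op_series A" "diff_op_series T" for A T
    unfolding next_symbol_def by (intro i c sd that)
  show ?thesis
    unfolding poly_rep_def normal_rep_def
    by (intro diff_op_series_intros(3-5) diff_op_series_diff c nx diff_op_series_lincomb op)
qed

text \<open>Expanding the finitely many coefficients in a basis of \<open>End(\<S>)\<close> reduces membership in the ideal of
  relations to scalar coefficients.\<close>

lemma generated_by_relations_between:
  assumes R: "is_ideal R" and \<phi>: "\<And>p. hom_part 0 (\<phi> p) = 0" and T: "pdeg n T"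
    and mem: "subst_endo \<phi> T \<in> generated_by R"
  shows "T \<in> generated_by (relations_between \<phi> R)"
proof -
  interpret endo_space: vector_space "\<lambda>c A. scalar_endo c * A"
    by unfold_locales (simp_all add: distrib_left distrib_right scalar_endo_hom mult.assoc)
  define B where "B = endo_space.extend_basis {}"
  have B: "endo_space.independent B" "endo_space.span B = UNIV"
    unfolding B_def using endo_space.independent_extend_basis [OF endo_space.independent_empty]
      endo_space.span_extend_basis [OF endo_space.independent_empty] by auto
  define cf where "cf b A = endo_space.representation B A b" for b A
  have fn: "endo_functional (cf b)" for b
    using B by (simp add: endo_functional_def cf_def endo_space.representation_add endo_space.representation_scale)
  define F where "F = (\<Union>a \<in> {a. mdeg a \<le> n}. {b. cf b (mcoeff T a) \<noteq> 0})"
  have fin: "finite F"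
    unfolding F_def cf_def by (intro finite_UN_I finite_mdeg_le endo_space.finite_representation)
  have "T = (\<Sum>b\<in>F. embed (lift (cf b) T) * mconst b)"
  proof (rule mfps_eqI)
    fix a
    have "mcoeff T a = (\<Sum>b\<in>F. scalar_endo (cf b (mcoeff T a)) * b)"
    proof (cases "mdeg a \<le> n")
      case True
      then have "{b. endo_space.representation B (mcoeff T a) b \<noteq> 0} \<subseteq> F" by (auto simp: F_def cf_def)
      then have "(\<Sum>b\<in>F. scalar_endo (cf b (mcoeff T a)) * b) =
         (\<Sum>b | endo_space.representation B (mcoeff T a) b \<noteq> 0. scalar_endo (endo_space.representation B (mcoeff T a) b) * b)"
        unfolding cf_def by (intro sum.mono_neutral_right fin) (auto simp: scalar_endo_hom)
      also have "\<dots> = mcoeff T a"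
        by (rule endo_space.sum_nonzero_representation_eq) (use B in auto)
      finally show ?thesis by simp
    next
      case False
      then have "hom_part (mdeg a) T = 0" using T by (simp add: pdeg_def)
      then have "mcoeff (hom_part (mdeg a) T) a = 0" by simp
      then have "mcoeff T a = 0" by simp
      then show ?thesis by (simp add: endo_functionalD(3) [OF fn] scalar_endo_hom)
    qed
    then show "mcoeff T a = mcoeff (\<Sum>b\<in>F. embed (lift (cf b) T) * mconst b) a"
      by (simp add: mcoeff_sum)
  qed
  also have "\<dots> \<in> generated_by (relations_between \<phi> R)"
  proof -
    have r: "lift (cf b) T \<in> relations_between \<phi> R" for b
    proof -
      \<comment> \<open>Substitution acts on endomorphisms through complex scalars only, so it
        commutes with taking a coordinate.\<close>
      have "lift (cf b) (subst_endo \<phi> T) = subst_scalar \<phi> (lift (cf b) T)"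
        by (rule mfps_eqI) (simp add: subst_endo_def subst_scalar_def endo_functionalD [OF fn])
      with generated_by_functional [OF R fn mem, of b] show ?thesis by (simp add: relations_between_def)
    qed
    from fin show ?thesis
      by induction (auto intro: generated_by_zero generated_by_add generated_by_embed r)
  qed
  finally show ?thesis .
qed

theorem proposition5p3:
  fixes R :: "scalar_series set" and \<rho> :: "real poly \<Rightarrow> endo_series"
  assumes "formal_deformation R \<rho>"
  shows "\<exists>\<phi> \<rho>'. parameter_system \<phi> \<and>
           formal_deformation (relations_between \<phi> R) \<rho>' \<and>
           polynomial_of_degree_le 3 \<rho>' \<and>
           equivalent_deformations R \<rho> (\<lambda>X. subst_endo \<phi> (\<rho>' X))"
proof -
  have rep: "is_rep R \<rho>" and inf: "\<And>X. hom_part 1 (\<rho> X) = infinitesimal X" and R: "is_ideal R"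
    using assms by (simp_all add: formal_deformation_def is_rep_def)
  obtain P Q \<phi> where PQ: "hom_part 0 P = 1" "P * Q = 1" "Q * P = 1"
    and \<phi>: "\<And>p. hom_part 0 (\<phi> p) = 0" "\<And>p. hom_part 1 (\<phi> p) = mvar p"
    and N: "\<And>X. cong_base R (P * \<rho> X * Q) (normal_rep (WW + lincomb \<phi> a_op) (lincomb \<phi> y_op) X)"
    using deformation_normal_form [OF rep inf] by blast
  define g where "g = lincomb \<phi> g_op"
  define P' where "P' = (1 + g) * P"
  define Q' where "Q' = Q * (1 - g + g * g)"
  note gi = gauge_inverse [of \<phi>, folded g_def]
  have "P * (Q * T) = T" "(1 - g + g * g) * ((1 + g) * T) = T" for T
    by (simp_all only: mult.assoc [symmetric] PQ gi mult_1)
  then have PQ': "P' * Q' = 1" "Q' * P' = 1"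
    by (simp_all only: P'_def Q'_def mult.assoc gi PQ)
  have conj: "cong_base R (P' * \<rho> X * Q') (poly_rep \<phi> X)" for X
    using cong_base_mult [OF cong_base_mult [OF cong_base_refl [of R "1 + g"] N [of X]] cong_base_refl [of R "1 - g + g * g"]]
    by (simp only: P'_def Q'_def poly_rep_def g_def mult.assoc)
  have "hom_part 0 g = 0" by (simp add: g_def hom_part_lincomb \<phi>) (simp add: lincomb_def embed_hom)
  then have "hom_part 0 P' = 1" by (simp add: P'_def hom_part_zero_mult PQ hom_part_one)
  from is_rep_conj [OF rep PQ' this] have brP: "cong_base R (P' * \<rho> X * Q' * (P' * \<rho> Y * Q') - P' * \<rho> Y * Q' * (P' * \<rho> X * Q'))
      (P' * \<rho> (vect_bracket X Y) * Q')" for X Y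
    by (simp add: is_rep_def)
  \<comment> \<open>The variables themselves are the new parameters; substituting \<phi> for them
    gives \<open>poly_rep \<phi>\<close>, which is conjugate to \<rho> modulo R.\<close>
  let ?\<rho> = "poly_rep mvar"
  have bracket: "cong_base (relations_between \<phi> R) (?\<rho> X * ?\<rho> Y - ?\<rho> Y * ?\<rho> X) (?\<rho> (vect_bracket X Y))" for X Y
    unfolding cong_base_def
  proof (rule generated_by_relations_between [OF R \<phi>(1)])
    \<comment> \<open>The transfer of membership to scalar coefficients works with finitely many
      coefficients; 6 bounds the products of two factors of degree 3.\<close>
    show "pdeg 6 (?\<rho> X * ?\<rho> Y - ?\<rho> Y * ?\<rho> X - ?\<rho> (vect_bracket X Y))"
      using pdeg_mult [OF pdeg_poly_rep pdeg_poly_rep] pdeg_mono [OF pdeg_poly_rep, of 6]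
      by (intro pdeg_arith) simp_all
    have "cong_base R (poly_rep \<phi> X * poly_rep \<phi> Y - poly_rep \<phi> Y * poly_rep \<phi> X)
       (P' * \<rho> X * Q' * (P' * \<rho> Y * Q') - P' * \<rho> Y * Q' * (P' * \<rho> X * Q'))"
      by (intro cong_base_diff cong_base_mult cong_base_sym [OF conj])
    also note brP
    also note conj
    finally show "subst_endo \<phi> (?\<rho> X * ?\<rho> Y - ?\<rho> Y * ?\<rho> X - ?\<rho> (vect_bracket X Y)) \<in> generated_by R"
      by (simp add: cong_base_def subst_diff [OF \<phi>(1)] subst_endo_hom [OF \<phi>(1)] subst_endo_poly_rep [OF \<phi>(1)])
  qed
  show ?thesis
  proof (intro exI conjI)
    show "parameter_system \<phi>" by (simp add: parameter_system_def \<phi> del: One_nat_def)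
    show "formal_deformation (relations_between \<phi> R) ?\<rho>"
      using diff_op_series_poly_rep bracket
      by (simp add: formal_deformation_def is_ideal_relations_between [OF \<phi>(1) R] poly_rep_arith hom_part_poly_rep
          diff_op_series_def del: One_nat_def)
    show "polynomial_of_degree_le 3 ?\<rho>"
      using pdeg_poly_rep by (simp add: polynomial_of_degree_le_def pdeg_def)
    show "equivalent_deformations R \<rho> (\<lambda>X. subst_endo \<phi> (?\<rho> X))"
      unfolding equivalent_deformations_def
      using PQ' conj by (intro exI [of _ P'] exI [of _ Q']) (simp add: cong_base_refl subst_endo_poly_rep [OF \<phi>(1)])
  qed
qed

end
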